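(* Let $Q$ be a Dynkin quiver, let $P$ be a projective and $I$ an injective finite-dimensional representation of $Q$ over $\mathbb{C}$, let $M=P\oplus I$, $\mathbf{e}=\mathbf{dim}\,P$ and $X=\mathrm{Gr}_{\mathbf{e}}(M)$, and let $T=\mathbb{C}^*$ act on $X$ via the degree function $d$ described in the context. For every $T$-fixed point $L\in X^T$, its attracting set $$\mathcal{C}(L)=\{N\in X:\ \lim_{\lambda\to0}\lambda\cdot N=L\}$$ is an affine space isomorphic to $\mathrm{Hom}_Q(L,M/L)^+$. In particular, there is a cellular decomposition $X=\coprod_{L\in X^T}\mathcal{C}(L)$. Moreover, writing $L_I=L\cap I$, $L_P=\pi(L)$ (with $\pi:P\oplus I\to P$ the projection), $\mathbf{f}=\mathbf{dim}\,L_I$, and letting $\mathcal{C}(L_I)\subset\mathrm{Gr}_{\mathbf{f}}(I)$ and $\mathcal{C}(L_P)\subset\mathrm{Gr}_{\mathbf{e}-\mathbf{f}}(P)$ denote the attracting sets (for $\lambda\to 0$) of $L_I$ and $L_P$, one has $$\mathcal{C}(L)=\zeta^{-1}(\mathcal{C}(L_I)\times\mathcal{C}(L_P))\simeq\mathcal{C}(L_I)\times\mathcal{C}(L_P)\times\mathrm{Hom}_Q(L_P,I/L_I).$$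
   Context: A Dynkin quiver is a quiver whose underlying graph is a simply laced Dynkin diagram. Representations are finite-dimensional over $\mathbb{C}$. The quiver Grassmannian $\mathrm{Gr}_{\mathbf{e}}(M)\subset\prod_i\mathrm{Gr}_{e_i}(M_i)$ parametrizes subrepresentations of $M$ of dimension vector $\mathbf{e}$. Fix decompositions of $P$ and $I$ into indecomposable direct summands. Each of these is thin (its space at every vertex is at most one-dimensional); choosing a generator of each of these one-dimensional spaces gives a linear basis $\mathbf{B}$ of $M=P\oplus I$. To each indecomposable summand $L'$ of $M$ assign an integer degree $d(L')$ such that: all degrees are pairwise distinct; $d(L')<d(L'')$ whenever $L'\not\simeq L''$ and $\mathrm{Hom}_Q(L',L'')\ne0$; and every summand of $I$ has strictly larger degree than every summand of $P$. Every $v\in\mathbf{B}$ lying in the summand $L'$ gets degree $d(v)=d(L')$. The torus $T=\mathbb{C}^*$ acts linearly on $M$ by $\lambda\cdot v=\lambda^{d(v)}v$ for $v\in\mathbf{B}$, and this induces actions on $X$, $\mathrm{Gr}_{\mathbf{f}}(I)$ and $\mathrm{Gr}_{\mathbf{e}-\mathbf{f}}(P)$. The finite fixed point set $X^T$ consists of the subrepresentations in $X$ spanned by subsets of $\mathbf{B}$. For $L\in X^T$, $L$ and $M/L$ are graded by degree, and $\mathrm{Hom}_Q(L,M/L)$ has a basis of homogeneous elements, an element having degree $k$ if it sends vectors of degree $a$ to vectors of degree $a+k$; $\mathrm{Hom}_Q(L,M/L)^+$ is the subspace spanned by homogeneous elements of positive degree. For a dimension vector $\mathbf{f}$, let $\mathcal{S}_{\mathbf{f}}=\{N\in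 X:\mathbf{dim}(N\cap I)=\mathbf{f},\ \mathbf{dim}\,\pi(N)=\mathbf{e}-\mathbf{f}\}$ and $\zeta:\mathcal{S}_{\mathbf{f}}\to\mathrm{Gr}_{\mathbf{f}}(I)\times\mathrm{Gr}_{\mathbf{e}-\mathbf{f}}(P)$, $N\mapsto(N\cap I,\pi(N))$. *)

theory Defs
  imports
    "HOL-Analysis.Analysis"
    "HOL-Library.Function_Algebras"
    "Graph_Theory.Digraph"
begin

section \<open>Complex vector spaces\<close>

class complex_vector = ab_group_add +
  fixes scaleC :: "complex \<Rightarrow> 'a \<Rightarrow> 'a" (infixr \<open>*\<^sub>C\<close> 75)
  assumes scaleC_add_right: "a *\<^sub>C (x + y) = a *\<^sub>C x + a *\<^sub>C y"
    and scaleC_add_left: "(a + b) *\<^sub>C x = a *\<^sub>C x + b *\<^sub>C x"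
    and scaleC_scaleC: "a *\<^sub>C b *\<^sub>C x = (a * b) *\<^sub>C x"
    and scaleC_one: "1 *\<^sub>C x = x"

interpretation cvec: vector_space "scaleC :: complex \<Rightarrow> 'a \<Rightarrow> 'a::complex_vector"
  by unfold_locales (simp_all add: scaleC_add_right scaleC_add_left scaleC_scaleC scaleC_one)

instantiation complex :: complex_vector
begin
definition scaleC_complex :: "complex \<Rightarrow> complex \<Rightarrow> complex" where
  "scaleC_complex a x = a * x"
instance
  by standard (simp_all add: scaleC_complex_def algebra_simps)
end

instantiation "fun" :: (type, complex_vector) complex_vector
begin
definition scaleC_fun :: "complex \<Rightarrow> ('a \<Rightarrow> 'b) \<Rightarrow> 'a \<Rightarrow> 'b" where
  "scaleC_fun a f = (\<lambda>x. a *\<^sub>C f x)"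
instance
  by standard
    (simp_all add: scaleC_fun_def fun_eq_iff scaleC_add_right scaleC_add_left scaleC_scaleC scaleC_one)
end

instantiation prod :: (complex_vector, complex_vector) complex_vector
begin
definition scaleC_prod :: "complex \<Rightarrow> 'a \<times> 'b \<Rightarrow> 'a \<times> 'b" where
  "scaleC_prod a x = (a *\<^sub>C fst x, a *\<^sub>C snd x)"
instance
  by standard
    (simp_all add: scaleC_prod_def prod_eq_iff scaleC_add_right scaleC_add_left scaleC_scaleC scaleC_one)
end

definition clinear_on :: "'m::complex_vector set \<Rightarrow> ('m \<Rightarrow> 'n::complex_vector) \<Rightarrow> bool" where
  "clinear_on A f \<longleftrightarrow>
     (\<forall>x\<in>A. \<forall>y\<in>A. f (x + y) = f x + f y) \<and> (\<forall>c. \<forall>x\<in>A. f (c *\<^sub>C x) = c *\<^sub>C f x)"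


section \<open>Algebraic varieties\<close>

text \<open>Polynomial functions. Their restrictions to a finite-dimensional subspace are the polynomial
  functions on that subspace.\<close>

inductive polyfun :: "('e::complex_vector \<Rightarrow> complex) \<Rightarrow> bool" where
  polyfun_linear: "Vector_Spaces.linear scaleC scaleC f \<Longrightarrow> polyfun f"
| polyfun_const: "polyfun (\<lambda>_. c)"
| polyfun_add: "polyfun f \<Longrightarrow> polyfun g \<Longrightarrow> polyfun (\<lambda>x. f x + g x)"
| polyfun_mult: "polyfun f \<Longrightarrow> polyfun g \<Longrightarrow> polyfun (\<lambda>x. f x * g x)"

text \<open>
  A variety is presented by a pair \<open>(F, q)\<close>: a subset \<open>F\<close> of a finite-dimensional vector space and a
  parametrization \<open>q\<close> of the points of the variety by \<open>F\<close>. Topology and regular functions are those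
  of the quotient of \<open>F\<close>. For the frame bundle of a Grassmannian, which is Zariski-locally trivial,
  this is the usual structure of the Grassmannian (and the reduced induced one over a locally
  closed subset); for \<open>q = id\<close> it is that of a locally closed subset of affine space.
\<close>

type_synonym ('e, 'x) pvariety = "'e set \<times> ('e \<Rightarrow> 'x)"

definition points :: "('e, 'x) pvariety \<Rightarrow> 'x set" where
  "points X = snd X ` fst X"

definition zariski_open :: "('e::complex_vector, 'x) pvariety \<Rightarrow> 'x set \<Rightarrow> bool" where
  "zariski_open X U \<longleftrightarrow> U \<subseteq> points X \<and>
     (\<exists>\<P>. (\<forall>p\<in>\<P>. polyfun p) \<and> (\<forall>u\<in>fst X. snd X u \<in> U \<longleftrightarrow> (\<exists>p\<in>\<P>. p u \<noteq> 0)))"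

definition zariski :: "('e::complex_vector, 'x) pvariety \<Rightarrow> 'x topology" where
  "zariski X = topology (zariski_open X)"

lemma istopology_zariski_open: "istopology (zariski_open X)"
  unfolding istopology_def
proof (intro conjI allI impI)
  fix S T assume S: "zariski_open X S" and T: "zariski_open X T"
  obtain \<P> where
    P: "\<forall>p\<in>\<P>. polyfun p" "\<forall>u\<in>fst X. snd X u \<in> S \<longleftrightarrow> (\<exists>p\<in>\<P>. p u \<noteq> 0)"
    using S unfolding zariski_open_def by (elim conjE exE) (rule that)
  obtain \<Q> where
    Q: "\<forall>p\<in>\<Q>. polyfun p" "\<forall>u\<in>fst X. snd X u \<in> T \<longleftrightarrow> (\<exists>p\<in>\<Q>. p u \<noteq> 0)"
    using T unfolding zariski_open_def by (elim conjE exE) (rule that)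
  let ?R = "(\<lambda>(p, g) x. p x * g x) ` (\<P> \<times> \<Q>)"
  have "\<forall>r\<in>?R. polyfun r" using P(1) Q(1) by (auto intro: polyfun_mult)
  moreover have "\<forall>u\<in>fst X. snd X u \<in> S \<inter> T \<longleftrightarrow> (\<exists>p\<in>?R. p u \<noteq> 0)"
    using P(2) Q(2) by fastforce
  moreover have "S \<inter> T \<subseteq> points X" using S unfolding zariski_open_def by auto
  ultimately show "zariski_open X (S \<inter> T)" unfolding zariski_open_def by blast
next
  fix \<K> assume K: "\<forall>S\<in>\<K>. zariski_open X S"
  then have "\<forall>S\<in>\<K>. \<exists>\<P>. (\<forall>p\<in>\<P>. polyfun p) \<and> (\<forall>u\<in>fst X. snd X u \<in> S \<longleftrightarrow> (\<exists>p\<in>\<P>. p u \<noteq> 0))"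
    unfolding zariski_open_def by blast
  then obtain \<P> where P: "\<forall>S\<in>\<K>. (\<forall>p\<in>\<P> S. polyfun p) \<and>
      (\<forall>u\<in>fst X. snd X u \<in> S \<longleftrightarrow> (\<exists>p\<in>\<P> S. p u \<noteq> 0))"
    by metis
  have "\<Union>\<K> \<subseteq> points X" using K unfolding zariski_open_def by auto
  moreover have "\<forall>p\<in>\<Union>(\<P> ` \<K>). polyfun p" using P by blast
  moreover have "\<forall>u\<in>fst X. snd X u \<in> \<Union>\<K> \<longleftrightarrow> (\<exists>p\<in>\<Union>(\<P> ` \<K>). p u \<noteq> 0)"
    using P by (simp add: Bex_def) blast
  ultimately show "zariski_open X (\<Union>\<K>)" unfolding zariski_open_def by blast
qed

lemma openin_zariski: "openin (zariski X) U \<longleftrightarrow> zariski_open X U"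
  by (simp add: zariski_def istopology_zariski_open)

lemma topspace_zariski: "topspace (zariski X) = points X"
proof -
  have "zariski_open X (points X)"
    unfolding zariski_open_def points_def
    by (intro conjI exI[of _ "{\<lambda>_. 1}"]) (auto intro: polyfun_const)
  then show ?thesis
    unfolding topspace_def openin_zariski by (auto simp: zariski_open_def)
qed

definition regular_on :: "('e::complex_vector, 'x) pvariety \<Rightarrow> 'x set \<Rightarrow> ('x \<Rightarrow> complex) \<Rightarrow> bool" where
  "regular_on X U f \<longleftrightarrow>
     (\<forall>u\<in>fst X. snd X u \<in> U \<longrightarrow>
        (\<exists>p g. polyfun p \<and> polyfun g \<and> g u \<noteq> 0 \<and>
           (\<forall>w\<in>fst X. snd X w \<in> U \<and> g w \<noteq> 0 \<longrightarrow> f (snd X w) = p w / g w)))"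

definition morphism ::
    "('e::complex_vector, 'x) pvariety \<Rightarrow> ('f::complex_vector, 'y) pvariety \<Rightarrow> ('x \<Rightarrow> 'y) \<Rightarrow> bool" where
  "morphism X Y h \<longleftrightarrow> continuous_map (zariski X) (zariski Y) h \<and>
     (\<forall>U f. openin (zariski Y) U \<and> regular_on Y U f \<longrightarrow>
        regular_on X {x \<in> points X. h x \<in> U} (f \<circ> h))"

definition isomorphic_var ::
    "('e::complex_vector, 'x) pvariety \<Rightarrow> ('f::complex_vector, 'y) pvariety \<Rightarrow> bool" where
  "isomorphic_var X Y \<longleftrightarrow>
     (\<exists>h. bij_betw h (points X) (points Y) \<and> morphism X Y h \<and> morphism Y X (inv_into (points X) h))"

definition subvar :: "('e, 'x) pvariety \<Rightarrow> 'x set \<Rightarrow> ('e, 'x) pvariety" where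
  "subvar X Z = ({u \<in> fst X. snd X u \<in> Z}, snd X)"

definition prod_var :: "('e, 'x) pvariety \<Rightarrow> ('f, 'y) pvariety \<Rightarrow> ('e \<times> 'f, 'x \<times> 'y) pvariety" where
  "prod_var X Y = (fst X \<times> fst Y, map_prod (snd X) (snd Y))"

definition affine_var :: "'e set \<Rightarrow> ('e, 'e) pvariety" where
  "affine_var A = (A, id)"

definition affine_space :: "nat \<Rightarrow> (nat \<Rightarrow> complex, nat \<Rightarrow> complex) pvariety" where
  "affine_space n = affine_var {x. \<forall>j\<ge>n. x j = 0}"

text \<open>A cellular decomposition: a finite partition into affine spaces for which the cells can be
  ordered so that the initial unions form a filtration by closed subsets. In particular every cell
  is locally closed.\<close>

definition cellular_decomposition ::
    "('e::complex_vector, 'x) pvariety \<Rightarrow> 'l set \<Rightarrow> ('l \<Rightarrow> 'x set) \<Rightarrow> bool" where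
  "cellular_decomposition X A C \<longleftrightarrow>
     finite A \<and> disjoint_family_on C A \<and> (\<Union>l\<in>A. C l) = points X \<and>
     (\<forall>l\<in>A. \<exists>n. isomorphic_var (subvar X (C l)) (affine_space n)) \<and>
     (\<exists>ls. distinct ls \<and> set ls = A \<and>
        (\<forall>j\<le>length ls. closedin (zariski X) (\<Union>l\<in>set (take j ls). C l)))"


section \<open>Dynkin quivers and their representations\<close>

text \<open>The edge sets of the diagrams of type A, D and E on the vertices \<open>0, ..., n - 1\<close>.\<close>

inductive dynkin_diagram :: "nat \<Rightarrow> nat set set \<Rightarrow> bool" where
  type_A: "n \<ge> 1 \<Longrightarrow> dynkin_diagram n {{i, i + 1} |i. i + 1 < n}"
| type_D: "n \<ge> 4 \<Longrightarrow> dynkin_diagram n (insert {n - 3, n - 1} {{i, i + 1} |i. i + 2 < n})"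
| type_E: "n \<in> {6, 7, 8} \<Longrightarrow> dynkin_diagram n (insert {2, n - 1} {{i, i + 1} |i. i + 2 < n})"

definition dynkin_quiver :: "('v, 'a) pre_digraph \<Rightarrow> bool" where
  "dynkin_quiver Q \<longleftrightarrow> wf_digraph Q \<and>
     (\<exists>n E \<sigma>. dynkin_diagram n E \<and> bij_betw \<sigma> (verts Q) {..<n} \<and>
        bij_betw (\<lambda>a. {\<sigma> (tail Q a), \<sigma> (head Q a)}) (arcs Q) E)"

record ('v, 'a, 'm) qrep =
  sp :: "'v \<Rightarrow> 'm set"
  act :: "'a \<Rightarrow> 'm \<Rightarrow> 'm"

text \<open>Finite-dimensional representations. Spaces at indices outside \<open>verts Q\<close> are zero by convention,
  so that subrepresentations and morphisms need no further normalization there.\<close>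

definition representation :: "('v, 'a) pre_digraph \<Rightarrow> ('v, 'a, 'm::complex_vector) qrep \<Rightarrow> bool" where
  "representation Q V \<longleftrightarrow>
     (\<forall>i. \<exists>B. finite B \<and> sp V i = cvec.span B) \<and>
     (\<forall>i. i \<notin> verts Q \<longrightarrow> sp V i = {0}) \<and>
     (\<forall>a\<in>arcs Q. clinear_on (sp V (tail Q a)) (act V a) \<and>
        act V a ` sp V (tail Q a) \<subseteq> sp V (head Q a))"

definition dimv :: "('v \<Rightarrow> 'm::complex_vector set) \<Rightarrow> 'v \<Rightarrow> nat" where
  "dimv N = (\<lambda>i. cvec.dim (N i))"

definition subrep ::
    "('v, 'a) pre_digraph \<Rightarrow> ('v, 'a, 'm::complex_vector) qrep \<Rightarrow> ('v \<Rightarrow> 'm set) \<Rightarrow> bool" where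
  "subrep Q V N \<longleftrightarrow> (\<forall>i. cvec.subspace (N i) \<and> N i \<subseteq> sp V i) \<and>
     (\<forall>a\<in>arcs Q. act V a ` N (tail Q a) \<subseteq> N (head Q a))"

definition rep_of :: "('v, 'a, 'm) qrep \<Rightarrow> ('v \<Rightarrow> 'm set) \<Rightarrow> ('v, 'a, 'm) qrep" where
  "rep_of V N = V\<lparr>sp := N\<rparr>"

text \<open>Morphisms are extended by zero outside the spaces of the source, so that \<open>rep_hom Q V W\<close> is a
  finite-dimensional subspace of the function space.\<close>

definition rep_hom ::
    "('v, 'a) pre_digraph \<Rightarrow> ('v, 'a, 'm::complex_vector) qrep \<Rightarrow> ('v, 'a, 'n::complex_vector) qrep
      \<Rightarrow> ('v \<Rightarrow> 'm \<Rightarrow> 'n) set" where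
  "rep_hom Q V W = {\<phi>.
     (\<forall>i. clinear_on (sp V i) (\<phi> i) \<and> \<phi> i ` sp V i \<subseteq> sp W i \<and> (\<forall>x. x \<notin> sp V i \<longrightarrow> \<phi> i x = 0)) \<and>
     (\<forall>a\<in>arcs Q. \<forall>x\<in>sp V (tail Q a). \<phi> (head Q a) (act V a x) = act W a (\<phi> (tail Q a) x))}"

definition rep_iso ::
    "('v, 'a) pre_digraph \<Rightarrow> ('v, 'a, 'm::complex_vector) qrep \<Rightarrow> ('v, 'a, 'n::complex_vector) qrep
      \<Rightarrow> bool" where
  "rep_iso Q V W \<longleftrightarrow> (\<exists>\<phi>\<in>rep_hom Q V W. \<forall>i. bij_betw (\<phi> i) (sp V i) (sp W i))"

text \<open>Lifting and extension properties in the category of finite-dimensional representations; every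
  such representation is isomorphic to one on subspaces of \<open>nat \<Rightarrow> complex\<close>.\<close>

definition projective :: "('v, 'a) pre_digraph \<Rightarrow> ('v, 'a, 'm::complex_vector) qrep \<Rightarrow> bool" where
  "projective Q V \<longleftrightarrow>
     (\<forall>(X :: ('v, 'a, nat \<Rightarrow> complex) qrep) (Y :: ('v, 'a, nat \<Rightarrow> complex) qrep) g f.
        representation Q X \<and> representation Q Y \<and> g \<in> rep_hom Q X Y \<and> (\<forall>i. g i ` sp X i = sp Y i) \<and>
        f \<in> rep_hom Q V Y \<longrightarrow>
        (\<exists>h\<in>rep_hom Q V X. \<forall>i. \<forall>x\<in>sp V i. g i (h i x) = f i x))"

definition injective :: "('v, 'a) pre_digraph \<Rightarrow> ('v, 'a, 'm::complex_vector) qrep \<Rightarrow> bool" where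
  "injective Q V \<longleftrightarrow>
     (\<forall>(X :: ('v, 'a, nat \<Rightarrow> complex) qrep) (Y :: ('v, 'a, nat \<Rightarrow> complex) qrep) g f.
        representation Q X \<and> representation Q Y \<and> g \<in> rep_hom Q X Y \<and> (\<forall>i. inj_on (g i) (sp X i)) \<and>
        f \<in> rep_hom Q X V \<longrightarrow>
        (\<exists>h\<in>rep_hom Q Y V. \<forall>i. \<forall>x\<in>sp X i. h i (g i x) = f i x))"

text \<open>\<open>V\<close> is the internal direct sum of the subrepresentations \<open>S k\<close>, \<open>k \<in> K\<close>.\<close>

definition direct_sum ::
    "('v, 'a) pre_digraph \<Rightarrow> ('v, 'a, 'm::complex_vector) qrep \<Rightarrow> 'k set \<Rightarrow> ('k \<Rightarrow> 'v \<Rightarrow> 'm set) \<Rightarrow> bool" where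
  "direct_sum Q V K S \<longleftrightarrow> finite K \<and> (\<forall>k\<in>K. subrep Q V (S k)) \<and>
     (\<forall>i. \<forall>x\<in>sp V i. \<exists>!c. (\<forall>k\<in>K. c k \<in> S k i) \<and> (\<forall>k. k \<notin> K \<longrightarrow> c k = 0) \<and> x = (\<Sum>k\<in>K. c k))"

definition direct_sum2 ::
    "('v, 'a) pre_digraph \<Rightarrow> ('v, 'a, 'm::complex_vector) qrep \<Rightarrow> ('v \<Rightarrow> 'm set) \<Rightarrow> ('v \<Rightarrow> 'm set) \<Rightarrow> bool" where
  "direct_sum2 Q V A B \<longleftrightarrow> direct_sum Q V UNIV (\<lambda>k::bool. if k then A else B)"

definition indecomposable :: "('v, 'a) pre_digraph \<Rightarrow> ('v, 'a, 'm::complex_vector) qrep \<Rightarrow> bool" where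
  "indecomposable Q V \<longleftrightarrow> sp V \<noteq> (\<lambda>_. {0}) \<and>
     (\<forall>A B. direct_sum2 Q V A B \<longrightarrow> A = (\<lambda>_. {0}) \<or> B = (\<lambda>_. {0}))"

text \<open>\<open>W\<close> together with the projection \<open>q\<close> is a quotient of \<open>V\<close> by the subrepresentation \<open>N\<close>,
  i.e. \<open>0 \<rightarrow> N \<rightarrow> V \<rightarrow> W \<rightarrow> 0\<close> is exact.\<close>

definition is_quotient ::
    "('v, 'a) pre_digraph \<Rightarrow> ('v, 'a, 'm::complex_vector) qrep \<Rightarrow> ('v \<Rightarrow> 'm set)
      \<Rightarrow> ('v, 'a, 'n::complex_vector) qrep \<Rightarrow> ('v \<Rightarrow> 'm \<Rightarrow> 'n) \<Rightarrow> bool" where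
  "is_quotient Q V N W q \<longleftrightarrow> representation Q W \<and> q \<in> rep_hom Q V W \<and>
     (\<forall>i. q i ` sp V i = sp W i \<and> {x \<in> sp V i. q i x = 0} = N i)"

lemma clinear_onD:
  "clinear_on A f \<Longrightarrow> x \<in> A \<Longrightarrow> y \<in> A \<Longrightarrow> f (x + y) = f x + f y"
  "clinear_on A f \<Longrightarrow> x \<in> A \<Longrightarrow> f (c *\<^sub>C x) = c *\<^sub>C f x"
  by (auto simp: clinear_on_def)

lemma ex_quotient:
  fixes V :: "('v, 'a, 'm::complex_vector) qrep"
  assumes V: "representation Q V" and N: "subrep Q V N"
  shows "\<exists>(W :: ('v, 'a, 'm) qrep) q. is_quotient Q V N W q"
proof -
  interpret vp: vector_space_pair "scaleC :: complex \<Rightarrow> 'm \<Rightarrow> 'm" "scaleC :: complex \<Rightarrow> 'm \<Rightarrow> 'm"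
    by unfold_locales
  have sN: "cvec.subspace (N i)" and NV: "N i \<subseteq> sp V i" for i
    using N by (auto simp: subrep_def)
  have sV: "cvec.subspace (sp V i)" for i
    using V unfolding representation_def by (metis cvec.subspace_span)
  have "\<exists>p. p ` UNIV \<subseteq> N i \<and> Vector_Spaces.linear scaleC scaleC p \<and> (\<forall>x\<in>N i. p x = x)" for i
    using vp.linear_exists_left_inverse_on[of id "N i"] sN[of i] cvec.linear_id by (auto simp: id_def)
  then obtain p where pN: "\<And>i x. p i x \<in> N i"
    and pl: "\<And>i. Vector_Spaces.linear scaleC scaleC (p i)"
    and pid: "\<And>i x. x \<in> N i \<Longrightarrow> p i x = x"
    by (metis rangeI subsetD)
  have padd: "p i (x + y) = p i x + p i y" and psc: "p i (c *\<^sub>C x) = c *\<^sub>C p i x" for i x y c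
    using pl[of i] by (auto simp: Vector_Spaces.linear_iff)
  have pV: "p i x \<in> sp V i" for i x using pN NV by blast
  define r where "r i x = x - p i x" for i x
  define q where "q i x = (if x \<in> sp V i then r i x else 0)" for i x
  define W where "W = \<lparr>sp = (\<lambda>i. r i ` sp V i), act = (\<lambda>a x. r (head Q a) (act V a x))\<rparr>"
  have radd: "r i (x + y) = r i x + r i y" and rsc: "r i (c *\<^sub>C x) = c *\<^sub>C r i x" for i x y c
    by (simp_all add: r_def padd psc cvec.scale_right_diff_distrib)
  have rl: "Vector_Spaces.linear scaleC scaleC (r i)" for i
    using radd rsc pl[of i] by (simp add: Vector_Spaces.linear_iff)
  have r0: "r i x = 0 \<longleftrightarrow> x \<in> N i" for i x
    using pN[of i x] pid[of x i] by (auto simp: r_def)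
  have rV: "x \<in> sp V i \<Longrightarrow> r i x \<in> sp V i" for i x
    using pV[of i x] sV[of i] by (simp add: r_def cvec.subspace_diff)
  have actl: "clinear_on (sp V (tail Q a)) (act V a)"
    and actV: "\<And>x. x \<in> sp V (tail Q a) \<Longrightarrow> act V a x \<in> sp V (head Q a)"
    and actN: "\<And>x. x \<in> N (tail Q a) \<Longrightarrow> act V a x \<in> N (head Q a)" if "a \<in> arcs Q" for a
    using V N that by (simp_all add: representation_def subrep_def image_subset_iff)
  have comm: "r (head Q a) (act V a (r (tail Q a) x)) = r (head Q a) (act V a x)"
    if a: "a \<in> arcs Q" and x: "x \<in> sp V (tail Q a)" for a x
  proof -
    have "x = r (tail Q a) x + p (tail Q a) x" by (simp add: r_def)
    then have "act V a x = act V a (r (tail Q a) x) + act V a (p (tail Q a) x)"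
      using clinear_onD(1)[OF actl[OF a] rV[OF x] pV] by metis
    moreover have "r (head Q a) (act V a (p (tail Q a) x)) = 0"
      using actN[OF a pN] by (simp add: r0)
    ultimately show ?thesis by (simp add: radd)
  qed
  have "representation Q W"
    unfolding representation_def
  proof (intro conjI allI ballI impI)
    fix i
    obtain B where B: "finite B" "sp V i = cvec.span B"
      using V unfolding representation_def by blast
    have "sp W i = cvec.span (r i ` B)"
      using vp.linear_span_image[OF rl[of i], of B] B by (simp add: W_def)
    then show "\<exists>B. finite B \<and> sp W i = cvec.span B" using B by blast
  next
    fix i assume "i \<notin> verts Q"
    then have "sp V i = {0}" using V by (auto simp: representation_def)
    then show "sp W i = {0}" using r0[of i 0] sN[of i] by (simp add: W_def cvec.subspace_0)
  next
    fix a assume a: "a \<in> arcs Q"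
    have sub: "sp W (tail Q a) \<subseteq> sp V (tail Q a)" using rV by (auto simp: W_def)
    have A: "act V a (x + y) = act V a x + act V a y" "act V a (c *\<^sub>C x) = c *\<^sub>C act V a x"
      if "x \<in> sp W (tail Q a)" "y \<in> sp W (tail Q a)" for x y c
      using clinear_onD[OF actl[OF a]] that sub by blast+
    show "clinear_on (sp W (tail Q a)) (act W a)"
      unfolding clinear_on_def using A by (auto simp: W_def radd rsc)
    show "act W a ` sp W (tail Q a) \<subseteq> sp W (head Q a)"
      using actV[OF a] rV by (auto simp: W_def)
  qed
  moreover have "q \<in> rep_hom Q V W"
  proof -
    have "clinear_on (sp V i) (q i)" for i
      using sV[of i] by (auto simp: clinear_on_def q_def radd rsc cvec.subspace_add cvec.subspace_scale)
    then show ?thesis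
      using actV comm by (auto simp: rep_hom_def q_def W_def)
  qed
  moreover have "q i ` sp V i = sp W i \<and> {x \<in> sp V i. q i x = 0} = N i" for i
    using NV[of i] r0[of i] by (auto simp: q_def W_def)
  ultimately show ?thesis unfolding is_quotient_def by blast
qed


section \<open>Quiver Grassmannians\<close>

text \<open>Frames: a basis \<open>u i 0, ..., u i (e i - 1)\<close> of an \<open>e i\<close>-dimensional subspace at every vertex
  \<open>i\<close>. Outside the relevant indices, \<open>u\<close> is zero.\<close>

definition frames ::
    "('v, 'a, 'm::complex_vector) qrep \<Rightarrow> ('v \<Rightarrow> nat) \<Rightarrow> ('v \<Rightarrow> nat \<Rightarrow> 'm) set" where
  "frames V e = {u. \<forall>i. (\<forall>j<e i. u i j \<in> sp V i) \<and> (\<forall>j\<ge>e i. u i j = 0) \<and>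
     inj_on (u i) {..<e i} \<and> \<not> cvec.dependent (u i ` {..<e i})}"

definition frame_span :: "('v \<Rightarrow> nat) \<Rightarrow> ('v \<Rightarrow> nat \<Rightarrow> 'm::complex_vector) \<Rightarrow> 'v \<Rightarrow> 'm set" where
  "frame_span e u = (\<lambda>i. cvec.span (u i ` {..<e i}))"

text \<open>The product over all vertices of the ordinary Grassmannians.\<close>

definition grass_var ::
    "('v, 'a, 'm::complex_vector) qrep \<Rightarrow> ('v \<Rightarrow> nat) \<Rightarrow> ('v \<Rightarrow> nat \<Rightarrow> 'm, 'v \<Rightarrow> 'm set) pvariety" where
  "grass_var V e = (frames V e, frame_span e)"

definition quiver_grass ::
    "('v, 'a) pre_digraph \<Rightarrow> ('v, 'a, 'm::complex_vector) qrep \<Rightarrow> ('v \<Rightarrow> nat) \<Rightarrow> ('v \<Rightarrow> 'm set) set" where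
  "quiver_grass Q V e = {N. subrep Q V N \<and> dimv N = e}"

definition quiver_grass_var ::
    "('v, 'a) pre_digraph \<Rightarrow> ('v, 'a, 'm::complex_vector) qrep \<Rightarrow> ('v \<Rightarrow> nat)
      \<Rightarrow> ('v \<Rightarrow> nat \<Rightarrow> 'm, 'v \<Rightarrow> 'm set) pvariety" where
  "quiver_grass_var Q V e = subvar (grass_var V e) (quiver_grass Q V e)"


section \<open>The torus action\<close>

text \<open>The basis consists of the nonzero ones among the vectors \<open>b k i\<close>, where \<open>b k i\<close> generates the
  space of the \<open>k\<close>-th summand at the vertex \<open>i\<close>; \<open>d k\<close> is the degree of the \<open>k\<close>-th summand.\<close>

definition torus_act ::
    "'k set \<Rightarrow> ('k \<Rightarrow> 'v \<Rightarrow> 'm::complex_vector) \<Rightarrow> ('k \<Rightarrow> int) \<Rightarrow> complex \<Rightarrow> 'v \<Rightarrow> 'm \<Rightarrow> 'm" where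
  "torus_act K b d z i x =
     (\<Sum>k\<in>{k \<in> K. b k i \<noteq> 0}.
        cvec.representation {b k i |k. k \<in> K \<and> b k i \<noteq> 0} x (b k i) *\<^sub>C (z powi d k) *\<^sub>C b k i)"

text \<open>In the following, \<open>t z i\<close> is the action of the scalar \<open>z\<close> on the space at the vertex \<open>i\<close>.\<close>

definition translate :: "(complex \<Rightarrow> 'v \<Rightarrow> 'm \<Rightarrow> 'm) \<Rightarrow> complex \<Rightarrow> ('v \<Rightarrow> 'm set) \<Rightarrow> 'v \<Rightarrow> 'm set" where
  "translate t z N = (\<lambda>i. t z i ` N i)"

definition fixed_points ::
    "('v, 'a) pre_digraph \<Rightarrow> ('v, 'a, 'm::complex_vector) qrep \<Rightarrow> ('v \<Rightarrow> nat)
      \<Rightarrow> (complex \<Rightarrow> 'v \<Rightarrow> 'm \<Rightarrow> 'm) \<Rightarrow> ('v \<Rightarrow> 'm set) set" where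
  "fixed_points Q V e t = {L \<in> quiver_grass Q V e. \<forall>z. z \<noteq> 0 \<longrightarrow> translate t z L = L}"

text \<open>The limit for \<open>z \<rightarrow> 0\<close> is the value at \<open>0\<close> of the extension of the orbit map to a morphism
  defined on the affine line.\<close>

definition attracting_set ::
    "('v, 'a) pre_digraph \<Rightarrow> ('v, 'a, 'm::complex_vector) qrep \<Rightarrow> ('v \<Rightarrow> nat)
      \<Rightarrow> (complex \<Rightarrow> 'v \<Rightarrow> 'm \<Rightarrow> 'm) \<Rightarrow> ('v \<Rightarrow> 'm set) \<Rightarrow> ('v \<Rightarrow> 'm set) set" where
  "attracting_set Q V e t L = {N \<in> quiver_grass Q V e.
     \<exists>g. morphism (affine_var (UNIV :: complex set)) (quiver_grass_var Q V e) g \<and>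
       (\<forall>z. z \<noteq> 0 \<longrightarrow> g z = translate t z N) \<and> g 0 = L}"

definition graded_part ::
    "'k set \<Rightarrow> ('k \<Rightarrow> 'v \<Rightarrow> 'm::complex_vector) \<Rightarrow> ('k \<Rightarrow> int) \<Rightarrow> int \<Rightarrow> 'v \<Rightarrow> 'm set" where
  "graded_part K b d n i = cvec.span {b k i |k. k \<in> K \<and> d k = n}"

text \<open>For a subrepresentation \<open>L\<close> of \<open>V\<close> and a quotient \<open>W\<close> of \<open>V\<close> with projection \<open>q\<close>, and a grading
  \<open>G\<close> of \<open>V\<close>: the span of the homogeneous morphisms \<open>L \<rightarrow> W\<close> of positive degree, with respect to the
  grading of \<open>L\<close> by its intersections with, and of \<open>W\<close> by the images of, the graded parts of \<open>V\<close>.\<close>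

definition hom_pos ::
    "('v, 'a) pre_digraph \<Rightarrow> ('v, 'a, 'm::complex_vector) qrep \<Rightarrow> (int \<Rightarrow> 'v \<Rightarrow> 'm set) \<Rightarrow> ('v \<Rightarrow> 'm set)
      \<Rightarrow> ('v, 'a, 'n::complex_vector) qrep \<Rightarrow> ('v \<Rightarrow> 'm \<Rightarrow> 'n) \<Rightarrow> ('v \<Rightarrow> 'm \<Rightarrow> 'n) set" where
  "hom_pos Q V G L W q = cvec.span {\<phi> \<in> rep_hom Q (rep_of V L) W.
     \<exists>k>0. \<forall>n i. \<phi> i ` (L i \<inter> G n i) \<subseteq> q i ` G (n + k) i}"


section \<open>The stratification\<close>

definition meet :: "('v \<Rightarrow> 'm set) \<Rightarrow> ('v \<Rightarrow> 'm set) \<Rightarrow> 'v \<Rightarrow> 'm set" where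
  "meet N I = (\<lambda>i. N i \<inter> I i)"

text \<open>The image of \<open>N\<close> under the projection to \<open>P\<close> along \<open>I\<close>.\<close>

definition proj_along ::
    "('v \<Rightarrow> 'm::complex_vector set) \<Rightarrow> ('v \<Rightarrow> 'm set) \<Rightarrow> ('v \<Rightarrow> 'm set) \<Rightarrow> 'v \<Rightarrow> 'm set" where
  "proj_along P I N = (\<lambda>i. {x \<in> P i. \<exists>y\<in>I i. x + y \<in> N i})"

definition zeta ::
    "('v \<Rightarrow> 'm::complex_vector set) \<Rightarrow> ('v \<Rightarrow> 'm set) \<Rightarrow> ('v \<Rightarrow> 'm set) \<Rightarrow> ('v \<Rightarrow> 'm set) \<times> ('v \<Rightarrow> 'm set)" where
  "zeta P I N = (meet N I, proj_along P I N)"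

definition stratum ::
    "('v, 'a) pre_digraph \<Rightarrow> ('v, 'a, 'm::complex_vector) qrep \<Rightarrow> ('v \<Rightarrow> 'm set) \<Rightarrow> ('v \<Rightarrow> 'm set)
      \<Rightarrow> ('v \<Rightarrow> nat) \<Rightarrow> ('v \<Rightarrow> nat) \<Rightarrow> ('v \<Rightarrow> 'm set) set" where
  "stratum Q V P I e f = {N \<in> quiver_grass Q V e.
     dimv (meet N I) = f \<and> dimv (proj_along P I N) = (\<lambda>i. e i - f i)}"

end

theory Submission
  imports "Jordan_Normal_Form.Determinant" Defs
begin

text \<open>
  In the basis \<open>\<^bold>B\<close> every arrow acts diagonally, so a fixed point \<open>L\<close> is spanned by a part of \<open>\<^bold>B\<close>, and the
  subspaces attracted to \<open>L\<close> are the graphs of the linear maps \<open>x\<close> of positive degree from \<open>L\<close> to the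
  span of the rest of \<open>\<^bold>B\<close>: this is the reduced echelon form with respect to the degree. Such a graph is a
  subrepresentation iff \<open>\<delta> x = q(x)\<close>, where \<open>\<delta>\<close> is the linear map with kernel \<open>Hom(L, M/L)\<close> and cokernel
  \<open>Ext\<^sup>1(L, M/L)\<close> and \<open>q\<close> is quadratic. As all degrees are positive, the degree \<open>k\<close> part of \<open>q(x)\<close> involves
  only parts of \<open>x\<close> of degree less than \<open>k\<close>. Since \<open>P\<close> is projective, \<open>I\<close> is injective and the degrees on \<open>I\<close>
  exceed those on \<open>P\<close>, the positive part of \<open>Ext\<^sup>1(L, M/L)\<close> vanishes; hence the equations can be solved
  recursively, with a free parameter in \<open>Hom(L, M/L)\<^sup>+\<close>. The same argument applies to \<open>I\<close> and to \<open>P\<close>, and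
  \<open>Hom(L, M/L)\<^sup>+\<close> splits accordingly.
\<close>


section \<open>Regular maps\<close>

text \<open>Source of the vanishing: a pair with \<open>d l < d k\<close> has \<open>l\<close> in P
  or \<open>k\<close> in I, as otherwise the degrees would be ordered the other way. A quiver has no
  relations, so every family of scalars on the arrows is a cocycle. One given on the part of L in a
  summand of P extends, with any values, to the whole summand, where projectivity splits it; dually,
  values in the part of M/L in a summand of I lift to the whole summand, where injectivity splits.
  The isomorphisms must be regular in both directions, and a Grassmannian is only known through its
  frames. All maps are therefore given on frames and coordinates: Cramer's rule yields the entries
  of a graph from a frame, and the inverse of the linearization is a fixed point iteration that is
  stationary after finitely many steps, hence polynomial. No entry of positive degree leads from I
  to P. The equations of the blocks inside P and inside I thus close up, and the block from P to I,
  where every degree is positive, contributes the entire Hom(L_P, I/L_I).\<close>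

lemma polyfun_uminus: "polyfun f \<Longrightarrow> polyfun (\<lambda>x. - f x)"
  using polyfun_mult[OF polyfun_const[of "-1"], of f] by simp

lemma polyfun_sum: "(\<And>i. i \<in> A \<Longrightarrow> polyfun (f i)) \<Longrightarrow> polyfun (\<lambda>x. \<Sum>i\<in>A. f i x)"
  by (induction A rule: infinite_finite_induct) (auto intro: polyfun_const polyfun_add)

lemma polyfun_prod: "(\<And>i. i \<in> A \<Longrightarrow> polyfun (f i)) \<Longrightarrow> polyfun (\<lambda>x. \<Prod>i\<in>A. f i x)"
  by (induction A rule: infinite_finite_induct) (auto intro: polyfun_const polyfun_mult)

lemma polyfun_diff: "polyfun f \<Longrightarrow> polyfun g \<Longrightarrow> polyfun (\<lambda>x. f x - g x)"
  using polyfun_add[OF _ polyfun_uminus, of f g] by simp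

lemma polyfun_power: "polyfun f \<Longrightarrow> polyfun (\<lambda>x. f x ^ n)"
  by (induction n) (auto intro: polyfun_const polyfun_mult)

lemma scaleC_complex: "a *\<^sub>C x = a * (x::complex)"
  by (simp add: scaleC_complex_def)

lemma scaleC_fun: "(a *\<^sub>C f) i = a *\<^sub>C f i"
  by (simp add: scaleC_fun_def)

lemma linearI:
  fixes f :: "'a::complex_vector \<Rightarrow> 'b::complex_vector"
  assumes "\<And>x y. f (x + y) = f x + f y" "\<And>c x. f (c *\<^sub>C x) = c *\<^sub>C f x"
  shows "Vector_Spaces.linear scaleC scaleC f"
  using assms by (auto simp: Vector_Spaces.linear_iff cvec.vector_space_axioms)

lemma linearD:
  fixes f :: "'a::complex_vector \<Rightarrow> 'b::complex_vector"
  assumes "Vector_Spaces.linear scaleC scaleC f"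
  shows "f (x + y) = f x + f y" "f (c *\<^sub>C x) = c *\<^sub>C f x" "f 0 = 0"
    "f (x - y) = f x - f y" "f (\<Sum>i\<in>A. g i) = (\<Sum>i\<in>A. f (g i))"
proof -
  interpret l: Vector_Spaces.linear "scaleC :: complex \<Rightarrow> 'a \<Rightarrow> 'a" "scaleC :: complex \<Rightarrow> 'b \<Rightarrow> 'b" f
    by fact
  show "f (x + y) = f x + f y" "f (c *\<^sub>C x) = c *\<^sub>C f x" "f 0 = 0"
    "f (x - y) = f x - f y" "f (\<Sum>i\<in>A. g i) = (\<Sum>i\<in>A. f (g i))"
    by (simp_all add: l.add l.scale l.zero l.diff l.sum)
qed

lemma polyfun_comp_linear:
  assumes "polyfun p" and h: "Vector_Spaces.linear scaleC scaleC h"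
  shows "polyfun (\<lambda>x. p (h x))"
  using assms(1)
proof induction
  case (polyfun_linear f)
  then show ?case
    by (intro polyfun.polyfun_linear linearI) (simp_all add: linearD[OF h] linearD[OF polyfun_linear])
qed (auto intro: polyfun.intros)

lemma polyfun_apply: "polyfun (\<lambda>x::'j \<Rightarrow> complex. x j)"
  by (intro polyfun_linear linearI) (simp_all add: scaleC_fun)

lemma polyfun_comp_apply:
  fixes p :: "'e::complex_vector \<Rightarrow> complex"
  assumes "polyfun p"
  shows "polyfun (\<lambda>x::'i \<Rightarrow> 'e. p (x i))"
  by (rule polyfun_comp_linear[OF assms]) (simp add: linearI scaleC_fun)

text \<open>Bridge from the algebraic limit to analysis: along a curve in one parameter,
  nonvanishing near 0 and comparison of values at 0 are obtained from ordinary limits.\<close>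

lemma isCont_polyfun:
  fixes p :: "complex \<Rightarrow> complex"
  assumes "polyfun p"
  shows "isCont p z"
  using assms
proof induction
  case (polyfun_linear f)
  have "f w = w * f 1" for w
    using linearD(2)[OF polyfun_linear, of w 1] by (simp add: scaleC_complex)
  then have f: "f = (\<lambda>w. w * f 1)" by (rule ext)
  show ?case by (subst f) (intro continuous_intros)
qed (auto intro: continuous_intros)

text \<open>One pair of numerator and denominator serves on all of \<open>A\<close>, in contrast
  with the local pairs of \<open>regular_on\<close>. On a chart this is enough, since a single minor
  is a denominator for all coordinates at a vertex.\<close>

definition regfun :: "'e::complex_vector set \<Rightarrow> ('e \<Rightarrow> complex) \<Rightarrow> bool" where
  "regfun A f \<longleftrightarrow> (\<exists>p g. polyfun p \<and> polyfun g \<and> (\<forall>u\<in>A. g u \<noteq> 0 \<and> f u = p u / g u))"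

lemma regfunI:
  assumes "polyfun p" "polyfun g" "\<And>u. u \<in> A \<Longrightarrow> g u \<noteq> 0" "\<And>u. u \<in> A \<Longrightarrow> f u = p u / g u"
  shows "regfun A f"
  using assms unfolding regfun_def by blast

lemma regfunE:
  assumes "regfun A f"
  obtains p g where "polyfun p" "polyfun g" "\<And>u. u \<in> A \<Longrightarrow> g u \<noteq> 0" "\<And>u. u \<in> A \<Longrightarrow> f u = p u / g u"
  using assms unfolding regfun_def by blast

lemma regfun_poly: "polyfun f \<Longrightarrow> regfun A f"
  by (rule regfunI[of f "\<lambda>_. 1"]) (auto intro: polyfun_const)

lemma regfun_const: "regfun A (\<lambda>_. c)"
  by (intro regfun_poly polyfun_const)

lemma regfun_cong: "regfun A f \<Longrightarrow> (\<And>u. u \<in> A \<Longrightarrow> f u = f' u) \<Longrightarrow> regfun A f'"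
  unfolding regfun_def by metis

lemma regfun_add:
  assumes "regfun A f" "regfun A f'"
  shows "regfun A (\<lambda>u. f u + f' u)"
proof -
  obtain p g where a: "polyfun p" "polyfun g" "\<And>u. u \<in> A \<Longrightarrow> g u \<noteq> 0" "\<And>u. u \<in> A \<Longrightarrow> f u = p u / g u"
    using regfunE[OF assms(1)] by metis
  obtain q h where b: "polyfun q" "polyfun h" "\<And>u. u \<in> A \<Longrightarrow> h u \<noteq> 0" "\<And>u. u \<in> A \<Longrightarrow> f' u = q u / h u"
    using regfunE[OF assms(2)] by metis
  show ?thesis
    by (rule regfunI[of "\<lambda>u. p u * h u + q u * g u" "\<lambda>u. g u * h u"])
      (auto intro!: polyfun_add polyfun_mult a(1,2) b(1,2) simp: a(3,4) b(3,4) add_frac_eq)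
qed

lemma regfun_mult:
  assumes "regfun A f" "regfun A f'"
  shows "regfun A (\<lambda>u. f u * f' u)"
proof -
  obtain p g where a: "polyfun p" "polyfun g" "\<And>u. u \<in> A \<Longrightarrow> g u \<noteq> 0" "\<And>u. u \<in> A \<Longrightarrow> f u = p u / g u"
    using regfunE[OF assms(1)] by metis
  obtain q h where b: "polyfun q" "polyfun h" "\<And>u. u \<in> A \<Longrightarrow> h u \<noteq> 0" "\<And>u. u \<in> A \<Longrightarrow> f' u = q u / h u"
    using regfunE[OF assms(2)] by metis
  show ?thesis
    by (rule regfunI[of "\<lambda>u. p u * q u" "\<lambda>u. g u * h u"])
      (auto intro!: polyfun_mult a(1,2) b(1,2) simp: a(3,4) b(3,4))
qed

lemma regfun_divide:
  assumes "regfun A f" "regfun A f'" "\<And>u. u \<in> A \<Longrightarrow> f' u \<noteq> 0"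
  shows "regfun A (\<lambda>u. f u / f' u)"
proof -
  obtain p g where a: "polyfun p" "polyfun g" "\<And>u. u \<in> A \<Longrightarrow> g u \<noteq> 0" "\<And>u. u \<in> A \<Longrightarrow> f u = p u / g u"
    using regfunE[OF assms(1)] by metis
  obtain q h where b: "polyfun q" "polyfun h" "\<And>u. u \<in> A \<Longrightarrow> h u \<noteq> 0" "\<And>u. u \<in> A \<Longrightarrow> f' u = q u / h u"
    using regfunE[OF assms(2)] by metis
  have q: "q u \<noteq> 0" if "u \<in> A" for u using assms(3)[OF that] b(4)[OF that] by auto
  show ?thesis
    by (rule regfunI[of "\<lambda>u. p u * h u" "\<lambda>u. g u * q u"])
      (auto intro!: polyfun_mult a(1,2) b(1,2) simp: a(3,4) b(3,4) q)
qed

text \<open>Finiteness of the combination matters: on an infinite-dimensional function space there are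
  linear functionals that are not determined by the coordinates.\<close>

inductive regmap :: "'e::complex_vector set \<Rightarrow> ('e \<Rightarrow> 'f::complex_vector) \<Rightarrow> bool" for A where
  regmap_zero: "regmap A (\<lambda>_. 0)"
| regmap_scale: "regfun A f \<Longrightarrow> regmap A (\<lambda>u. f u *\<^sub>C v)"
| regmap_add: "regmap A H \<Longrightarrow> regmap A H' \<Longrightarrow> regmap A (\<lambda>u. H u + H' u)"
| regmap_cong: "regmap A H \<Longrightarrow> (\<And>u. u \<in> A \<Longrightarrow> H u = H' u) \<Longrightarrow> regmap A H'"

lemma regmap_sum: "(\<And>i. i \<in> I \<Longrightarrow> regmap A (f i)) \<Longrightarrow> regmap A (\<lambda>x. \<Sum>i\<in>I. f i x)"
  by (induction I rule: infinite_finite_induct) (auto intro: regmap_zero regmap_add)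

lemma finite_support_expansion:
  fixes x :: "'j \<Rightarrow> complex"
  assumes "finite J" "\<And>p. p \<notin> J \<Longrightarrow> x p = 0"
  shows "(\<Sum>q\<in>J. x q *\<^sub>C (\<lambda>p. if p = q then 1 else 0)) = x"
proof
  fix p
  have ev: "Vector_Spaces.linear scaleC scaleC (\<lambda>x::'j \<Rightarrow> complex. x p)"
    by (rule linearI) (simp_all add: scaleC_fun)
  have "(\<Sum>q\<in>J. x q *\<^sub>C (\<lambda>p. if p = q then 1 else 0)) p = (\<Sum>q\<in>J. if q = p then x p else 0)"
    unfolding linearD(5)[OF ev] by (intro sum.cong) (auto simp: scaleC_fun scaleC_complex)
  also have "\<dots> = x p" using assms by auto
  finally show "(\<Sum>q\<in>J. x q *\<^sub>C (\<lambda>p. if p = q then 1 else 0)) p = x p" .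
qed

text \<open>Such a map is the finite combination of the unit vectors at \<open>J\<close> with its
  own coordinates as coefficients.\<close>

lemma regmap_finite_support:
  fixes H :: "'e::complex_vector \<Rightarrow> 'j \<Rightarrow> complex"
  assumes "finite J" "\<And>u p. u \<in> A \<Longrightarrow> p \<notin> J \<Longrightarrow> H u p = 0" "\<And>p. p \<in> J \<Longrightarrow> regfun A (\<lambda>u. H u p)"
  shows "regmap A H"
proof (rule regmap_cong)
  show "regmap A (\<lambda>u. \<Sum>q\<in>J. H u q *\<^sub>C (\<lambda>p. if p = q then 1 else 0))"
    by (intro regmap_sum regmap_scale assms(3))
qed (use finite_support_expansion[OF assms(1)] assms(2) in blast)

lemma regfun_linear_regmap:
  assumes "regmap A H" and f: "Vector_Spaces.linear scaleC scaleC f"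
  shows "regfun A (\<lambda>u. f (H u))"
  using assms(1)
proof induction
  case (regmap_scale g v)
  show ?case
    by (rule regfun_cong[OF regfun_mult[OF regmap_scale regfun_const[of _ "f v"]]])
      (simp add: linearD[OF f] scaleC_complex)
next
  case (regmap_add H H')
  then show ?case by (simp add: linearD[OF f] regfun_add)
next
  case (regmap_cong H H')
  show ?case by (rule regfun_cong[OF regmap_cong(3)]) (simp add: regmap_cong)
qed (simp add: linearD[OF f] regfun_const)

lemma regfun_polyfun_regmap:
  assumes "polyfun p" "regmap A H"
  shows "regfun A (\<lambda>u. p (H u))"
  using assms(1)
  by induction (auto intro: regfun_linear_regmap[OF assms(2)] regfun_const regfun_add regfun_mult)

lemma regfun_comp_regmap:
  assumes "regfun B f" "regmap A H" "\<And>u. u \<in> A \<Longrightarrow> H u \<in> B"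
  shows "regfun A (\<lambda>u. f (H u))"
proof -
  obtain p g where a: "polyfun p" "polyfun g" "\<And>u. u \<in> B \<Longrightarrow> g u \<noteq> 0" "\<And>u. u \<in> B \<Longrightarrow> f u = p u / g u"
    using regfunE[OF assms(1)] by metis
  show ?thesis
    by (rule regfun_cong[OF regfun_divide[OF regfun_polyfun_regmap[OF a(1) assms(2)]
            regfun_polyfun_regmap[OF a(2) assms(2)]]]) (auto simp: a assms(3))
qed

lemma regmap_comp:
  assumes "regmap B G" "regmap A H" "\<And>u. u \<in> A \<Longrightarrow> H u \<in> B"
  shows "regmap A (\<lambda>u. G (H u))"
  using assms(1)
proof induction
  case (regmap_scale f v)
  then show ?case by (intro regmap.regmap_scale regfun_comp_regmap[OF _ assms(2,3)])
next
  case (regmap_cong H H')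
  show ?case by (rule regmap.regmap_cong[OF regmap_cong(3)]) (simp add: regmap_cong assms(3))
qed (auto intro: regmap.intros)

lemma regmap_linear_comp:
  assumes "regmap A H" and f: "Vector_Spaces.linear scaleC scaleC f"
  shows "regmap A (\<lambda>u. f (H u))"
  using assms(1)
proof induction
  case (regmap_cong H H')
  show ?case by (rule regmap.regmap_cong[OF regmap_cong(3)]) (simp add: regmap_cong)
qed (auto intro: regmap.intros simp: linearD[OF f])

lemma linear_fst: "Vector_Spaces.linear scaleC scaleC fst"
  and linear_snd: "Vector_Spaces.linear scaleC scaleC snd"
  by (intro linearI; simp add: scaleC_prod_def)+

lemma regfun_fst: "regfun A f \<Longrightarrow> regfun (A \<times> B) (\<lambda>x. f (fst x))"
  by (erule regfunE, rule regfunI[OF polyfun_comp_linear[OF _ linear_fst] polyfun_comp_linear[OF _ linear_fst]],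
      assumption, assumption) auto

lemma regfun_snd: "regfun B f \<Longrightarrow> regfun (A \<times> B) (\<lambda>x. f (snd x))"
  by (erule regfunE, rule regfunI[OF polyfun_comp_linear[OF _ linear_snd] polyfun_comp_linear[OF _ linear_snd]],
      assumption, assumption) auto

lemma regmap_fst: "regmap A H \<Longrightarrow> regmap (A \<times> B) (\<lambda>x. H (fst x))"
proof (induction rule: regmap.induct)
  case (regmap_scale f v)
  show ?case by (rule regmap.regmap_scale[OF regfun_fst[OF regmap_scale]])
next
  case (regmap_cong H H')
  show ?case by (rule regmap.regmap_cong[OF regmap_cong(3)]) (auto simp: regmap_cong(2))
qed (auto intro: regmap.intros)

lemma regmap_snd: "regmap B H \<Longrightarrow> regmap (A \<times> B) (\<lambda>x. H (snd x))"
proof (induction rule: regmap.induct)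
  case (regmap_scale f v)
  show ?case by (rule regmap.regmap_scale[OF regfun_snd[OF regmap_scale]])
next
  case (regmap_cong H H')
  show ?case by (rule regmap.regmap_cong[OF regmap_cong(3)]) (auto simp: regmap_cong(2))
qed (auto intro: regmap.intros)

lemma regmap_Pair:
  fixes H :: "'e::complex_vector \<Rightarrow> 'f::complex_vector" and H' :: "'e \<Rightarrow> 'g::complex_vector"
  assumes "regmap A H" "regmap A H'"
  shows "regmap A (\<lambda>u. (H u, H' u))"
proof -
  have "Vector_Spaces.linear scaleC scaleC (\<lambda>x::'f. (x, 0::'g))"
    "Vector_Spaces.linear scaleC scaleC (\<lambda>x::'g. (0::'f, x))"
    by (rule linearI; simp add: scaleC_prod_def)+
  from regmap_add[OF regmap_linear_comp[OF assms(1) this(1)] regmap_linear_comp[OF assms(2) this(2)]]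
  show ?thesis by simp
qed

text \<open>A map of varieties induced by one map \<open>H\<close> between the presenting sets. Such
  lifts compose by substitution and multiply factor by factor, so that the local definition of
  \<open>morphism\<close> is unfolded only once, in \<open>regular_lift_morphism\<close>.\<close>

definition regular_lift ::
    "('e::complex_vector, 'x) pvariety \<Rightarrow> ('f::complex_vector, 'y) pvariety \<Rightarrow> ('x \<Rightarrow> 'y) \<Rightarrow> bool" where
  "regular_lift X Y h \<longleftrightarrow>
     (\<exists>H. regmap (fst X) H \<and> (\<forall>u\<in>fst X. H u \<in> fst Y \<and> snd Y (H u) = h (snd X u)))"

lemma regular_liftI:
  assumes "regmap (fst X) H" "\<And>u. u \<in> fst X \<Longrightarrow> H u \<in> fst Y"
    "\<And>u. u \<in> fst X \<Longrightarrow> snd Y (H u) = h (snd X u)"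
  shows "regular_lift X Y h"
  using assms unfolding regular_lift_def by blast

lemma regular_lift_points: "regular_lift X Y h \<Longrightarrow> x \<in> points X \<Longrightarrow> h x \<in> points Y"
  unfolding regular_lift_def points_def by force

lemma regular_lift_comp:
  assumes "regular_lift X Y h" "regular_lift Y Z k"
  shows "regular_lift X Z (\<lambda>x. k (h x))"
proof -
  obtain H where H: "regmap (fst X) H" "\<And>u. u \<in> fst X \<Longrightarrow> H u \<in> fst Y \<and> snd Y (H u) = h (snd X u)"
    using assms(1) unfolding regular_lift_def by blast
  obtain K where K: "regmap (fst Y) K" "\<And>u. u \<in> fst Y \<Longrightarrow> K u \<in> fst Z \<and> snd Z (K u) = k (snd Y u)"
    using assms(2) unfolding regular_lift_def by blast
  show ?thesis
    by (rule regular_liftI[where H = "\<lambda>u. K (H u)"]) (use H K in \<open>auto intro!: regmap_comp[OF K(1) H(1)]\<close>)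
qed

lemma regular_lift_prod:
  assumes "regular_lift X X' h" "regular_lift Y Y' k"
  shows "regular_lift (prod_var X Y) (prod_var X' Y') (map_prod h k)"
proof -
  obtain H where H: "regmap (fst X) H" "\<And>u. u \<in> fst X \<Longrightarrow> H u \<in> fst X' \<and> snd X' (H u) = h (snd X u)"
    using assms(1) unfolding regular_lift_def by blast
  obtain K where K: "regmap (fst Y) K" "\<And>u. u \<in> fst Y \<Longrightarrow> K u \<in> fst Y' \<and> snd Y' (K u) = k (snd Y u)"
    using assms(2) unfolding regular_lift_def by blast
  show ?thesis
    by (rule regular_liftI[where H = "\<lambda>u. (H (fst u), K (snd u))"])
      (use H K in \<open>auto simp: prod_var_def intro!: regmap_Pair regmap_fst regmap_snd\<close>)
qed

lemma regular_onE:
  assumes "regular_on X U f" "u \<in> fst X" "snd X u \<in> U"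
  obtains p g where "polyfun p" "polyfun g" "g u \<noteq> 0"
    "\<And>w. w \<in> fst X \<Longrightarrow> snd X w \<in> U \<Longrightarrow> g w \<noteq> 0 \<Longrightarrow> f (snd X w) = p w / g w"
  using assms unfolding regular_on_def by auto

text \<open>Along \<open>H\<close> every polynomial \<open>p\<close> becomes a quotient
  \<open>P p / G p\<close> with \<open>G p\<close> without zeros. Hence
  \<open>p (H u) \<noteq> 0\<close> says \<open>P p u \<noteq> 0\<close>, which gives continuity,
  and a local fraction pulls back to a fraction.\<close>

lemma regular_lift_morphism:
  fixes X :: "('e::complex_vector, 'x) pvariety" and Y :: "('f::complex_vector, 'y) pvariety"
  assumes "regular_lift X Y h"
  shows "morphism X Y h"
proof -
  obtain H where H: "regmap (fst X) H" and
    HY: "\<And>u. u \<in> fst X \<Longrightarrow> H u \<in> fst Y" and Hh: "\<And>u. u \<in> fst X \<Longrightarrow> snd Y (H u) = h (snd X u)"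
    using assms unfolding regular_lift_def by blast
  have "\<exists>P g. polyfun P \<and> polyfun g \<and> (\<forall>u\<in>fst X. g u \<noteq> 0 \<and> p (H u) = P u / g u)" if "polyfun p" for p
    using regfun_polyfun_regmap[OF that H] unfolding regfun_def by blast
  then obtain P G where PG: "\<And>p. polyfun p \<Longrightarrow> polyfun (P p)" "\<And>p. polyfun p \<Longrightarrow> polyfun (G p)"
    "\<And>p u. polyfun p \<Longrightarrow> u \<in> fst X \<Longrightarrow> G p u \<noteq> 0" "\<And>p u. polyfun p \<Longrightarrow> u \<in> fst X \<Longrightarrow> p (H u) = P p u / G p u"
    by metis
  have "zariski_open X {x \<in> points X. h x \<in> U}" if "zariski_open Y U" for U
  proof -
    obtain R where R: "\<forall>p\<in>R. polyfun p" "\<forall>u\<in>fst Y. snd Y u \<in> U \<longleftrightarrow> (\<exists>p\<in>R. p u \<noteq> 0)"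
      using \<open>zariski_open Y U\<close> unfolding zariski_open_def by auto
    have "snd X u \<in> {x \<in> points X. h x \<in> U} \<longleftrightarrow> (\<exists>p\<in>P ` R. p u \<noteq> 0)" if u: "u \<in> fst X" for u
    proof -
      have "p (H u) \<noteq> 0 \<longleftrightarrow> P p u \<noteq> 0" if "p \<in> R" for p
        using PG(3)[OF _ u, of p] PG(4)[OF _ u, of p] R(1) that by (metis div_by_0 divide_eq_0_iff)
      moreover have "snd X u \<in> points X" using u by (simp add: points_def)
      moreover have "h (snd X u) \<in> U \<longleftrightarrow> (\<exists>p\<in>R. p (H u) \<noteq> 0)"
        using R(2) HY[OF u] Hh[OF u] by metis
      ultimately show ?thesis by auto
    qed
    moreover have "\<forall>p\<in>P ` R. polyfun p" using R(1) PG(1) by auto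
    ultimately show ?thesis unfolding zariski_open_def by (intro conjI exI[of _ "P ` R"]) auto
  qed
  moreover have "regular_on X {x \<in> points X. h x \<in> U} (f \<circ> h)" if reg: "regular_on Y U f" for U f
    unfolding regular_on_def
  proof (intro ballI impI)
    fix u assume u: "u \<in> fst X" "snd X u \<in> {x \<in> points X. h x \<in> U}"
    then have "H u \<in> fst Y" "snd Y (H u) \<in> U" using HY Hh by auto
    then obtain p g where pg: "polyfun p" "polyfun g" "g (H u) \<noteq> 0"
      "\<And>w. w \<in> fst Y \<Longrightarrow> snd Y w \<in> U \<Longrightarrow> g w \<noteq> 0 \<Longrightarrow> f (snd Y w) = p w / g w"
      using regular_onE[OF reg] by blast
    \<comment> \<open>The quotient of \<open>P p / G p\<close> by \<open>P g / G g\<close>, cleared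
      of denominators.\<close>
    show "\<exists>p g. polyfun p \<and> polyfun g \<and> g u \<noteq> 0 \<and> (\<forall>w\<in>fst X. snd X w \<in> {x \<in> points X. h x \<in> U} \<and> g w \<noteq> 0
        \<longrightarrow> (f \<circ> h) (snd X w) = p w / g w)"
    proof (rule exI[of _ "\<lambda>w. P p w * G g w"], rule exI[of _ "\<lambda>w. G p w * P g w"], intro conjI ballI impI)
      show "polyfun (\<lambda>w. P p w * G g w)" "polyfun (\<lambda>w. G p w * P g w)"
        by (auto intro: polyfun_mult PG pg)
      show "G p u * P g u \<noteq> 0" using PG(3,4) pg u by fastforce
      fix w assume w: "w \<in> fst X" "snd X w \<in> {x \<in> points X. h x \<in> U} \<and> G p w * P g w \<noteq> 0"
      then have "g (H w) \<noteq> 0" using PG(3,4) pg by fastforce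
      then have "f (snd Y (H w)) = p (H w) / g (H w)"
        using pg(4)[of "H w"] w HY Hh by auto
      then show "(f \<circ> h) (snd X w) = P p w * G g w / (G p w * P g w)"
        by (simp add: PG(4)[OF pg(1) w(1)] PG(4)[OF pg(2) w(1)] Hh[OF w(1)])
    qed
  qed
  moreover have "h x \<in> points Y" if "x \<in> points X" for x
    using regular_lift_points[OF assms that] .
  ultimately show ?thesis
    unfolding morphism_def continuous_map_def by (auto simp: openin_zariski topspace_zariski)
qed

text \<open>Isomorphism with explicit lifts of both directions; chains of isomorphisms and products
  of them are formed at this level and turned into \<open>isomorphic_var\<close> at the end.\<close>

definition lift_iso ::
    "('e::complex_vector, 'x) pvariety \<Rightarrow> ('f::complex_vector, 'y) pvariety \<Rightarrow> bool" where
  "lift_iso X Y \<longleftrightarrow> (\<exists>h k. regular_lift X Y h \<and> regular_lift Y X k \<and>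
     (\<forall>x\<in>points X. k (h x) = x) \<and> (\<forall>y\<in>points Y. h (k y) = y))"

lemma lift_isoI:
  assumes "regular_lift X Y h" "regular_lift Y X k"
    "\<And>x. x \<in> points X \<Longrightarrow> k (h x) = x" "\<And>y. y \<in> points Y \<Longrightarrow> h (k y) = y"
  shows "lift_iso X Y"
  using assms unfolding lift_iso_def by blast

lemma lift_iso_sym: "lift_iso X Y \<Longrightarrow> lift_iso Y X"
  unfolding lift_iso_def by blast

lemma lift_iso_trans:
  assumes "lift_iso X Y" "lift_iso Y Z"
  shows "lift_iso X Z"
proof -
  obtain h k where a: "regular_lift X Y h" "regular_lift Y X k"
    "\<forall>x\<in>points X. k (h x) = x" "\<forall>y\<in>points Y. h (k y) = y"
    using assms(1) unfolding lift_iso_def by blast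
  obtain h' k' where b: "regular_lift Y Z h'" "regular_lift Z Y k'"
    "\<forall>x\<in>points Y. k' (h' x) = x" "\<forall>y\<in>points Z. h' (k' y) = y"
    using assms(2) unfolding lift_iso_def by blast
  show ?thesis
    by (rule lift_isoI[OF regular_lift_comp[OF a(1) b(1)] regular_lift_comp[OF b(2) a(2)]])
      (use a(3,4) b(3,4) regular_lift_points[OF a(1)] regular_lift_points[OF b(2)] in auto)
qed

lemma lift_iso_prod:
  assumes "lift_iso X X'" "lift_iso Y Y'"
  shows "lift_iso (prod_var X Y) (prod_var X' Y')"
proof -
  obtain h k where a: "regular_lift X X' h" "regular_lift X' X k"
    "\<forall>x\<in>points X. k (h x) = x" "\<forall>y\<in>points X'. h (k y) = y"
    using assms(1) unfolding lift_iso_def by blast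
  obtain h' k' where b: "regular_lift Y Y' h'" "regular_lift Y' Y k'"
    "\<forall>x\<in>points Y. k' (h' x) = x" "\<forall>y\<in>points Y'. h' (k' y) = y"
    using assms(2) unfolding lift_iso_def by blast
  show ?thesis
    by (rule lift_isoI[OF regular_lift_prod[OF a(1) b(1)] regular_lift_prod[OF a(2) b(2)]])
      (use a(3,4) b(3,4) in \<open>auto simp: prod_var_def points_def\<close>)
qed

lemma lift_iso_isomorphic_var:
  assumes "lift_iso X Y"
  shows "isomorphic_var X Y"
proof -
  obtain h k where a: "regular_lift X Y h" "regular_lift Y X k"
    "\<forall>x\<in>points X. k (h x) = x" "\<forall>y\<in>points Y. h (k y) = y"
    using assms unfolding lift_iso_def by blast
  have bij: "bij_betw h (points X) (points Y)"
    by (rule bij_betw_byWitness[where f' = k])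
      (use a(3,4) regular_lift_points[OF a(1)] regular_lift_points[OF a(2)] in auto)
  have "inv_into (points X) h y = k y" if "y \<in> points Y" for y
    using bij a regular_lift_points[OF a(2) that] that by (metis bij_betw_inv_into_left)
  moreover have "snd Y u \<in> points Y" if "u \<in> fst Y" for u
    using that by (simp add: points_def)
  ultimately have "regular_lift Y X (inv_into (points X) h)"
    using a(2) unfolding regular_lift_def by auto
  then show ?thesis
    unfolding isomorphic_var_def using bij regular_lift_morphism[OF a(1)] regular_lift_morphism by metis
qed


section \<open>Linear isomorphisms\<close>

text \<open>The functionals live on the whole type, so that they are admissible in
  \<open>polyfun\<close>; only their values on the span of \<open>B\<close> are determined.\<close>

lemma dual_functionals:
  fixes B :: "'e::complex_vector set"
  assumes "\<not> cvec.dependent B"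
  obtains c :: "'e \<Rightarrow> 'e \<Rightarrow> complex"
  where "\<And>\<beta>. Vector_Spaces.linear scaleC scaleC (c \<beta>)"
    "\<And>\<beta> \<gamma>. \<gamma> \<in> B \<Longrightarrow> c \<beta> \<gamma> = (if \<gamma> = \<beta> then 1 else 0)"
proof -
  interpret vp: vector_space_pair "scaleC :: complex \<Rightarrow> 'e \<Rightarrow> 'e" "scaleC :: complex \<Rightarrow> complex \<Rightarrow> complex"
    by unfold_locales
  have "\<exists>g. Vector_Spaces.linear scaleC scaleC g \<and> (\<forall>x\<in>B. g x = (if x = \<beta> then 1 else 0 :: complex))" for \<beta>
    by (rule vp.linear_independent_extend[OF assms])
  then obtain c where "\<And>\<beta>. Vector_Spaces.linear scaleC scaleC (c \<beta>)"
    "\<And>\<beta>. \<forall>x\<in>B. c \<beta> x = (if x = \<beta> then 1 else 0 :: complex)"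
    by metis
  then show ?thesis using that by blast
qed

lemma dual_functionals_expansion:
  fixes B :: "'e::complex_vector set"
  assumes "finite B" and lin: "\<And>\<beta>. Vector_Spaces.linear scaleC scaleC (c \<beta> :: 'e \<Rightarrow> complex)"
    and c: "\<And>\<beta> \<gamma>. \<gamma> \<in> B \<Longrightarrow> c \<beta> \<gamma> = (if \<gamma> = \<beta> then 1 else 0)"
    and x: "x \<in> cvec.span B"
  shows "x = (\<Sum>\<beta>\<in>B. c \<beta> x *\<^sub>C \<beta>)"
  using x
proof (induction rule: cvec.span_induct_alt)
  case base
  then show ?case by (simp add: linearD[OF lin])
next
  case (step a x y)
  have "(\<Sum>\<beta>\<in>B. c \<beta> (a *\<^sub>C x + y) *\<^sub>C \<beta>) = (\<Sum>\<beta>\<in>B. (a * c \<beta> x) *\<^sub>C \<beta>) + (\<Sum>\<beta>\<in>B. c \<beta> y *\<^sub>C \<beta>)"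
    by (simp add: linearD[OF lin] scaleC_complex scaleC_add_left sum.distrib)
  also have "(\<Sum>\<beta>\<in>B. (a * c \<beta> x) *\<^sub>C \<beta>) = (\<Sum>\<beta>\<in>B. if \<beta> = x then a *\<^sub>C x else 0)"
    by (intro sum.cong) (use c[OF \<open>x \<in> B\<close>] in auto)
  finally show ?case using step \<open>finite B\<close> by simp
qed

lemma finite_basis:
  fixes A :: "'e::complex_vector set"
  assumes "finite B0" "A = cvec.span B0"
  obtains B where "finite B" "\<not> cvec.dependent B" "A = cvec.span B"
proof -
  obtain B where B: "B \<subseteq> B0" "\<not> cvec.dependent B" "B0 \<subseteq> cvec.span B"
    using cvec.maximal_independent_subset[of B0] by metis
  have "cvec.span B = cvec.span B0"
    using B by (metis cvec.span_mono cvec.span_span subset_antisym)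
  then show ?thesis using that[of B] B assms by (metis finite_subset)
qed

lemma span_image_lessThan:
  fixes u :: "nat \<Rightarrow> 'm::complex_vector"
  assumes "v \<in> cvec.span (u ` {..<n})"
  obtains y where "v = (\<Sum>j<n. y j *\<^sub>C u j)"
proof -
  have "\<exists>y. v = (\<Sum>j<n. y j *\<^sub>C u j)"
    using assms
  proof (induction rule: cvec.span_induct_alt)
    case base
    show ?case by (rule exI[of _ "\<lambda>_. 0"]) simp
  next
    case (step c x v)
    then obtain y k where y: "v = (\<Sum>j<n. y j *\<^sub>C u j)" and k: "k < n" "x = u k" by auto
    have "c *\<^sub>C x + v = (\<Sum>j<n. if j = k then c *\<^sub>C u j else 0) + (\<Sum>j<n. y j *\<^sub>C u j)"
      using k y by simp
    also have "\<dots> = (\<Sum>j<n. ((if j = k then c else 0) + y j) *\<^sub>C u j)"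
      unfolding sum.distrib[symmetric] by (rule sum.cong) (auto simp: scaleC_add_left)
    finally show ?case by (rule exI[of _ "\<lambda>j. (if j = k then c else 0) + y j"])
  qed
  then show ?thesis using that by blast
qed

lemma independent_combination:
  fixes u :: "nat \<Rightarrow> 'm::complex_vector"
  assumes "inj_on u {..<n}" "\<not> cvec.dependent (u ` {..<n})" "(\<Sum>j<n. y j *\<^sub>C u j) = 0" "j < n"
  shows "y j = 0"
proof -
  have "(\<Sum>v\<in>u ` {..<n}. y (inv_into {..<n} u v) *\<^sub>C v) = (\<Sum>j<n. y j *\<^sub>C u j)"
    by (simp add: sum.reindex[OF assms(1)] inv_into_f_f[OF assms(1)])
  then have "y (inv_into {..<n} u (u j)) = 0"
    using cvec.independentD[OF assms(2) _ order.refl, of "\<lambda>v. y (inv_into {..<n} u v)"] assms(3,4)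
    by (metis (no_types, lifting) finite_imageI finite_lessThan imageI lessThan_iff)
  then show ?thesis using inv_into_f_f[OF assms(1)] assms(4) by simp
qed

lemma independent_dual:
  fixes v :: "'j \<Rightarrow> 'm::complex_vector"
  assumes "finite J" and lin: "\<And>j. j \<in> J \<Longrightarrow> Vector_Spaces.linear scaleC scaleC (c j :: 'm \<Rightarrow> complex)"
    and c: "\<And>j k. j \<in> J \<Longrightarrow> k \<in> J \<Longrightarrow> c j (v k) = (if j = k then 1 else 0)"
  shows "inj_on v J" "\<not> cvec.dependent (v ` J)"
proof -
  show inj: "inj_on v J"
    by (rule inj_onI) (metis c zero_neq_one)
  show "\<not> cvec.dependent (v ` J)"
  proof (subst cvec.dependent_finite)
    show "finite (v ` J)" using \<open>finite J\<close> by simp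
    show "\<not> (\<exists>u. (\<exists>x\<in>v ` J. u x \<noteq> 0) \<and> (\<Sum>x\<in>v ` J. u x *\<^sub>C x) = 0)"
    proof safe
      fix u j assume j: "j \<in> J" "u (v j) \<noteq> 0" and "(\<Sum>x\<in>v ` J. u x *\<^sub>C x) = 0"
      then have "(\<Sum>k\<in>J. u (v k) *\<^sub>C v k) = 0" by (simp add: sum.reindex[OF inj])
      then have "c j (\<Sum>k\<in>J. u (v k) *\<^sub>C v k) = 0" by (simp add: linearD(3)[OF lin[OF j(1)]])
      then have "(\<Sum>k\<in>J. u (v k) * c j (v k)) = 0"
        by (simp add: linearD[OF lin[OF j(1)]] scaleC_complex)
      moreover have "(\<Sum>k\<in>J. u (v k) * c j (v k)) = (\<Sum>k\<in>J. if k = j then u (v j) else 0)"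
        by (rule sum.cong) (use j(1) c in auto)
      ultimately show False using j \<open>finite J\<close> by simp
    qed
  qed
qed

lemma finite_support_subspace:
  fixes A :: "('j \<Rightarrow> complex) set"
  assumes "finite J" "cvec.subspace A" "\<And>x p. x \<in> A \<Longrightarrow> p \<notin> J \<Longrightarrow> x p = 0"
  obtains B where "finite B" "A = cvec.span B"
proof -
  let ?E = "(\<lambda>q p. if p = q then 1 else 0 :: complex) ` J"
  have AE: "A \<subseteq> cvec.span ?E"
  proof
    fix x assume x: "x \<in> A"
    have "(\<Sum>q\<in>J. x q *\<^sub>C (\<lambda>p. if p = q then 1 else 0)) \<in> cvec.span ?E"
      by (intro cvec.span_sum cvec.span_scale cvec.span_base) auto
    then show "x \<in> cvec.span ?E" using finite_support_expansion[OF assms(1)] assms(3)[OF x] by simp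
  qed
  obtain B where B: "B \<subseteq> A" "\<not> cvec.dependent B" "A \<subseteq> cvec.span B"
    using cvec.maximal_independent_subset[of A] by metis
  have "finite B" using cvec.independent_span_bound[OF _ B(2), of ?E] B(1) AE \<open>finite J\<close> by auto
  moreover have "cvec.span B \<subseteq> A" using B(1) assms(2) by (rule cvec.span_minimal)
  ultimately show ?thesis using that B(3) by blast
qed

lemma clinear_on_sum:
  assumes "clinear_on A f" "cvec.subspace A" "\<And>i. i \<in> I \<Longrightarrow> x i \<in> A"
  shows "f (\<Sum>i\<in>I. c i *\<^sub>C x i) = (\<Sum>i\<in>I. c i *\<^sub>C f (x i))"
  using assms(3)
proof (induction I rule: infinite_finite_induct)
  case (insert i I)
  then show ?case
    using assms(1,2) by (simp add: clinear_onD cvec.subspace_scale cvec.subspace_sum)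
next
  case empty
  have "f (0 *\<^sub>C 0) = 0 *\<^sub>C f 0"
    using assms(1,2) clinear_onD(2) cvec.subspace_0 by blast
  then show ?case by simp
next
  case (infinite I)
  have "f (0 *\<^sub>C 0) = 0 *\<^sub>C f 0"
    using assms(1,2) clinear_onD(2) cvec.subspace_0 by blast
  then show ?case using infinite by simp
qed

text \<open>The extension is the finite sum of the values of \<open>F\<close> on a basis, weighted
  by dual functionals. It is linear everywhere and regular by construction, although
  \<open>F\<close> is only controlled on \<open>A\<close>.\<close>

lemma clinear_on_span_extend:
  fixes F :: "'e::complex_vector \<Rightarrow> 'f::complex_vector"
  assumes "finite B0" "A = cvec.span B0" "clinear_on A F"
  obtains G where "Vector_Spaces.linear scaleC scaleC G" "\<And>x. x \<in> A \<Longrightarrow> G x = F x" "regmap UNIV G"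
proof -
  obtain B where B: "finite B" "\<not> cvec.dependent B" "A = cvec.span B"
    using finite_basis[OF assms(1,2)] by metis
  obtain c where c: "\<And>\<beta>. Vector_Spaces.linear scaleC scaleC (c \<beta> :: 'e \<Rightarrow> complex)"
    "\<And>\<beta> \<gamma>. \<gamma> \<in> B \<Longrightarrow> c \<beta> \<gamma> = (if \<gamma> = \<beta> then 1 else 0)"
    using dual_functionals[OF B(2)] by metis
  define G where "G x = (\<Sum>\<beta>\<in>B. c \<beta> x *\<^sub>C F \<beta>)" for x
  show ?thesis
  proof
    show "Vector_Spaces.linear scaleC scaleC G"
      by (rule linearI) (simp_all add: G_def linearD[OF c(1)] scaleC_add_left sum.distrib
          scaleC_complex cvec.scale_sum_right)
    show "regmap UNIV G"
      unfolding G_def by (intro regmap_sum regmap_scale regfun_poly polyfun_linear c(1))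
    fix x assume x: "x \<in> A"
    have "F x = F (\<Sum>\<beta>\<in>B. c \<beta> x *\<^sub>C \<beta>)"
      using dual_functionals_expansion[OF B(1) c, of x] x B(3) by simp
    also have "\<dots> = G x"
      unfolding G_def by (rule clinear_on_sum[OF assms(3)]) (auto simp: B(3) cvec.span_base)
    finally show "G x = F x" by simp
  qed
qed

lemma regmap_mono: "regmap A H \<Longrightarrow> A' \<subseteq> A \<Longrightarrow> regmap A' H"
proof (induction rule: regmap.induct)
  case (regmap_scale f v)
  show ?case
    by (rule regmap.regmap_scale) (use regmap_scale in \<open>auto simp: regfun_def\<close>)
next
  case (regmap_cong H H')
  then show ?case by (auto intro: regmap.regmap_cong)
qed (auto intro: regmap.intros)

text \<open>The image \<open>C\<close> is again finitely spanned and the inverse is linear on it, so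
  both directions extend to regular maps of the ambient spaces.\<close>

lemma lift_iso_linear:
  fixes F :: "'e::complex_vector \<Rightarrow> 'f::complex_vector"
  assumes "finite B0" "A = cvec.span B0" "clinear_on A F" and bij: "bij_betw F A C"
  shows "lift_iso (affine_var A) (affine_var C)"
proof -
  interpret vp: vector_space_pair "scaleC :: complex \<Rightarrow> 'e \<Rightarrow> 'e" "scaleC :: complex \<Rightarrow> 'f \<Rightarrow> 'f"
    by unfold_locales
  obtain G where G: "Vector_Spaces.linear scaleC scaleC G" "\<And>x. x \<in> A \<Longrightarrow> G x = F x" "regmap UNIV G"
    using clinear_on_span_extend[OF assms(1-3)] by metis
  have "C = G ` A" using bij G(2) by (auto simp: bij_betw_def)
  then have C: "C = cvec.span (G ` B0)"
    unfolding assms(2) using vp.linear_span_image[OF G(1)] by simp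
  define K where "K = inv_into A F"
  have K: "K y \<in> A" "F (K y) = y" if "y \<in> C" for y
    using bij that unfolding K_def by (auto simp: bij_betw_def inv_into_into f_inv_into_f)
  have KF: "K (F x) = x" if "x \<in> A" for x
    using bij that unfolding K_def by (auto simp: bij_betw_def)
  have sub: "cvec.subspace A" by (simp add: assms(2))
  have "clinear_on C K"
    unfolding clinear_on_def
  proof (intro conjI ballI allI)
    fix x y assume x: "x \<in> C" and y: "y \<in> C"
    have "F (K x + K y) = x + y" using K x y assms(3) by (simp add: clinear_onD)
    then show "K (x + y) = K x + K y"
      using KF[of "K x + K y"] K x y sub by (simp add: cvec.subspace_add)
  next
    fix a x assume x: "x \<in> C"
    have "F (a *\<^sub>C K x) = a *\<^sub>C x" using K x assms(3) by (simp add: clinear_onD)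
    then show "K (a *\<^sub>C x) = a *\<^sub>C K x"
      using KF[of "a *\<^sub>C K x"] K x sub by (simp add: cvec.subspace_scale)
  qed
  then obtain L where L: "\<And>x. x \<in> C \<Longrightarrow> L x = K x" "regmap UNIV L"
    using clinear_on_span_extend[OF _ C] assms(1) by (metis finite_imageI)
  show ?thesis
  proof (rule lift_isoI)
    show "regular_lift (affine_var A) (affine_var C) F"
      by (rule regular_liftI[where H = G])
        (use G bij in \<open>auto simp: affine_var_def bij_betw_def intro: regmap_mono\<close>)
    show "regular_lift (affine_var C) (affine_var A) K"
      by (rule regular_liftI[where H = L])
        (use L K in \<open>auto simp: affine_var_def intro: regmap_mono\<close>)
  qed (use K KF in \<open>auto simp: affine_var_def points_def\<close>)
qed

lemma lift_iso_affine_space: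
  fixes A :: "'e::complex_vector set"
  assumes "finite B0" "A = cvec.span B0"
  obtains n where "lift_iso (affine_var A) (affine_space n)"
proof -
  obtain B where B: "finite B" "\<not> cvec.dependent B" "A = cvec.span B"
    using finite_basis[OF assms(1,2)] by metis
  obtain c where c: "\<And>\<beta>. Vector_Spaces.linear scaleC scaleC (c \<beta> :: 'e \<Rightarrow> complex)"
    "\<And>\<beta> \<gamma>. \<gamma> \<in> B \<Longrightarrow> c \<beta> \<gamma> = (if \<gamma> = \<beta> then 1 else 0)"
    using dual_functionals[OF B(2)] by metis
  obtain g where g: "bij_betw g {..<card B} B"
    using B(1) bij_betw_from_nat_into_finite by blast
  define F where "F x j = (if j < card B then c (g j) x else 0)" for x and j :: nat
  define K where "K y = (\<Sum>j<card B. y j *\<^sub>C g j)" for y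
  have gB: "g j \<in> B" if "j < card B" for j using g that by (auto simp: bij_betw_def)
  have sum_g: "(\<Sum>j<card B. h (g j)) = sum h B" for h :: "'e \<Rightarrow> 'e"
    by (rule sum.reindex_bij_betw[OF g])
  have KA: "K y \<in> A" for y
    unfolding K_def B(3) by (intro cvec.span_sum cvec.span_scale cvec.span_base) (use gB in auto)
  have FK: "F (K y) = y" if "\<forall>j\<ge>card B. y j = 0" for y
  proof
    fix j
    show "F (K y) j = y j"
    proof (cases "j < card B")
      case True
      have "F (K y) j = (\<Sum>i<card B. y i * c (g j) (g i))"
        unfolding F_def K_def linearD(5)[OF c(1)] using True by (simp add: linearD[OF c(1)] scaleC_complex)
      also have "\<dots> = (\<Sum>i<card B. if i = j then y i else 0)"
        by (intro sum.cong) (use g True c(2)[OF gB] in \<open>auto simp: bij_betw_def inj_on_def\<close>)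
      finally show ?thesis using True by simp
    qed (use that in \<open>simp add: F_def\<close>)
  qed
  have KF: "K (F x) = x" if "x \<in> A" for x
  proof -
    have "K (F x) = (\<Sum>j<card B. c (g j) x *\<^sub>C g j)" by (simp add: K_def F_def)
    also have "\<dots> = (\<Sum>\<beta>\<in>B. c \<beta> x *\<^sub>C \<beta>)" by (rule sum_g[of "\<lambda>\<beta>. c \<beta> x *\<^sub>C \<beta>"])
    finally show ?thesis using dual_functionals_expansion[OF B(1) c, of x] that B(3) by simp
  qed
  have "clinear_on A F"
    by (auto simp: clinear_on_def F_def linearD[OF c(1)] fun_eq_iff scaleC_fun scaleC_complex)
  then obtain G where G: "\<And>x. x \<in> A \<Longrightarrow> G x = F x" "regmap UNIV G"
    using clinear_on_span_extend[OF assms(1,2)] by metis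
  have "lift_iso (affine_var A) (affine_space (card B))"
  proof (rule lift_isoI)
    show "regular_lift (affine_var A) (affine_space (card B)) F"
      by (rule regular_liftI[where H = G])
        (use G in \<open>auto simp: affine_var_def affine_space_def F_def intro: regmap_mono\<close>)
    have "regmap S K" for S
      unfolding K_def[abs_def] by (intro regmap_sum regmap_scale regfun_poly polyfun_apply)
    then show "regular_lift (affine_space (card B)) (affine_var A) K"
      by (intro regular_liftI[where H = K]) (use KA in \<open>auto simp: affine_var_def affine_space_def\<close>)
  qed (use KF FK in \<open>auto simp: affine_var_def affine_space_def points_def\<close>)
  then show ?thesis by (rule that)
qed


section \<open>Determinants\<close>

text \<open>Determinants of arrays given as functions: the entries may then depend on a frame, and
  polynomial dependence can be stated entry by entry.\<close>

definition fdet :: "nat \<Rightarrow> (nat \<Rightarrow> nat \<Rightarrow> complex) \<Rightarrow> complex" where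
  "fdet n A = Determinant.det (Matrix.mat n n (\<lambda>(i, j). A i j))"

definition fadj :: "nat \<Rightarrow> (nat \<Rightarrow> nat \<Rightarrow> complex) \<Rightarrow> nat \<Rightarrow> nat \<Rightarrow> complex" where
  "fadj n A i j = adj_mat (Matrix.mat n n (\<lambda>(i, j). A i j)) $$ (i, j)"

lemma fdet_Leibniz:
  "fdet n A = (\<Sum>p\<in>{p. p permutes {0..<n}}. signof p * (\<Prod>i=0..<n. A i (p i)))"
proof -
  have "p i < n" if "p permutes {0..<n}" "i < n" for p i
    using permutes_in_image[OF that(1), of i] that(2) by simp
  then show ?thesis
    unfolding fdet_def by (subst det_def'[of _ n]) (auto intro!: sum.cong prod.cong)
qed

lemma polyfun_fdet:
  assumes "\<And>i j. i < n \<Longrightarrow> j < n \<Longrightarrow> polyfun (\<lambda>u. A u i j)"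
  shows "polyfun (\<lambda>u. fdet n (A u))"
  unfolding fdet_Leibniz
  by (intro polyfun_sum polyfun_mult polyfun_const polyfun_prod assms) (auto dest: permutes_in_image)

text \<open>The entries of the adjugate are signed minors, that is, determinants of arrays with one
  row and one column skipped.\<close>

lemma polyfun_fadj:
  assumes "\<And>i j. i < n \<Longrightarrow> j < n \<Longrightarrow> polyfun (\<lambda>u. A u i j)" "i < n" "j < n"
  shows "polyfun (\<lambda>u. fadj n (A u) i j)"
proof -
  have "fadj n (A u) i j = (-1) ^ (j + i) *
      fdet (n - 1) (\<lambda>i' j'. A u (if i' < j then i' else Suc i') (if j' < i then j' else Suc j'))" for u
  proof -
    have "mat_delete (Matrix.mat n n (\<lambda>(i, j). A u i j)) j i =
        Matrix.mat (n - 1) (n - 1)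
          (\<lambda>(i', j'). A u (if i' < j then i' else Suc i') (if j' < i then j' else Suc j'))"
      unfolding mat_delete_def by (rule eq_matI) auto
    then show ?thesis using assms(2,3) by (simp add: fadj_def fdet_def adj_mat_def cofactor_def)
  qed
  then show ?thesis
    by (simp only:) (intro polyfun_mult polyfun_const polyfun_fdet assms(1); auto)
qed

lemma fadj_mult:
  assumes "i < n" "j < n"
  shows "(\<Sum>k<n. fadj n A i k * A k j) = (if i = j then fdet n A else 0)"
proof -
  let ?M = "Matrix.mat n n (\<lambda>(i, j). A i j)"
  have M: "?M \<in> carrier_mat n n" by simp
  have "(adj_mat ?M * ?M) $$ (i, j) = (\<Sum>k=0..<n. adj_mat ?M $$ (i, k) * ?M $$ (k, j))"
    using adj_mat(1)[OF M] assms by (simp add: scalar_prod_def)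
  also have "\<dots> = (\<Sum>k<n. fadj n A i k * A k j)"
    by (rule sum.cong) (use assms in \<open>auto simp: fadj_def\<close>)
  finally show ?thesis using assms by (cases "i = j") (auto simp: adj_mat(3)[OF M] fdet_def)
qed

text \<open>The kernel is taken on the left, as a relation between rows: later the rows are the
  vectors of a frame and the columns are coordinates. This is why the transpose appears.\<close>

lemma fdet_eq_0:
  assumes "fdet n A = 0"
  obtains y i where "i < n" "y i \<noteq> 0" "\<And>j. j < n \<Longrightarrow> (\<Sum>i<n. y i * A i j) = 0"
proof -
  let ?M = "Matrix.mat n n (\<lambda>(i, j). A i j)"
  have M: "?M \<in> carrier_mat n n" by simp
  have "Determinant.det ?M\<^sup>T = 0" using assms Determinant.det_transpose[OF M] by (simp add: fdet_def)
  then obtain v where v: "v \<in> carrier_vec n" "v \<noteq> 0\<^sub>v n" "?M\<^sup>T *\<^sub>v v = 0\<^sub>v n"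
    using det_0_iff_vec_prod_zero[of "?M\<^sup>T" n] by auto
  obtain i where i: "i < n" "vec_index v i \<noteq> 0" using v(1,2) by (metis carrier_vecD eq_vecI index_zero_vec)
  have "(\<Sum>i<n. vec_index v i * A i j) = 0" if "j < n" for j
  proof -
    have "vec_index (?M\<^sup>T *\<^sub>v v) j = (\<Sum>i=0..<n. ?M\<^sup>T $$ (j, i) * vec_index v i)"
      using that v(1) by (simp add: scalar_prod_def)
    also have "\<dots> = (\<Sum>i<n. vec_index v i * A i j)" by (rule sum.cong) (use that in auto)
    finally show ?thesis using v(3) that by simp
  qed
  then show ?thesis using i that[of i "\<lambda>i. vec_index v i"] by blast
qed

lemma fdet_nonzero_kernel:
  assumes "fdet n A \<noteq> 0" "\<And>j. j < n \<Longrightarrow> (\<Sum>i<n. y i * A i j) = 0" "i < n"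
  shows "y i = 0"
proof -
  let ?M = "Matrix.mat n n (\<lambda>(i, j). A i j)" and ?v = "Matrix.vec n y"
  have M: "?M \<in> carrier_mat n n" by simp
  have "?M\<^sup>T *\<^sub>v ?v = 0\<^sub>v n"
  proof (rule eq_vecI)
    fix j assume j: "j < dim_vec (0\<^sub>v n :: complex Matrix.vec)"
    have "vec_index (?M\<^sup>T *\<^sub>v ?v) j = (\<Sum>i=0..<n. ?M\<^sup>T $$ (j, i) * vec_index ?v i)"
      using j by (simp add: scalar_prod_def)
    also have "\<dots> = (\<Sum>i<n. y i * A i j)" by (rule sum.cong) (use j in auto)
    finally show "vec_index (?M\<^sup>T *\<^sub>v ?v) j = vec_index (0\<^sub>v n) j" using assms(2) j by simp
  qed simp
  moreover have "Determinant.det ?M\<^sup>T \<noteq> 0" using assms(1) Determinant.det_transpose[OF M] by (simp add: fdet_def)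
  ultimately have "?v = 0\<^sub>v n"
    using det_0_iff_vec_prod_zero[of "?M\<^sup>T" n] by (metis M transpose_carrier_mat vec_carrier)
  then show ?thesis using \<open>i < n\<close> by (metis index_vec index_zero_vec(1))
qed

lemma fdet_nonzero_permutation:
  assumes "fdet n A \<noteq> 0"
  obtains p where "p permutes {..<n}" "\<And>i. i < n \<Longrightarrow> A i (p i) \<noteq> 0"
proof -
  obtain p where p: "p permutes {0..<n}" "(\<Prod>i=0..<n. A i (p i)) \<noteq> 0"
    using assms unfolding fdet_Leibniz by (metis (no_types, lifting) mem_Collect_eq mult_eq_0_iff sum.neutral)
  then show ?thesis using that[of p] by (simp add: atLeast0LessThan)
qed


section \<open>Representations in coordinates\<close>

text \<open>\<open>b k i\<close> spans the \<open>k\<close>-th thin summand at the vertex \<open>i\<close> and \<open>cd i k\<close> is the corresponding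
  coordinate functional, extended to the whole type; \<open>\<alpha> a k\<close> is the matrix entry of the arrow \<open>a\<close>
  on the \<open>k\<close>-th summand.\<close>

locale coordinate_rep =
  fixes Q :: "('v, 'a) pre_digraph"
    and V :: "('v, 'a, 'm::complex_vector) qrep"
    and K :: "'k set"
    and b :: "'k \<Rightarrow> 'v \<Rightarrow> 'm"
    and d :: "'k \<Rightarrow> int"
    and cd :: "'v \<Rightarrow> 'k \<Rightarrow> 'm \<Rightarrow> complex"
    and \<alpha> :: "'a \<Rightarrow> 'k \<Rightarrow> complex"
    and t :: "complex \<Rightarrow> 'v \<Rightarrow> 'm \<Rightarrow> 'm"
  assumes fin_verts: "finite (verts Q)" and fin_arcs: "finite (arcs Q)" and wf: "wf_digraph Q"
    and rep: "representation Q V"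
    and fin_K: "finite K"
    and sp_eq: "sp V i = cvec.span ((\<lambda>k. b k i) ` K)"
    and cd_lin: "Vector_Spaces.linear scaleC scaleC (cd i k)"
    and cd_b: "k \<in> K \<Longrightarrow> l \<in> K \<Longrightarrow> cd i k (b l i) = (if k = l \<and> b l i \<noteq> 0 then 1 else 0)"
    and act_b: "a \<in> arcs Q \<Longrightarrow> k \<in> K \<Longrightarrow> act V a (b k (tail Q a)) = \<alpha> a k *\<^sub>C b k (head Q a)"
    and alpha_nz: "a \<in> arcs Q \<Longrightarrow> k \<in> K \<Longrightarrow> \<alpha> a k \<noteq> 0 \<Longrightarrow> b k (tail Q a) \<noteq> 0 \<and> b k (head Q a) \<noteq> 0"
    and d_inj: "inj_on d K"
    and t_eq: "z \<noteq> 0 \<Longrightarrow> x \<in> sp V i \<Longrightarrow> t z i x = (\<Sum>k\<in>K. (z powi d k * cd i k x) *\<^sub>C b k i)"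
begin

lemmas cdD = linearD[OF cd_lin]

text \<open>The indices of the basis vectors at the vertex \<open>i\<close>; a summand that is zero
  at \<open>i\<close> has \<open>b k i = 0\<close> and must be left out.\<close>

definition T :: "'v \<Rightarrow> 'k set" where
  "T i = {k \<in> K. b k i \<noteq> 0}"

lemma finite_T: "finite (T i)" and T_K: "k \<in> T i \<Longrightarrow> k \<in> K"
  using fin_K by (auto simp: T_def)

lemma subspace_sp: "cvec.subspace (sp V i)"
  by (simp add: sp_eq)

lemma b_sp: "k \<in> K \<Longrightarrow> b k i \<in> sp V i"
  by (auto simp: sp_eq intro: cvec.span_base)

lemma T_empty: "i \<notin> verts Q \<Longrightarrow> T i = {}"
  using rep b_sp[of _ i] by (fastforce simp: representation_def T_def)

lemma expansion: "x \<in> sp V i \<Longrightarrow> x = (\<Sum>k\<in>K. cd i k x *\<^sub>C b k i)"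
  unfolding sp_eq
proof (induction rule: cvec.span_induct_alt)
  case base
  then show ?case by (simp add: cdD)
next
  case (step a x y)
  then obtain l where l: "l \<in> K" "x = b l i" by auto
  have "(\<Sum>k\<in>K. cd i k (a *\<^sub>C x + y) *\<^sub>C b k i) =
      (\<Sum>k\<in>K. (a * cd i k x) *\<^sub>C b k i) + (\<Sum>k\<in>K. cd i k y *\<^sub>C b k i)"
    by (simp add: cdD scaleC_complex scaleC_add_left sum.distrib)
  also have "(\<Sum>k\<in>K. (a * cd i k x) *\<^sub>C b k i) = (\<Sum>k\<in>K. if k = l then a *\<^sub>C x else 0)"
    by (intro sum.cong) (use l in \<open>auto simp: cd_b\<close>)
  finally show ?case using step(2) l(1) fin_K by simp
qed

lemma combination_sp: "(\<Sum>k\<in>K. c k *\<^sub>C b k i) \<in> sp V i"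
  by (intro cvec.subspace_sum[OF subspace_sp] cvec.subspace_scale[OF subspace_sp] b_sp)

lemma cd_combination:
  assumes "k \<in> K"
  shows "cd i k (\<Sum>l\<in>K. c l *\<^sub>C b l i) = (if k \<in> T i then c k else 0)"
proof -
  have "cd i k (\<Sum>l\<in>K. c l *\<^sub>C b l i) = (\<Sum>l\<in>K. if l = k then (if k \<in> T i then c k else 0) else 0)"
    unfolding cdD by (intro sum.cong) (use assms in \<open>auto simp: cd_b scaleC_complex T_def\<close>)
  then show ?thesis using assms fin_K by simp
qed

lemma cd_outside: "k \<in> K \<Longrightarrow> k \<notin> T i \<Longrightarrow> x \<in> sp V i \<Longrightarrow> cd i k x = 0"
  by (metis cd_combination expansion)

lemma sp_eqI:
  assumes "x \<in> sp V i" "y \<in> sp V i" "\<And>k. k \<in> T i \<Longrightarrow> cd i k x = cd i k y"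
  shows "x = y"
proof -
  have "(\<Sum>k\<in>K. cd i k x *\<^sub>C b k i) = (\<Sum>k\<in>K. cd i k y *\<^sub>C b k i)"
    by (rule sum.cong) (use assms(3) in \<open>auto simp: T_def\<close>)
  then show ?thesis using expansion[OF assms(1)] expansion[OF assms(2)] by simp
qed

lemma act_sp: "a \<in> arcs Q \<Longrightarrow> x \<in> sp V (tail Q a) \<Longrightarrow> act V a x \<in> sp V (head Q a)"
  using rep unfolding representation_def by blast

lemma act_linear: "a \<in> arcs Q \<Longrightarrow> clinear_on (sp V (tail Q a)) (act V a)"
  using rep by (auto simp: representation_def)

lemma act_expansion:
  assumes "a \<in> arcs Q" "x \<in> sp V (tail Q a)"
  shows "act V a x = (\<Sum>k\<in>K. (\<alpha> a k * cd (tail Q a) k x) *\<^sub>C b k (head Q a))"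
proof -
  have "act V a x = act V a (\<Sum>k\<in>K. cd (tail Q a) k x *\<^sub>C b k (tail Q a))"
    using expansion[OF assms(2)] by simp
  also have "\<dots> = (\<Sum>k\<in>K. cd (tail Q a) k x *\<^sub>C act V a (b k (tail Q a)))"
    by (rule clinear_on_sum[OF act_linear[OF assms(1)] subspace_sp b_sp])
  finally show ?thesis using act_b[OF assms(1)] by (simp add: scaleC_scaleC mult.commute)
qed

lemma alpha_T: "a \<in> arcs Q \<Longrightarrow> k \<in> K \<Longrightarrow> \<alpha> a k \<noteq> 0 \<Longrightarrow> k \<in> T (tail Q a) \<and> k \<in> T (head Q a)"
  using alpha_nz by (auto simp: T_def)

lemma cd_act:
  assumes "a \<in> arcs Q" "x \<in> sp V (tail Q a)" "k \<in> K"
  shows "cd (head Q a) k (act V a x) = \<alpha> a k * cd (tail Q a) k x"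
  unfolding act_expansion[OF assms(1,2)] cd_combination[OF assms(3)] using alpha_T[OF assms(1,3)] by auto

lemma t_sp: "z \<noteq> 0 \<Longrightarrow> x \<in> sp V i \<Longrightarrow> t z i x \<in> sp V i"
  by (simp add: t_eq combination_sp)

lemma cd_t: "z \<noteq> 0 \<Longrightarrow> x \<in> sp V i \<Longrightarrow> k \<in> K \<Longrightarrow> cd i k (t z i x) = z powi d k * cd i k x"
  by (simp add: t_eq cd_combination cd_outside)

section \<open>Graphs of linear maps over coordinate subspaces\<close>

definition chartvec :: "('v \<times> 'k \<times> 'k \<Rightarrow> complex) \<Rightarrow> 'v \<Rightarrow> 'k \<Rightarrow> 'm" where
  "chartvec x i l = b l i + (\<Sum>k\<in>K. x (i, k, l) *\<^sub>C b k i)"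

text \<open>The entry \<open>x (i, k, l)\<close> is the coefficient of \<open>b k i\<close> in the
  image of \<open>b l i\<close> under a linear map from the span of the vectors indexed by
  \<open>S i\<close> to the span of the others; this space is its graph.\<close>

definition chart :: "('v \<Rightarrow> 'k set) \<Rightarrow> ('v \<times> 'k \<times> 'k \<Rightarrow> complex) \<Rightarrow> 'v \<Rightarrow> 'm set" where
  "chart S x i = cvec.span (chartvec x i ` S i)"

definition chart_index :: "('v \<Rightarrow> 'k set) \<Rightarrow> ('v \<times> 'k \<times> 'k) set" where
  "chart_index S = {(i, k, l). l \<in> S i \<and> k \<in> T i - S i}"

definition supported :: "('v \<Rightarrow> 'k set) \<Rightarrow> ('v \<times> 'k \<times> 'k \<Rightarrow> complex) \<Rightarrow> bool" where
  "supported S x \<longleftrightarrow> (\<forall>p. p \<notin> chart_index S \<longrightarrow> x p = 0)"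

lemma supportedD: "supported S x \<Longrightarrow> p \<notin> chart_index S \<Longrightarrow> x p = 0"
  unfolding supported_def by blast

text \<open>The entries of positive degree \<open>d k - d l\<close>. As \<open>d\<close> is
  injective on \<open>K\<close> and \<open>k \<noteq> l\<close>, the other entries of the chart have
  negative degree.\<close>

definition pos_index :: "('v \<Rightarrow> 'k set) \<Rightarrow> ('v \<times> 'k \<times> 'k) set" where
  "pos_index S = {(i, k, l). l \<in> S i \<and> k \<in> T i - S i \<and> d l < d k}"

lemma pos_chart_index: "pos_index S \<subseteq> chart_index S"
  by (auto simp: pos_index_def chart_index_def)

context
  fixes S :: "'v \<Rightarrow> 'k set"
  assumes S_T: "\<And>i. S i \<subseteq> T i"
begin

lemma S_K: "l \<in> S i \<Longrightarrow> l \<in> K"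
  using S_T T_K by blast

lemma finite_S: "finite (S i)"
  using S_T finite_T finite_subset by blast

lemma finite_chart_index: "finite (chart_index S)"
proof (rule finite_subset)
  show "chart_index S \<subseteq> verts Q \<times> K \<times> K"
    using T_empty T_K S_T by (fastforce simp: chart_index_def)
qed (simp add: fin_verts fin_K)

lemma chartvec_sp: "l \<in> S i \<Longrightarrow> chartvec x i l \<in> sp V i"
  unfolding chartvec_def by (intro cvec.subspace_add[OF subspace_sp] b_sp combination_sp S_K)

lemma chart_sp: "chart S x i \<subseteq> sp V i"
  unfolding chart_def by (intro cvec.span_minimal subspace_sp) (auto intro: chartvec_sp)

lemma cd_chartvec:
  assumes "supported S x" "l \<in> S i" "k \<in> K"
  shows "cd i k (chartvec x i l) = (if k = l then 1 else 0) + x (i, k, l)"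
proof -
  have "l \<in> T i" using assms(2) S_T by blast
  then have "cd i k (b l i) = (if k = l then 1 else 0)"
    using cd_b[OF assms(3) T_K] by (auto simp: T_def)
  moreover have "k \<notin> T i \<Longrightarrow> x (i, k, l) = 0" using supportedD[OF assms(1), of "(i, k, l)"] by (auto simp: chart_index_def)
  ultimately show ?thesis
    by (auto simp: chartvec_def cdD(1) cd_combination[OF assms(3)])
qed

lemma cd_chartvec_S:
  assumes "supported S x" "l \<in> S i" "k \<in> S i"
  shows "cd i k (chartvec x i l) = (if k = l then 1 else 0)"
  using cd_chartvec[OF assms(1,2) S_K[OF assms(3)]] supportedD[OF assms(1), of "(i, k, l)"] assms(3)
  by (simp add: chart_index_def)

context
  fixes x :: "'v \<times> 'k \<times> 'k \<Rightarrow> complex"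
  assumes x: "supported S x"
begin

lemma chartvec_independent: "inj_on (chartvec x i) (S i)" "\<not> cvec.dependent (chartvec x i ` S i)"
  by (rule independent_dual[OF finite_S, where c = "cd i"];
      auto simp: cd_lin cd_chartvec_S[OF x])+

lemma dim_chart: "cvec.dim (chart S x i) = card (S i)"
  using cvec.dim_eq_card_independent[OF chartvec_independent(2)[of i]] card_image[OF chartvec_independent(1)[of i]]
  by (simp add: chart_def)

lemma chart_expansion: "v \<in> chart S x i \<Longrightarrow> v = (\<Sum>m\<in>S i. cd i m v *\<^sub>C chartvec x i m)"
  unfolding chart_def
proof (induction rule: cvec.span_induct_alt)
  case base
  then show ?case by (simp add: cdD)
next
  case (step a u y)
  then obtain l where l: "l \<in> S i" "u = chartvec x i l" by auto
  have "(\<Sum>k\<in>S i. cd i k (a *\<^sub>C u + y) *\<^sub>C chartvec x i k) =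
      (\<Sum>k\<in>S i. (a * cd i k u) *\<^sub>C chartvec x i k) + (\<Sum>k\<in>S i. cd i k y *\<^sub>C chartvec x i k)"
    by (simp add: cdD scaleC_complex scaleC_add_left sum.distrib)
  also have "(\<Sum>k\<in>S i. (a * cd i k u) *\<^sub>C chartvec x i k) = (\<Sum>k\<in>S i. if k = l then a *\<^sub>C u else 0)"
    by (intro sum.cong) (use l in \<open>auto simp: cd_chartvec_S[OF x]\<close>)
  finally show ?case using step(2) l(1) finite_S by simp
qed

lemma chartvec_chart: "l \<in> S i \<Longrightarrow> chartvec x i l \<in> chart S x i"
  by (auto simp: chart_def intro: cvec.span_base)

lemma cd_chart_combination:
  assumes "k \<in> T i - S i"
  shows "cd i k (\<Sum>m\<in>S i. c m *\<^sub>C chartvec x i m) = (\<Sum>m\<in>S i. c m * x (i, k, m))"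
proof -
  have "k \<in> K" "\<And>m. m \<in> S i \<Longrightarrow> k \<noteq> m" using assms T_K by auto
  then show ?thesis
    unfolding cdD by (intro sum.cong) (auto simp: cd_chartvec[OF x] scaleC_complex)
qed

lemma cd_chart_combination_S:
  assumes "k \<in> S i"
  shows "cd i k (\<Sum>m\<in>S i. c m *\<^sub>C chartvec x i m) = c k"
proof -
  have "cd i k (\<Sum>m\<in>S i. c m *\<^sub>C chartvec x i m) = (\<Sum>m\<in>S i. if m = k then c k else 0)"
    unfolding cdD by (rule sum.cong) (use assms in \<open>auto simp: cd_chartvec_S[OF x] scaleC_complex\<close>)
  then show ?thesis using assms finite_S by simp
qed

text \<open>Equation of a graph: the coordinates outside \<open>S i\<close> are the image of the
  pivot coordinates. The only candidate in the graph is the combination of the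
  \<open>chartvec\<close> with the pivot coordinates of \<open>v\<close>.\<close>

lemma mem_chart:
  assumes v: "v \<in> sp V i"
  shows "v \<in> chart S x i \<longleftrightarrow> (\<forall>k\<in>T i - S i. cd i k v = (\<Sum>m\<in>S i. cd i m v * x (i, k, m)))"
proof
  assume "v \<in> chart S x i"
  from chart_expansion[OF this] show "\<forall>k\<in>T i - S i. cd i k v = (\<Sum>m\<in>S i. cd i m v * x (i, k, m))"
    using cd_chart_combination[of _ i "\<lambda>m. cd i m v"] by simp
next
  assume *: "\<forall>k\<in>T i - S i. cd i k v = (\<Sum>m\<in>S i. cd i m v * x (i, k, m))"
  let ?w = "\<Sum>m\<in>S i. cd i m v *\<^sub>C chartvec x i m"
  have w: "?w \<in> chart S x i"
    unfolding chart_def by (intro cvec.span_sum cvec.span_scale cvec.span_base) auto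
  have "v = ?w"
  proof (rule sp_eqI[OF v])
    show "?w \<in> sp V i" using w chart_sp by blast
    show "cd i k v = cd i k ?w" if "k \<in> T i" for k
      using * that cd_chart_combination cd_chart_combination_S by (cases "k \<in> S i") auto
  qed
  then show "v \<in> chart S x i" using w by simp
qed

lemma chart_zero: "v \<in> chart S x i \<Longrightarrow> (\<And>m. m \<in> S i \<Longrightarrow> cd i m v = 0) \<Longrightarrow> v = 0"
  using chart_expansion by fastforce

end

lemma chart_inj:
  assumes x: "supported S x" and y: "supported S y"
    and "chart S x = chart S y"
  shows "x = y"
proof
  fix p :: "'v \<times> 'k \<times> 'k"
  obtain i k l where p: "p = (i, k, l)" by (metis prod_cases3)
  show "x p = y p"
  proof (cases "p \<in> chart_index S")
    case True
    then have l: "l \<in> S i" and k: "k \<in> T i - S i" by (auto simp: p chart_index_def)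
    have "chartvec x i l \<in> chart S y i" using chartvec_chart[OF x l] assms(3) by simp
    then have "cd i k (chartvec x i l) = (\<Sum>m\<in>S i. cd i m (chartvec x i l) * y (i, k, m))"
      using mem_chart[OF y chartvec_sp[OF l]] k by auto
    also have "\<dots> = (\<Sum>m\<in>S i. if m = l then y (i, k, l) else 0)"
      by (rule sum.cong) (use l in \<open>auto simp: cd_chartvec_S[OF x]\<close>)
    finally show ?thesis
      using cd_chartvec[OF x l, of k] k l finite_S T_K by (auto simp: p)
  qed (simp add: supportedD[OF x] supportedD[OF y])
qed

text \<open>The vectors \<open>w\<close> are dual to the pivot coordinates, and these are injective
  on \<open>N i\<close> by \<open>zero\<close>. So each \<open>v\<close> in \<open>N i\<close>
  equals the combination of the \<open>w l\<close> with its own pivot coordinates, and each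
  \<open>w l\<close> is forced to be a \<open>chartvec\<close>.\<close>

lemma chart_eqI:
  assumes N: "cvec.subspace (N i)" "N i \<subseteq> sp V i"
    and w: "\<And>l. l \<in> S i \<Longrightarrow> w l \<in> N i"
      "\<And>l m. l \<in> S i \<Longrightarrow> m \<in> S i \<Longrightarrow> cd i m (w l) = (if m = l then 1 else 0)"
    and zero: "\<And>v. v \<in> N i \<Longrightarrow> (\<And>m. m \<in> S i \<Longrightarrow> cd i m v = 0) \<Longrightarrow> v = 0"
    and x: "supported S x"
    and xw: "\<And>k l. (i, k, l) \<in> chart_index S \<Longrightarrow> x (i, k, l) = cd i k (w l)"
  shows "N i = chart S x i"
proof -
  have wx: "w l = chartvec x i l" if l: "l \<in> S i" for l
  proof (rule sp_eqI)
    show "w l \<in> sp V i" using w(1)[OF l] N by auto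
    show "chartvec x i l \<in> sp V i" by (rule chartvec_sp[OF l])
    show "cd i k (w l) = cd i k (chartvec x i l)" if "k \<in> T i" for k
      using cd_chartvec[OF x l T_K[OF that]] cd_chartvec_S[OF x l] w(2)[OF l] xw[of k l] that l
      by (cases "k \<in> S i") (auto simp: chart_index_def)
  qed
  show ?thesis
  proof
    show "N i \<subseteq> chart S x i"
    proof
      fix v assume v: "v \<in> N i"
      let ?u = "\<Sum>m\<in>S i. cd i m v *\<^sub>C w m"
      have u: "?u = (\<Sum>m\<in>S i. cd i m v *\<^sub>C chartvec x i m)" by (simp add: wx)
      have "?u \<in> N i" by (intro cvec.subspace_sum cvec.subspace_scale N w)
      then have "v - ?u = 0"
        by (intro zero cvec.subspace_diff N v) (simp_all add: u cdD(4) cd_chart_combination_S[OF x])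
      then have "v = (\<Sum>m\<in>S i. cd i m v *\<^sub>C chartvec x i m)" using u by simp
      moreover have "\<dots> \<in> chart S x i"
        unfolding chart_def by (intro cvec.span_sum cvec.span_scale cvec.span_base) auto
      ultimately show "v \<in> chart S x i" by simp
    qed
    show "chart S x i \<subseteq> N i"
      unfolding chart_def by (rule cvec.span_minimal) (use w(1) wx N in auto)
  qed
qed

end

text \<open>The graph equation at \<open>k\<close> for the image under \<open>a\<close> of the graph
  vector with pivot \<open>l\<close>. That image has \<open>m\<close>-coordinate
  \<open>\<alpha> a m * x (tail Q a, m, l)\<close>, plus \<open>\<alpha> a l\<close> if
  \<open>m = l\<close>; the latter gives the linear term at the head. The sum may run over
  \<open>K\<close>, because for supported \<open>x\<close> the factor at the head vanishes unless
  \<open>m\<close> is a pivot there.\<close>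

definition cell_eqs :: "('v \<Rightarrow> 'k set) \<Rightarrow> ('v \<times> 'k \<times> 'k \<Rightarrow> complex) \<Rightarrow> bool" where
  "cell_eqs S x \<longleftrightarrow> (\<forall>a\<in>arcs Q. \<forall>l\<in>S (tail Q a). \<forall>k\<in>T (head Q a) - S (head Q a).
     \<alpha> a k * x (tail Q a, k, l) - \<alpha> a l * x (head Q a, k, l) =
     (\<Sum>m\<in>K. \<alpha> a m * x (head Q a, k, m) * x (tail Q a, m, l)))"

definition cell_coords :: "('v \<Rightarrow> 'k set) \<Rightarrow> ('v \<times> 'k \<times> 'k \<Rightarrow> complex) set" where
  "cell_coords S = {x. (\<forall>p. p \<notin> pos_index S \<longrightarrow> x p = 0) \<and> cell_eqs S x}"

text \<open>Combinatorial form of the fixed points: the last condition says that the span of the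
  chosen basis vectors is stable under the arrows.\<close>

definition cells :: "('v \<Rightarrow> nat) \<Rightarrow> ('v \<Rightarrow> 'k set) set" where
  "cells e = {S. (\<forall>i. S i \<subseteq> T i) \<and> (\<forall>i. card (S i) = e i) \<and>
     (\<forall>a\<in>arcs Q. \<forall>k\<in>S (tail Q a). \<alpha> a k \<noteq> 0 \<longrightarrow> k \<in> S (head Q a))}"

lemma cellsD:
  assumes "S \<in> cells e"
  shows "S i \<subseteq> T i" "card (S i) = e i"
    "a \<in> arcs Q \<Longrightarrow> k \<in> S (tail Q a) \<Longrightarrow> \<alpha> a k \<noteq> 0 \<Longrightarrow> k \<in> S (head Q a)"
  using assms by (auto simp: cells_def)

lemma cell_coords_pos: "x \<in> cell_coords S \<Longrightarrow> p \<notin> pos_index S \<Longrightarrow> x p = 0"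
  unfolding cell_coords_def by blast

lemma cell_coords_supported: "x \<in> cell_coords S \<Longrightarrow> supported S x"
  using pos_chart_index[of S] unfolding cell_coords_def supported_def by blast

lemma chart_subrep:
  assumes S: "S \<in> cells e" and x: "supported S x"
  shows "subrep Q V (chart S x) \<longleftrightarrow> cell_eqs S x"
proof -
  note S_T = cellsD(1)[OF S]
  have key: "act V a (chartvec x (tail Q a) l) \<in> chart S x (head Q a) \<longleftrightarrow>
      (\<forall>k\<in>T (head Q a) - S (head Q a). \<alpha> a k * x (tail Q a, k, l) - \<alpha> a l * x (head Q a, k, l) =
         (\<Sum>m\<in>K. \<alpha> a m * x (head Q a, k, m) * x (tail Q a, m, l)))"
    if a: "a \<in> arcs Q" and l: "l \<in> S (tail Q a)" for a l
  proof -
    let ?i = "tail Q a" and ?j = "head Q a" and ?w = "chartvec x (tail Q a) l"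
    have lK: "l \<in> K" using S_K[OF S_T l] .
    have w: "?w \<in> sp V ?i" by (rule chartvec_sp[OF S_T l])
    have cdw: "cd ?j k (act V a ?w) = \<alpha> a k * ((if k = l then 1 else 0) + x (?i, k, l))" if "k \<in> K" for k
      using cd_act[OF a w that] cd_chartvec[OF S_T x l that] by simp
    have "cd ?j k (act V a ?w) = (\<Sum>m\<in>S ?j. cd ?j m (act V a ?w) * x (?j, k, m)) \<longleftrightarrow>
        \<alpha> a k * x (?i, k, l) - \<alpha> a l * x (?j, k, l) = (\<Sum>m\<in>K. \<alpha> a m * x (?j, k, m) * x (?i, m, l))"
      if k: "k \<in> T ?j - S ?j" for k
    proof -
      \<comment> \<open>A pivot at the tail with nonzero matrix entry is a pivot at the head, which
        \<open>k\<close> is not; so the diagonal coefficient 1 contributes nothing.\<close>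
      have "k = l \<Longrightarrow> \<alpha> a k = 0" using cellsD(3)[OF S a, of k] k l by auto
      then have L: "cd ?j k (act V a ?w) = \<alpha> a k * x (?i, k, l)"
        using cdw[OF T_K] k by (auto simp: distrib_left)
      have out: "x (?j, k, m) = 0" if "m \<notin> S ?j" for m
        using supportedD[OF x, of "(?j, k, m)"] that by (simp add: chart_index_def)
      have "(\<Sum>m\<in>S ?j. cd ?j m (act V a ?w) * x (?j, k, m)) =
          (\<Sum>m\<in>K. \<alpha> a m * ((if m = l then 1 else 0) + x (?i, m, l)) * x (?j, k, m))"
        using S_K[OF S_T] cdw out fin_K by (intro sum.mono_neutral_cong_left) auto
      also have "\<dots> = (\<Sum>m\<in>K. if m = l then \<alpha> a l * x (?j, k, l) else 0) +
          (\<Sum>m\<in>K. \<alpha> a m * x (?j, k, m) * x (?i, m, l))"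
        unfolding sum.distrib[symmetric] by (rule sum.cong) (auto simp: algebra_simps)
      finally show ?thesis using L lK fin_K by (auto simp: algebra_simps)
    qed
    then show ?thesis
      unfolding mem_chart[OF S_T x act_sp[OF a w]] by blast
  qed
  have "act V a ` chart S x (tail Q a) \<subseteq> chart S x (head Q a) \<longleftrightarrow>
      (\<forall>l\<in>S (tail Q a). act V a (chartvec x (tail Q a) l) \<in> chart S x (head Q a))" if a: "a \<in> arcs Q" for a
  proof
    assume *: "\<forall>l\<in>S (tail Q a). act V a (chartvec x (tail Q a) l) \<in> chart S x (head Q a)"
    show "act V a ` chart S x (tail Q a) \<subseteq> chart S x (head Q a)"
    proof safe
      fix v assume v: "v \<in> chart S x (tail Q a)"
      have "act V a v = act V a (\<Sum>m\<in>S (tail Q a). cd (tail Q a) m v *\<^sub>C chartvec x (tail Q a) m)"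
        using chart_expansion[OF S_T x v] by simp
      also have "\<dots> = (\<Sum>m\<in>S (tail Q a). cd (tail Q a) m v *\<^sub>C act V a (chartvec x (tail Q a) m))"
        by (rule clinear_on_sum[OF act_linear[OF a] subspace_sp chartvec_sp[OF S_T]])
      also have "\<dots> \<in> chart S x (head Q a)"
        using * unfolding chart_def by (intro cvec.span_sum cvec.span_scale) auto
      finally show "act V a v \<in> chart S x (head Q a)" .
    qed
  qed (use chartvec_chart[OF S_T x] in blast)
  then show ?thesis
    using key chart_sp[OF S_T] by (auto simp: subrep_def cell_eqs_def chart_def)
qed

lemma chart_quiver_grass:
  assumes S: "S \<in> cells e" and x: "x \<in> cell_coords S"
  shows "chart S x \<in> quiver_grass Q V e"
  using chart_subrep[OF S cell_coords_supported[OF x]] x dim_chart[OF cellsD(1)[OF S] cell_coords_supported[OF x]]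
    cellsD(2)[OF S]
  by (auto simp: quiver_grass_def dimv_def fun_eq_iff cell_coords_def)

text \<open>The reduced echelon form of a subrepresentation; its pivots are the initial terms.\<close>

lemma ex_cell:
  assumes N: "N \<in> quiver_grass Q V e"
  obtains S x where "S \<in> cells e" "x \<in> cell_coords S" "N = chart S x"
proof -
  have sub: "cvec.subspace (N i)" and Nsp: "N i \<subseteq> sp V i"
    and Nact: "\<And>a. a \<in> arcs Q \<Longrightarrow> act V a ` N (tail Q a) \<subseteq> N (head Q a)" for i
    using N by (auto simp: quiver_grass_def subrep_def)
  \<comment> \<open>A vector of \<open>N i\<close> with initial term \<open>b k i\<close>:
    coefficient 1 there and no terms of smaller degree.\<close>
  define init where "init i k v \<longleftrightarrow> v \<in> N i \<and> cd i k v = 1 \<and> (\<forall>m\<in>T i. d m < d k \<longrightarrow> cd i m v = 0)" for i k v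
  define S where "S i = {k \<in> T i. \<exists>v. init i k v}" for i
  have S_T: "S i \<subseteq> T i" for i by (auto simp: S_def)
  \<comment> \<open>The lowest term of a nonzero vector would make its index a pivot.\<close>
  have zero: "v = 0" if v: "v \<in> N i" "\<And>m. m \<in> S i \<Longrightarrow> cd i m v = 0" for i v
  proof (rule ccontr)
    assume "v \<noteq> 0"
    have "0 \<in> sp V i" using subspace_sp cvec.subspace_0 by blast
    then have "{k \<in> T i. cd i k v \<noteq> 0} \<noteq> {}"
      using sp_eqI[of v i 0] v Nsp \<open>v \<noteq> 0\<close> by (auto simp: cdD)
    moreover have "finite {k \<in> T i. cd i k v \<noteq> 0}" using finite_T by simp
    ultimately obtain k where k: "k \<in> T i" "cd i k v \<noteq> 0"
      and min: "\<And>m. m \<in> T i \<Longrightarrow> cd i m v \<noteq> 0 \<Longrightarrow> d k \<le> d m"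
      using arg_min_if_finite(1)[of "{k \<in> T i. cd i k v \<noteq> 0}" d]
        arg_min_least[of "{k \<in> T i. cd i k v \<noteq> 0}" _ d] by blast
    have "init i k ((1 / cd i k v) *\<^sub>C v)"
      using k v sub min by (force simp: init_def cdD scaleC_complex intro: cvec.subspace_scale)
    then have "k \<in> S i" using k by (auto simp: S_def)
    then show False using v k by blast
  qed
  have "\<exists>v. init i k v \<and> (\<forall>m\<in>S i. m \<noteq> k \<longrightarrow> cd i m v = 0)" if "k \<in> S i" for i k
    using that
  \<comment> \<open>Induction on the number of pivots of larger degree: the vectors already reduced
    at those pivots are subtracted, and as their terms all have degree larger than
    \<open>d k\<close>, the terms up to \<open>d k\<close> stay as they are.\<close>
  proof (induction "card {m \<in> S i. d k < d m}" arbitrary: k rule: less_induct)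
    case less
    let ?R = "{m \<in> S i. d k < d m}"
    have finR: "finite ?R" using finite_S[OF S_T] by simp
    have "\<exists>w. init i m w \<and> (\<forall>n\<in>S i. n \<noteq> m \<longrightarrow> cd i n w = 0)" if m: "m \<in> ?R" for m
    proof (rule less(1))
      have "{n \<in> S i. d m < d n} \<subset> ?R" using m by auto
      then show "card {n \<in> S i. d m < d n} < card ?R" using finR psubset_card_mono by blast
    qed (use m in auto)
    then obtain w where w: "\<And>m. m \<in> ?R \<Longrightarrow> init i m (w m)"
      "\<And>m n. m \<in> ?R \<Longrightarrow> n \<in> S i \<Longrightarrow> n \<noteq> m \<Longrightarrow> cd i n (w m) = 0" by metis
    obtain v where v: "init i k v" using less(2) by (auto simp: S_def)
    let ?u = "v - (\<Sum>m\<in>?R. cd i m v *\<^sub>C w m)"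
    have cdu: "cd i n ?u = cd i n v - (\<Sum>m\<in>?R. cd i m v * cd i n (w m))" for n
      by (simp add: cdD scaleC_complex)
    have low: "cd i n ?u = cd i n v" if "n \<in> T i" "d n \<le> d k" for n
    proof -
      have "cd i m v * cd i n (w m) = 0" if "m \<in> ?R" for m
        using w(1)[OF that] that \<open>n \<in> T i\<close> \<open>d n \<le> d k\<close> by (auto simp: init_def)
      then have "(\<Sum>m\<in>?R. cd i m v * cd i n (w m)) = 0" by (intro sum.neutral) blast
      then show ?thesis unfolding cdu by simp
    qed
    have kT: "k \<in> T i" using less(2) by (simp add: S_def)
    have "init i k ?u"
      unfolding init_def
    proof (intro conjI)
      show "?u \<in> N i"
        using v w(1) by (intro cvec.subspace_diff cvec.subspace_sum cvec.subspace_scale sub) (auto simp: init_def)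
      show "cd i k ?u = 1" using low[OF kT] v by (simp add: init_def)
      show "\<forall>m\<in>T i. d m < d k \<longrightarrow> cd i m ?u = 0" using low v by (auto simp: init_def)
    qed
    moreover have "cd i n ?u = 0" if n: "n \<in> S i" "n \<noteq> k" for n
    proof (cases "d n < d k")
      case True
      then show ?thesis using low[of n] v n S_T by (auto simp: init_def)
    next
      case False
      have "d n \<noteq> d k" using n(2) S_K[OF S_T n(1)] S_K[OF S_T less(2)] d_inj by (auto simp: inj_on_def)
      then have nR: "n \<in> ?R" using n False by simp
      have "(\<Sum>m\<in>?R. cd i m v * cd i n (w m)) = (\<Sum>m\<in>?R. if m = n then cd i n v else 0)"
        by (rule sum.cong) (use w n(1) in \<open>auto simp: init_def\<close>)
      then show ?thesis unfolding cdu using nR finR by simp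
    qed
    ultimately show ?case by blast
  qed
  then have "\<forall>i k. \<exists>v. k \<in> S i \<longrightarrow> init i k v \<and> (\<forall>m\<in>S i. m \<noteq> k \<longrightarrow> cd i m v = 0)"
    by blast
  then obtain w where "\<forall>i k. k \<in> S i \<longrightarrow> init i k (w i k) \<and> (\<forall>m\<in>S i. m \<noteq> k \<longrightarrow> cd i m (w i k) = 0)"
    by metis
  then have w: "\<And>i k. k \<in> S i \<Longrightarrow> init i k (w i k)"
    "\<And>i k m. k \<in> S i \<Longrightarrow> m \<in> S i \<Longrightarrow> m \<noteq> k \<Longrightarrow> cd i m (w i k) = 0" by auto
  define x where "x p = (case p of (i, k, l) \<Rightarrow> if p \<in> chart_index S then cd i k (w i l) else 0)" for p
  have x: "supported S x" by (auto simp: supported_def x_def split: prod.split)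
  have xw: "x (i, k, l) = cd i k (w i l)" if "(i, k, l) \<in> chart_index S" for i k l
    using that by (simp add: x_def)
  have Nx: "N = chart S x"
  proof
    fix i
    show "N i = chart S x i"
      by (rule chart_eqI[where w = "w i", OF S_T sub Nsp])
        (use w zero x xw in \<open>auto simp: init_def\<close>)
  qed
  have S: "S \<in> cells e"
    unfolding cells_def
  proof (intro CollectI conjI allI ballI impI S_T)
    show "card (S i) = e i" for i
      using N dim_chart[OF S_T x, of i] Nx by (auto simp: quiver_grass_def dimv_def)
    fix a k assume a: "a \<in> arcs Q" and k: "k \<in> S (tail Q a)" and nz: "\<alpha> a k \<noteq> 0"
    have kK: "k \<in> K" using S_K[OF S_T k] .
    let ?w = "w (tail Q a) k"
    have wN: "?w \<in> N (tail Q a)" using w(1)[OF k] by (simp add: init_def)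
    then have wsp: "?w \<in> sp V (tail Q a)" using Nsp by blast
    have 0: "cd (head Q a) m (act V a ?w) = 0" if "m \<in> T (head Q a)" "d m < d k" for m
    proof (cases "\<alpha> a m = 0")
      case False
      then have "m \<in> T (tail Q a)" using alpha_T[OF a T_K[OF that(1)]] by auto
      then show ?thesis using cd_act[OF a wsp T_K[OF that(1)]] w(1)[OF k] that by (simp add: init_def)
    qed (simp add: cd_act[OF a wsp T_K[OF that(1)]])
    \<comment> \<open>An arrow acts diagonally, so the image of a vector with initial term
      \<open>k\<close> has initial term \<open>k\<close> again if \<open>\<alpha> a k\<close> is
      nonzero.\<close>
    have "init (head Q a) k ((1 / \<alpha> a k) *\<^sub>C act V a ?w)"
      using 0 Nact[OF a] wN nz w(1)[OF k] cd_act[OF a wsp kK] sub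
      by (auto simp: init_def cdD scaleC_complex intro!: cvec.subspace_scale)
    then show "k \<in> S (head Q a)" using alpha_T[OF a kK nz] by (auto simp: S_def)
  qed
  have "cell_eqs S x"
    using chart_subrep[OF S x] N Nx by (auto simp: quiver_grass_def)
  \<comment> \<open>The reduced vector with initial term \<open>l\<close> has no terms of degree
    below \<open>d l\<close>.\<close>
  moreover have "x p = 0" if "p \<notin> pos_index S" for p
  proof (cases "p \<in> chart_index S")
    case True
    then obtain i k l where p: "p = (i, k, l)" "l \<in> S i" "k \<in> T i - S i" by (auto simp: chart_index_def)
    then have "d k \<le> d l" using that by (auto simp: pos_index_def)
    moreover have "d k \<noteq> d l" using p S_K[OF S_T p(2)] T_K d_inj by (auto simp: inj_on_def)
    ultimately show ?thesis using w(1)[OF p(2)] p by (auto simp: x_def init_def)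
  qed (rule supportedD[OF x])
  ultimately show ?thesis using that[OF S _ Nx] by (auto simp: cell_coords_def)
qed

section \<open>Frames, minors and the open charts of the Grassmannian\<close>

definition enum :: "('v \<Rightarrow> 'k set) \<Rightarrow> 'v \<Rightarrow> nat \<Rightarrow> 'k" where
  "enum S i = (SOME g. bij_betw g {..<card (S i)} (S i))"

definition frame :: "('v \<Rightarrow> 'k set) \<Rightarrow> ('v \<times> 'k \<times> 'k \<Rightarrow> complex) \<Rightarrow> 'v \<Rightarrow> nat \<Rightarrow> 'm" where
  "frame S x = (\<lambda>i j. if j < card (S i) then chartvec x i (enum S i j) else 0)"

definition minor_matrix :: "('v \<Rightarrow> 'k set) \<Rightarrow> ('v \<Rightarrow> nat \<Rightarrow> 'm) \<Rightarrow> 'v \<Rightarrow> nat \<Rightarrow> nat \<Rightarrow> complex" where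
  "minor_matrix S u i j m = cd i (enum S i m) (u i j)"

definition minor :: "('v \<Rightarrow> 'k set) \<Rightarrow> ('v \<Rightarrow> nat \<Rightarrow> 'm) \<Rightarrow> 'v \<Rightarrow> complex" where
  "minor S u i = fdet (card (S i)) (minor_matrix S u i)"

text \<open>Cramer's rule: the row of the inverse of the minor matrix that belongs to
  \<open>l\<close>, applied to the frame. The result is the vector of the spanned space that is dual
  to the pivot coordinate \<open>l\<close>.\<close>

definition pivot :: "('v \<Rightarrow> 'k set) \<Rightarrow> ('v \<Rightarrow> nat \<Rightarrow> 'm) \<Rightarrow> 'v \<Rightarrow> 'k \<Rightarrow> 'm" where
  "pivot S u i l = (\<Sum>j<card (S i).
     (fadj (card (S i)) (minor_matrix S u i) (inv_into {..<card (S i)} (enum S i) l) j / minor S u i) *\<^sub>C u i j)"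

text \<open>Injectivity of the pivot coordinates on a space of the matching dimension makes it a
  graph over the span of the pivots; on frames it is the nonvanishing of a minor at every
  vertex.\<close>

definition open_chart :: "('v \<Rightarrow> nat) \<Rightarrow> ('v \<Rightarrow> 'k set) \<Rightarrow> ('v \<Rightarrow> 'm set) set" where
  "open_chart e S = {N \<in> quiver_grass Q V e. \<forall>i. \<forall>v\<in>N i. (\<forall>m\<in>S i. cd i m v = 0) \<longrightarrow> v = 0}"

text \<open>Expressed through the space \<open>N\<close> itself and not through a frame, so that it
  is a function on the points of the variety; on \<open>open_chart\<close> the described vector is
  unique.\<close>

definition chart_coord :: "('v \<Rightarrow> 'k set) \<Rightarrow> ('v \<Rightarrow> 'm set) \<Rightarrow> 'v \<Rightarrow> 'k \<Rightarrow> 'k \<Rightarrow> complex" where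
  "chart_coord S N i k l = cd i k (THE v. v \<in> N i \<and> (\<forall>m\<in>S i. cd i m v = (if m = l then 1 else 0)))"

lemma polyfun_cd: "polyfun (\<lambda>u. cd i k (u i j))"
  by (rule polyfun_comp_apply[where p = "\<lambda>w. cd i k (w j)"],
      rule polyfun_comp_apply[where p = "cd i k"], rule polyfun_linear, rule cd_lin)

lemma polyfun_minor: "polyfun (\<lambda>u. minor S u i)"
  unfolding minor_def minor_matrix_def by (intro polyfun_fdet polyfun_cd)

context
  fixes S :: "'v \<Rightarrow> 'k set" and e :: "'v \<Rightarrow> nat"
  assumes S: "S \<in> cells e"
begin

lemma enum_bij: "bij_betw (enum S i) {..<e i} (S i)"
proof -
  have "\<exists>g. bij_betw g {..<card (S i)} (S i)"
    using bij_betw_from_nat_into_finite[OF finite_S[OF cellsD(1)[OF S]]] by blast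
  then show ?thesis
    unfolding enum_def cellsD(2)[OF S] by (rule someI_ex)
qed

lemma enum_S: "j < e i \<Longrightarrow> enum S i j \<in> S i"
  using enum_bij[of i] by (auto simp: bij_betw_def)

lemma enum_surj:
  assumes "m \<in> S i"
  obtains n where "n < e i" "m = enum S i n"
proof -
  have "m \<in> enum S i ` {..<e i}" using assms enum_bij[of i] by (simp add: bij_betw_def)
  then show ?thesis using that by auto
qed

lemma e_0: "i \<notin> verts Q \<Longrightarrow> e i = 0"
  using T_empty cellsD(1)[OF S, of i] cellsD(2)[OF S, of i] by (metis card.empty subset_empty)

lemma frame_span_frame: "frame_span e (frame S x) = chart S x"
proof
  fix i
  have "chartvec x i ` S i = chartvec x i ` (enum S i ` {..<e i})"
    using enum_bij[of i] by (simp add: bij_betw_def)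
  also have "\<dots> = frame S x i ` {..<e i}"
    unfolding image_image by (rule image_cong) (auto simp: frame_def cellsD(2)[OF S])
  finally show "frame_span e (frame S x) i = chart S x i"
    by (simp add: frame_span_def chart_def)
qed

lemma frame_frames:
  assumes x: "supported S x"
  shows "frame S x \<in> frames V e"
  unfolding frames_def
proof (intro CollectI allI)
  fix i
  have "inj_on (frame S x i) {..<e i} \<and> \<not> cvec.dependent (frame S x i ` {..<e i})"
    using independent_dual[of "{..<e i}" "\<lambda>j. cd i (enum S i j)" "frame S x i"] enum_bij[of i] enum_S
    by (auto simp: frame_def cellsD(2)[OF S] cd_lin cd_chartvec_S[OF cellsD(1)[OF S] x] bij_betw_def inj_on_eq_iff)
  then show "(\<forall>j<e i. frame S x i j \<in> sp V i) \<and> (\<forall>j\<ge>e i. frame S x i j = 0) \<and>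
      inj_on (frame S x i) {..<e i} \<and> \<not> cvec.dependent (frame S x i ` {..<e i})"
    using chartvec_sp[OF cellsD(1)[OF S] enum_S] by (auto simp: frame_def cellsD(2)[OF S])
qed

text \<open>The frame is affine in \<open>x\<close> and has only finitely many nonzero slots, since
  the vertices are finite and \<open>e\<close> vanishes elsewhere.\<close>

lemma regmap_frame: "regmap A (frame S)"
proof -
  \<comment> \<open>The frame with \<open>v\<close> in the slot \<open>(i, j)\<close> and zero
    everywhere else.\<close>
  define \<iota> :: "'v \<Rightarrow> nat \<Rightarrow> 'm \<Rightarrow> 'v \<Rightarrow> nat \<Rightarrow> 'm"
    where "\<iota> i j v = (\<lambda>i' j'. if i' = i \<and> j' = j then v else 0)" for i j v
  have "frame S x = (\<Sum>i\<in>verts Q. \<Sum>j<e i. 1 *\<^sub>C \<iota> i j (b (enum S i j) i) +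
      (\<Sum>k\<in>K. x (i, k, enum S i j) *\<^sub>C \<iota> i j (b k i)))" (is "_ = ?F x") for x
  proof (intro ext)
    fix i' j'
    have ev: "Vector_Spaces.linear scaleC scaleC (\<lambda>u::'v \<Rightarrow> nat \<Rightarrow> 'm. u i' j')"
      by (rule linearI) (simp_all add: scaleC_fun)
    have "?F x i' j' = (\<Sum>i\<in>verts Q. \<Sum>j<e i. \<iota> i j (b (enum S i j) i) i' j' +
        (\<Sum>k\<in>K. x (i, k, enum S i j) *\<^sub>C \<iota> i j (b k i) i' j'))"
      by (simp add: linearD(1,5)[OF ev] scaleC_fun scaleC_one)
    also have "\<dots> = (\<Sum>i\<in>verts Q. \<Sum>j<e i. if i = i' then (if j = j' then chartvec x i (enum S i j) else 0) else 0)"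
      by (intro sum.cong refl) (simp add: \<iota>_def chartvec_def)
    also have "\<dots> = (\<Sum>i\<in>verts Q. if i = i' then
        (\<Sum>j<e i. if j = j' then chartvec x i (enum S i j) else 0) else 0)"
      by (intro sum.cong refl) simp
    also have "\<dots> = (if i' \<in> verts Q \<and> j' < e i' then chartvec x i' (enum S i' j') else 0)"
      using fin_verts by (simp add: sum.delta)
    finally show "frame S x i' j' = ?F x i' j'"
      using e_0[of i'] by (auto simp: frame_def cellsD(2)[OF S])
  qed
  moreover have "regmap A ?F"
    by (intro regmap_sum regmap_add regmap_scale regfun_const regfun_poly polyfun_apply)
  ultimately show ?thesis by presburger
qed

lemma frame_span_combination:
  assumes "v \<in> frame_span e u i"
  obtains y where "v = (\<Sum>j<e i. y j *\<^sub>C u i j)"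
  using span_image_lessThan assms unfolding frame_span_def by blast

lemma cd_frame_combination:
  "cd i (enum S i m) (\<Sum>j<e i. y j *\<^sub>C u i j) = (\<Sum>j<e i. y j * minor_matrix S u i j m)"
  by (simp add: cdD scaleC_complex minor_matrix_def)

text \<open>A relation between the rows of the minor matrix is a combination of frame vectors whose
  pivot coordinates vanish; independence of the frame translates between coefficients and
  vectors.\<close>

lemma minor_nonzero_iff:
  assumes u: "u \<in> frames V e"
  shows "minor S u i \<noteq> 0 \<longleftrightarrow> (\<forall>v\<in>frame_span e u i. (\<forall>m\<in>S i. cd i m v = 0) \<longrightarrow> v = 0)"
proof
  assume nz: "minor S u i \<noteq> 0"
  show "\<forall>v\<in>frame_span e u i. (\<forall>m\<in>S i. cd i m v = 0) \<longrightarrow> v = 0"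
  proof (intro ballI impI)
    fix v assume v: "v \<in> frame_span e u i" "\<forall>m\<in>S i. cd i m v = 0"
    obtain y where y: "v = (\<Sum>j<e i. y j *\<^sub>C u i j)"
      using frame_span_combination[OF v(1)] by blast
    have "y j = 0" if "j < e i" for j
    proof (rule fdet_nonzero_kernel)
      show "fdet (e i) (minor_matrix S u i) \<noteq> 0" using nz by (simp add: minor_def cellsD(2)[OF S])
      show "(\<Sum>j<e i. y j * minor_matrix S u i j m) = 0" if "m < e i" for m
        using v(2) enum_S[OF that] y by (simp flip: cd_frame_combination)
    qed (rule that)
    then show "v = 0" unfolding y by simp
  qed
next
  assume *: "\<forall>v\<in>frame_span e u i. (\<forall>m\<in>S i. cd i m v = 0) \<longrightarrow> v = 0"
  show "minor S u i \<noteq> 0"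
  proof
    assume "minor S u i = 0"
    then have "fdet (e i) (minor_matrix S u i) = 0" by (simp add: minor_def cellsD(2)[OF S])
    then obtain y j where y: "j < e i" "y j \<noteq> 0"
      "\<And>m. m < e i \<Longrightarrow> (\<Sum>j<e i. y j * minor_matrix S u i j m) = 0"
      by (rule fdet_eq_0) blast
    let ?v = "\<Sum>j<e i. y j *\<^sub>C u i j"
    have "cd i m ?v = 0" if mS: "m \<in> S i" for m
    proof -
      obtain n where "n < e i" "m = enum S i n" by (rule enum_surj[OF mS])
      then show ?thesis using y(3)[of n] cd_frame_combination[of i n y u] by simp
    qed
    moreover have "?v \<in> frame_span e u i"
      unfolding frame_span_def by (intro cvec.span_sum cvec.span_scale cvec.span_base) auto
    ultimately have "?v = 0" using * by blast
    then show False
      using independent_combination[of "u i" "e i" y j] u y(1,2) by (auto simp: frames_def)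
  qed
qed

lemma pivot:
  assumes u: "u \<in> frames V e" and nz: "minor S u i \<noteq> 0" and l: "l \<in> S i"
  shows "pivot S u i l \<in> frame_span e u i"
    and "m \<in> S i \<Longrightarrow> cd i m (pivot S u i l) = (if m = l then 1 else 0)"
proof -
  show "pivot S u i l \<in> frame_span e u i"
    unfolding pivot_def cellsD(2)[OF S] frame_span_def
    by (intro cvec.span_sum cvec.span_scale cvec.span_base) auto
  let ?h = "inv_into {..<e i} (enum S i)"
  have h: "?h m < e i" "enum S i (?h m) = m" if "m \<in> S i" for m
    using enum_bij[of i] that by (auto simp: bij_betw_def inv_into_into[of m "enum S i" "{..<e i}", simplified] f_inv_into_f)
  assume m: "m \<in> S i"
  have "cd i m (pivot S u i l) =
      (\<Sum>j<e i. fadj (e i) (minor_matrix S u i) (?h l) j / minor S u i * minor_matrix S u i j (?h m))"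
    using cd_frame_combination[of i "?h m" "\<lambda>j. fadj (e i) (minor_matrix S u i) (?h l) j / minor S u i" u] h[OF m]
    by (simp add: pivot_def cellsD(2)[OF S])
  also have "\<dots> = (\<Sum>j<e i. fadj (e i) (minor_matrix S u i) (?h l) j * minor_matrix S u i j (?h m)) / minor S u i"
    by (simp add: sum_divide_distrib)
  also have "\<dots> = (if ?h l = ?h m then 1 else 0)"
    using fadj_mult[OF h(1)[OF l] h(1)[OF m], of "minor_matrix S u i"] nz
    by (simp add: minor_def cellsD(2)[OF S])
  also have "?h l = ?h m \<longleftrightarrow> m = l"
    using arg_cong[of "?h l" "?h m" "enum S i"] h(2)[OF l] h(2)[OF m] by metis
  finally show "cd i m (pivot S u i l) = (if m = l then 1 else 0)" .
qed

end

text \<open>A subrepresentation of the right dimension is a point of the presented variety only if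
  it has a frame; the echelon form supplies one.\<close>

lemma points_quiver_grass: "points (quiver_grass_var Q V e) = quiver_grass Q V e"
proof
  show "quiver_grass Q V e \<subseteq> points (quiver_grass_var Q V e)"
  proof
    fix N assume N: "N \<in> quiver_grass Q V e"
    then obtain S' x where S': "S' \<in> cells e" "x \<in> cell_coords S'" "N = chart S' x" by (rule ex_cell)
    have "frame S' x \<in> frames V e" "frame_span e (frame S' x) = N"
      using frame_frames[OF S'(1) cell_coords_supported[OF S'(2)]] frame_span_frame[OF S'(1)] S'(3) by auto
    then have "frame S' x \<in> fst (quiver_grass_var Q V e)" "N = snd (quiver_grass_var Q V e) (frame S' x)"
      using N by (simp_all add: quiver_grass_var_def subvar_def grass_var_def)
    then show "N \<in> points (quiver_grass_var Q V e)"
      by (simp add: points_def)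
  qed
qed (auto simp: points_def quiver_grass_var_def subvar_def grass_var_def)

section \<open>The torus action on charts and the attracting sets\<close>

lemma t_scale: "z \<noteq> 0 \<Longrightarrow> x \<in> sp V i \<Longrightarrow> t z i (c *\<^sub>C x) = c *\<^sub>C t z i x"
  using cvec.subspace_scale[OF subspace_sp, of x i c]
  by (simp add: t_eq cdD scaleC_complex cvec.scale_sum_right scaleC_scaleC mult_ac)

lemma t_sum:
  assumes "z \<noteq> 0" "\<And>j. j \<in> J \<Longrightarrow> x j \<in> sp V i"
  shows "t z i (\<Sum>j\<in>J. x j) = (\<Sum>j\<in>J. t z i (x j))"
proof -
  have "t z i (\<Sum>j\<in>J. x j) = (\<Sum>k\<in>K. \<Sum>j\<in>J. (z powi d k * cd i k (x j)) *\<^sub>C b k i)"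
    using assms cvec.subspace_sum[OF subspace_sp, of J x i]
    by (simp add: t_eq cdD sum_distrib_left cvec.scale_sum_left)
  also have "\<dots> = (\<Sum>j\<in>J. \<Sum>k\<in>K. (z powi d k * cd i k (x j)) *\<^sub>C b k i)"
    by (rule sum.swap)
  finally show ?thesis using assms by (simp add: t_eq)
qed

text \<open>The torus action in chart coordinates. Natural exponents make it polynomial in
  \<open>z\<close> and meaningful at \<open>z = 0\<close>; on entries of positive degree the
  truncation by \<open>nat\<close> is invisible.\<close>

definition torus_scale :: "complex \<Rightarrow> ('v \<times> 'k \<times> 'k \<Rightarrow> complex) \<Rightarrow> 'v \<times> 'k \<times> 'k \<Rightarrow> complex" where
  "torus_scale z x = (\<lambda>(i, k, l). z ^ nat (d k - d l) * x (i, k, l))"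

lemma torus_scale_0:
  assumes "\<And>p. p \<notin> pos_index S \<Longrightarrow> x p = 0"
  shows "torus_scale 0 x = (\<lambda>_. 0)"
proof
  fix p :: "'v \<times> 'k \<times> 'k"
  obtain i k l where p: "p = (i, k, l)" by (metis prod_cases3)
  show "torus_scale 0 x p = 0"
    using assms[of p] by (cases "p \<in> pos_index S") (auto simp: p torus_scale_def pos_index_def)
qed

lemma frames_quiver_grass:
  "u \<in> fst (quiver_grass_var Q V e) \<longleftrightarrow> u \<in> frames V e \<and> frame_span e u \<in> quiver_grass Q V e"
  "snd (quiver_grass_var Q V e) = frame_span e"
  by (simp_all add: quiver_grass_var_def subvar_def grass_var_def)

context
  fixes S :: "'v \<Rightarrow> 'k set" and e :: "'v \<Rightarrow> nat"
  assumes S: "S \<in> cells e"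
begin

lemma open_chart_iff:
  assumes u: "u \<in> fst (quiver_grass_var Q V e)"
  shows "frame_span e u \<in> open_chart e S \<longleftrightarrow> (\<forall>i. minor S u i \<noteq> 0)"
  using u minor_nonzero_iff[OF S, of u] by (simp add: frames_quiver_grass open_chart_def)

lemma minor_outside: "i \<notin> verts Q \<Longrightarrow> u \<in> frames V e \<Longrightarrow> minor S u i \<noteq> 0"
  using minor_nonzero_iff[OF S, of u i] e_0[OF S] by (simp add: frame_span_def)

lemma zariski_open_chart: "zariski_open (quiver_grass_var Q V e) (open_chart e S)"
  unfolding zariski_open_def
\<comment> \<open>One polynomial cuts out the complement: the product of the minors over all
  vertices. At other indices the minor has size 0 and is nonzero.\<close>
proof (intro conjI exI[of _ "{\<lambda>u. \<Prod>i\<in>verts Q. minor S u i}"] ballI)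
  show "open_chart e S \<subseteq> points (quiver_grass_var Q V e)"
    by (auto simp: points_quiver_grass open_chart_def)
  show "polyfun p" if "p \<in> {\<lambda>u. \<Prod>i\<in>verts Q. minor S u i}" for p
    using that by (auto intro: polyfun_prod polyfun_minor)
  fix u assume u: "u \<in> fst (quiver_grass_var Q V e)"
  have "(\<forall>i. minor S u i \<noteq> 0) \<longleftrightarrow> (\<forall>i\<in>verts Q. minor S u i \<noteq> 0)"
    using minor_outside u by (auto simp: frames_quiver_grass)
  then show "snd (quiver_grass_var Q V e) u \<in> open_chart e S \<longleftrightarrow>
      (\<exists>p\<in>{\<lambda>u. \<Prod>i\<in>verts Q. minor S u i}. p u \<noteq> 0)"
    using open_chart_iff[OF u] fin_verts by (simp add: frames_quiver_grass)
qed

lemma chart_coord_eqI: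
  assumes N: "N \<in> open_chart e S" and l: "l \<in> S i" and v: "v \<in> N i"
    and vS: "\<And>m. m \<in> S i \<Longrightarrow> cd i m v = (if m = l then 1 else 0)"
  shows "chart_coord S N i k l = cd i k v"
proof -
  have sub: "cvec.subspace (N i)" using N by (auto simp: open_chart_def quiver_grass_def subrep_def)
  have "(THE v. v \<in> N i \<and> (\<forall>m\<in>S i. cd i m v = (if m = l then 1 else 0))) = v"
  proof (rule the_equality)
    fix w assume w: "w \<in> N i \<and> (\<forall>m\<in>S i. cd i m w = (if m = l then 1 else 0))"
    then have "w - v \<in> N i" using sub v by (simp add: cvec.subspace_diff)
    moreover have "\<forall>m\<in>S i. cd i m (w - v) = 0" using w vS by (simp add: cdD(4))
    ultimately have "w - v = 0" using N unfolding open_chart_def by blast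
    then show "w = v" by simp
  qed (use v vS in auto)
  then show ?thesis by (simp add: chart_coord_def)
qed

lemma chart_coord_frame:
  assumes u: "u \<in> fst (quiver_grass_var Q V e)" "frame_span e u \<in> open_chart e S" and l: "l \<in> S i"
  shows "chart_coord S (frame_span e u) i k l = cd i k (pivot S u i l)"
proof -
  have uf: "u \<in> frames V e" using u by (simp add: frames_quiver_grass)
  have "minor S u i \<noteq> 0" using open_chart_iff[OF u(1)] u(2) by blast
  from pivot[OF S uf this l] show ?thesis by (intro chart_coord_eqI[OF u(2) l])
qed

lemma chart_open_chart: "x \<in> cell_coords S \<Longrightarrow> chart S x \<in> open_chart e S"
  using chart_quiver_grass[OF S] chart_zero[OF cellsD(1)[OF S] cell_coords_supported]
  by (auto simp: open_chart_def)

lemma chart_coord_chart: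
  assumes x: "x \<in> cell_coords S" and p: "(i, k, l) \<in> chart_index S"
  shows "chart_coord S (chart S x) i k l = x (i, k, l)"
proof -
  note sx = cell_coords_supported[OF x] and S_T = cellsD(1)[OF S]
  have l: "l \<in> S i" and k: "k \<in> T i - S i" using p by (auto simp: chart_index_def)
  have "chart_coord S (chart S x) i k l = cd i k (chartvec x i l)"
    using cd_chartvec_S[OF S_T sx l]
    by (intro chart_coord_eqI[OF chart_open_chart[OF x] l chartvec_chart[OF S_T sx l]])
  also have "\<dots> = x (i, k, l)" using cd_chartvec[OF S_T sx l T_K] k l by auto
  finally show ?thesis .
qed

text \<open>The vectors \<open>pivot S u i\<close>, computed from any frame \<open>u\<close> of
  \<open>N\<close>, form the dual basis that \<open>chart_eqI\<close> requires.\<close>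

lemma open_chart_eq_chart:
  assumes N: "N \<in> open_chart e S"
  shows "N = chart S (\<lambda>(i, k, l). if (i, k, l) \<in> chart_index S then chart_coord S N i k l else 0)"
    (is "N = chart S ?x")
proof
  fix i
  note S_T = cellsD(1)[OF S]
  have "N \<in> points (quiver_grass_var Q V e)" using N by (simp add: points_quiver_grass open_chart_def)
  then obtain u where u: "u \<in> fst (quiver_grass_var Q V e)" "N = frame_span e u"
    by (auto simp: points_def frames_quiver_grass)
  have uf: "u \<in> frames V e" using u by (simp add: frames_quiver_grass)
  have nz: "minor S u i \<noteq> 0" using open_chart_iff[OF u(1)] u(2) N by blast
  show "N i = chart S ?x i"
  proof (rule chart_eqI[OF S_T, where w = "pivot S u i"])
    show "cvec.subspace (N i)" "N i \<subseteq> sp V i"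
      using N by (auto simp: open_chart_def quiver_grass_def subrep_def)
    show "supported S ?x" by (auto simp: supported_def)
    show "?x (i, k, l) = cd i k (pivot S u i l)" if "(i, k, l) \<in> chart_index S" for k l
      using that chart_coord_frame[OF u(1), of l i k] u(2) N by (auto simp: chart_index_def)
    show "v = 0" if "v \<in> N i" "\<And>m. m \<in> S i \<Longrightarrow> cd i m v = 0" for v
      using N that unfolding open_chart_def by blast
  qed (use pivot[OF S uf nz] u(2) in auto)
qed

lemma regfun_chart_coord:
  assumes "\<And>u. u \<in> A \<Longrightarrow> u \<in> fst (quiver_grass_var Q V e) \<and> frame_span e u \<in> open_chart e S" and l: "l \<in> S i"
  shows "regfun A (\<lambda>u. chart_coord S (frame_span e u) i k l)"
proof (rule regfun_cong)
  let ?c = "\<lambda>u j. fadj (e i) (minor_matrix S u i) (inv_into {..<e i} (enum S i) l) j"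
  have m: "inv_into {..<e i} (enum S i) l < e i"
    using l enum_bij[OF S, of i] by (metis bij_betw_def inv_into_into lessThan_iff)
  have "polyfun (\<lambda>u. ?c u j)" if "j < e i" for j
    using that m unfolding minor_matrix_def by (intro polyfun_fadj polyfun_cd)
  then show "regfun A (\<lambda>u. (\<Sum>j<e i. ?c u j * cd i k (u i j)) / minor S u i)"
    by (intro regfun_divide regfun_poly polyfun_sum polyfun_mult polyfun_cd polyfun_minor)
      (use assms open_chart_iff in auto)
  show "(\<Sum>j<e i. ?c u j * cd i k (u i j)) / minor S u i = chart_coord S (frame_span e u) i k l" if "u \<in> A" for u
    using chart_coord_frame[OF _ _ l, of u k] assms(1)[OF that]
    by (simp add: pivot_def cellsD(2)[OF S] cdD(2,5) scaleC_complex sum_divide_distrib)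
qed

lemma regular_on_chart_coord:
  assumes l: "l \<in> S i"
  shows "regular_on (quiver_grass_var Q V e) (open_chart e S) (\<lambda>N. chart_coord S N i k l)"
proof -
  let ?A = "{u \<in> fst (quiver_grass_var Q V e). frame_span e u \<in> open_chart e S}"
  obtain p g where "polyfun p" "polyfun g" "\<And>u. u \<in> ?A \<Longrightarrow> g u \<noteq> 0"
    "\<And>u. u \<in> ?A \<Longrightarrow> chart_coord S (frame_span e u) i k l = p u / g u"
    using regfunE[OF regfun_chart_coord[of ?A, OF _ l]] by blast
  then show ?thesis
    unfolding regular_on_def frames_quiver_grass(2) by (intro ballI impI exI[of _ p] exI[of _ g]) auto
qed

text \<open>In one direction the chart coordinates, rational in the frame with minors as
  denominators; in the other direction \<open>frame S\<close>, which is affine in \<open>x\<close>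
  and lifts the chart to frames.\<close>

lemma lift_iso_cell:
  "lift_iso (subvar (quiver_grass_var Q V e) (chart S ` cell_coords S)) (affine_var (cell_coords S))"
proof -
  note S_T = cellsD(1)[OF S]
  let ?X = "subvar (quiver_grass_var Q V e) (chart S ` cell_coords S)"
  define h where "h N = (\<lambda>(i, k, l). if (i, k, l) \<in> pos_index S then chart_coord S N i k l else 0)" for N
  have hc: "h (chart S x) = x" if x: "x \<in> cell_coords S" for x
  proof
    fix p :: "'v \<times> 'k \<times> 'k"
    obtain i k l where p: "p = (i, k, l)" by (metis prod_cases3)
    show "h (chart S x) p = x p"
    proof (cases "p \<in> pos_index S")
      case True
      then show ?thesis
        using chart_coord_chart[OF x, of i k l] pos_chart_index by (auto simp: h_def p)
    next
      case False
      then show ?thesis using x by (simp add: h_def p cell_coords_def)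
    qed
  qed
  have X: "u \<in> fst ?X \<longleftrightarrow> u \<in> frames V e \<and> frame_span e u \<in> chart S ` cell_coords S" for u
    using chart_quiver_grass[OF S] by (auto simp: subvar_def frames_quiver_grass)
  have sX: "snd ?X = frame_span e" by (simp add: subvar_def frames_quiver_grass)
  have inU: "u \<in> fst (quiver_grass_var Q V e) \<and> frame_span e u \<in> open_chart e S" if "u \<in> fst ?X" for u
    using that chart_open_chart by (auto simp: subvar_def frames_quiver_grass)
  have "regmap (fst ?X) (\<lambda>u. h (frame_span e u))"
  proof (rule regmap_finite_support)
    show "finite (pos_index S)"
      by (rule finite_subset[OF pos_chart_index finite_chart_index[OF S_T]])
    show "h (frame_span e u) p = 0" if "p \<notin> pos_index S" for u p
      using that by (auto simp: h_def split: prod.split)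
    show "regfun (fst ?X) (\<lambda>u. h (frame_span e u) p)" if p: "p \<in> pos_index S" for p
    proof -
      obtain i k l where ikl: "p = (i, k, l)" by (metis prod_cases3)
      then have "l \<in> S i" using p by (simp add: pos_index_def)
      from regfun_chart_coord[OF inU this] show ?thesis using p by (simp add: h_def ikl)
    qed
  qed
  then have "regular_lift ?X (affine_var (cell_coords S)) h"
    by (rule regular_liftI) (auto simp: affine_var_def X sX hc)
  moreover have "regular_lift (affine_var (cell_coords S)) ?X (chart S)"
    by (rule regular_liftI[where H = "frame S"])
      (auto simp: affine_var_def X sX regmap_frame[OF S] frame_span_frame[OF S]
        intro: frame_frames[OF S cell_coords_supported])
  ultimately show ?thesis
    by (rule lift_isoI) (auto simp: points_def affine_var_def X sX hc)
qed

end

lemma coordinate_subspace: "cvec.span ((\<lambda>k. b k i) ` S i) = chart S (\<lambda>_. 0) i"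
  by (simp add: chart_def chartvec_def)

context
  fixes S :: "'v \<Rightarrow> 'k set" and e :: "'v \<Rightarrow> nat"
  assumes S: "S \<in> cells e"
begin

lemma zero_cell_coords: "(\<lambda>_. 0) \<in> cell_coords S"
  by (simp add: cell_coords_def cell_eqs_def)

text \<open>The cell equations are homogeneous: with \<open>x (i, k, l)\<close> in degree
  \<open>d k - d l\<close>, both sides of the equation for \<open>k\<close> and \<open>l\<close>
  have that degree.\<close>

lemma torus_scale_cell_coords:
  assumes x: "x \<in> cell_coords S"
  shows "torus_scale z x \<in> cell_coords S"
  unfolding cell_coords_def cell_eqs_def
proof (intro CollectI conjI allI impI ballI)
  note pos = cell_coords_pos[OF x]
  show "torus_scale z x p = 0" if "p \<notin> pos_index S" for p
    using pos[OF that] by (cases p) (simp add: torus_scale_def)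
  fix a l k assume a: "a \<in> arcs Q" and l: "l \<in> S (tail Q a)" and k: "k \<in> T (head Q a) - S (head Q a)"
  let ?i = "tail Q a" and ?j = "head Q a"
  have "\<alpha> a k * torus_scale z x (?i, k, l) - \<alpha> a l * torus_scale z x (?j, k, l) =
      z ^ nat (d k - d l) * (\<alpha> a k * x (?i, k, l) - \<alpha> a l * x (?j, k, l))"
    by (simp add: torus_scale_def algebra_simps)
  also have "\<dots> = z ^ nat (d k - d l) * (\<Sum>m\<in>K. \<alpha> a m * x (?j, k, m) * x (?i, m, l))"
    using x a l k by (simp add: cell_coords_def cell_eqs_def)
  also have "\<dots> = (\<Sum>m\<in>K. \<alpha> a m * torus_scale z x (?j, k, m) * torus_scale z x (?i, m, l))"
    unfolding sum_distrib_left
  proof (rule sum.cong)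
    fix m
    show "z ^ nat (d k - d l) * (\<alpha> a m * x (?j, k, m) * x (?i, m, l)) =
        \<alpha> a m * torus_scale z x (?j, k, m) * torus_scale z x (?i, m, l)"
    proof (cases "x (?j, k, m) = 0 \<or> x (?i, m, l) = 0")
      case False
      then have "d m < d k" "d l < d m"
        using pos[of "(?j, k, m)"] pos[of "(?i, m, l)"] by (auto simp: pos_index_def)
      \<comment> \<open>Truncation is additive here because both differences are positive.\<close>
      then have "nat (d k - d l) = nat (d k - d m) + nat (d m - d l)" by simp
      then show ?thesis by (simp add: torus_scale_def power_add)
    qed (auto simp: torus_scale_def)
  qed simp
  finally show "\<alpha> a k * torus_scale z x (?i, k, l) - \<alpha> a l * torus_scale z x (?j, k, l) =
      (\<Sum>m\<in>K. \<alpha> a m * torus_scale z x (?j, k, m) * torus_scale z x (?i, m, l))" .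
qed

text \<open>The graph vector with pivot \<open>l\<close> is multiplied by \<open>z powi d l\<close>
  at the pivot and by \<open>z powi d k\<close> at \<open>k\<close>; normalizing the pivot leaves
  the factor of exponent \<open>d k - d l\<close>.\<close>

lemma translate_chart:
  assumes x: "x \<in> cell_coords S" and z: "z \<noteq> 0"
  shows "translate t z (chart S x) = chart S (torus_scale z x)"
proof
  fix i
  note S_T = cellsD(1)[OF S] and sx = cell_coords_supported[OF x]
  let ?y = "torus_scale z x"
  have sy: "supported S ?y" by (rule cell_coords_supported[OF torus_scale_cell_coords[OF x]])
  have w: "t z i (chartvec x i l) = (z powi d l) *\<^sub>C chartvec ?y i l" if l: "l \<in> S i" for l
  proof (rule sp_eqI)
    show "t z i (chartvec x i l) \<in> sp V i" using chartvec_sp[OF S_T l] z by (intro t_sp)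
    show "(z powi d l) *\<^sub>C chartvec ?y i l \<in> sp V i"
      using chartvec_sp[OF S_T l] by (intro cvec.subspace_scale[OF subspace_sp])
    fix k assume k: "k \<in> T i"
    have "z powi d k * x (i, k, l) = z powi d l * ?y (i, k, l)"
    proof (cases "(i, k, l) \<in> pos_index S")
      case True
      then have "d k = d l + int (nat (d k - d l))" by (auto simp: pos_index_def)
      then have "z powi d k = z powi d l * z ^ nat (d k - d l)"
        using z by (metis power_int_add power_int_of_nat)
      then show ?thesis by (simp add: torus_scale_def)
    next
      case False
      then show ?thesis using cell_coords_pos[OF x] by (simp add: torus_scale_def)
    qed
    then show "cd i k (t z i (chartvec x i l)) = cd i k ((z powi d l) *\<^sub>C chartvec ?y i l)"
      using cd_chartvec[OF S_T sx l T_K[OF k]] cd_chartvec[OF S_T sy l T_K[OF k]]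
      by (auto simp: cd_t[OF z chartvec_sp[OF S_T l] T_K[OF k]] cdD scaleC_complex distrib_left)
  qed
  show "translate t z (chart S x) i = chart S ?y i"
  proof
    show "translate t z (chart S x) i \<subseteq> chart S ?y i"
    proof
      fix v assume "v \<in> translate t z (chart S x) i"
      then obtain u where u: "u \<in> chart S x i" "v = t z i u" by (auto simp: translate_def)
      have "v = t z i (\<Sum>m\<in>S i. cd i m u *\<^sub>C chartvec x i m)"
        using chart_expansion[OF S_T sx u(1)] u(2) by simp
      also have "\<dots> = (\<Sum>m\<in>S i. cd i m u *\<^sub>C t z i (chartvec x i m))"
        using chartvec_sp[OF S_T] z
        by (subst t_sum) (auto simp: t_scale cvec.subspace_scale[OF subspace_sp])
      also have "\<dots> = (\<Sum>m\<in>S i. (cd i m u * z powi d m) *\<^sub>C chartvec ?y i m)"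
        by (simp add: w scaleC_scaleC)
      also have "\<dots> \<in> chart S ?y i"
        unfolding chart_def by (intro cvec.span_sum cvec.span_scale cvec.span_base) auto
      finally show "v \<in> chart S ?y i" .
    qed
    show "chart S ?y i \<subseteq> translate t z (chart S x) i"
    proof
      fix v assume v: "v \<in> chart S ?y i"
      let ?u = "\<Sum>m\<in>S i. (cd i m v / z powi d m) *\<^sub>C chartvec x i m"
      have "t z i ?u = (\<Sum>m\<in>S i. (cd i m v / z powi d m) *\<^sub>C t z i (chartvec x i m))"
        using chartvec_sp[OF S_T] z
        by (subst t_sum) (auto simp: t_scale cvec.subspace_scale[OF subspace_sp])
      also have "\<dots> = (\<Sum>m\<in>S i. cd i m v *\<^sub>C chartvec ?y i m)"
        using z by (simp add: w scaleC_scaleC)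
      also have "\<dots> = v" using chart_expansion[OF S_T sy v] by simp
      finally have "t z i ?u = v" .
      moreover have "?u \<in> chart S x i"
        unfolding chart_def by (intro cvec.span_sum cvec.span_scale cvec.span_base) auto
      then have "t z i ?u \<in> translate t z (chart S x) i"
        unfolding translate_def by (rule imageI)
      ultimately show "v \<in> translate t z (chart S x) i" by simp
    qed
  qed
qed

text \<open>All exponents in \<open>torus_scale\<close> are positive on the entries of a cell, so
  the orbit map extends over \<open>z = 0\<close> with value the coordinate subspace;
  \<open>frame S\<close> lifts this curve to frames.\<close>

lemma cell_subset_attracting:
  assumes x: "x \<in> cell_coords S"
  shows "chart S x \<in> attracting_set Q V e t (chart S (\<lambda>_. 0))"
proof -
  let ?g = "\<lambda>z. chart S (torus_scale z x)"
  note pos = cell_coords_pos[OF x]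
  have "regmap UNIV (\<lambda>z. torus_scale z x)"
  proof (rule regmap_finite_support)
    show "finite (pos_index S)"
      by (rule finite_subset[OF pos_chart_index finite_chart_index[OF cellsD(1)[OF S]]])
    show "torus_scale z x p = 0" if "p \<notin> pos_index S" for z p
      using pos[OF that] by (cases p) (simp add: torus_scale_def)
    show "regfun UNIV (\<lambda>z. torus_scale z x p)" for p
    proof (cases p)
      case (fields i k l)
      have "polyfun (\<lambda>z::complex. z)" by (intro polyfun_linear linearI) (simp_all add: scaleC_complex)
      then show ?thesis
        unfolding fields torus_scale_def prod.case
        by (intro regfun_poly polyfun_mult polyfun_power polyfun_const)
    qed
  qed
  then have "regular_lift (affine_var UNIV) (quiver_grass_var Q V e) ?g"
    using torus_scale_cell_coords[OF x]
    by (intro regular_liftI[where H = "\<lambda>z. frame S (torus_scale z x)"])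
      (auto simp: affine_var_def frames_quiver_grass frame_span_frame[OF S] chart_quiver_grass[OF S]
        intro: regmap_comp[OF regmap_frame[OF S, of UNIV]] frame_frames[OF S cell_coords_supported])
  then have "morphism (affine_var UNIV) (quiver_grass_var Q V e) ?g" by (rule regular_lift_morphism)
  moreover have "?g 0 = chart S (\<lambda>_. 0)" using torus_scale_0[OF pos] by simp
  ultimately show ?thesis
    using chart_quiver_grass[OF S x] translate_chart[OF x] by (auto simp: attracting_set_def)
qed

text \<open>Diagonal action rescales every coordinate by a nonzero factor, so vanishing of the pivot
  coordinates is preserved.\<close>

lemma translate_open_chart:
  assumes N: "N \<in> quiver_grass Q V e" "translate t z N \<in> quiver_grass Q V e" and z: "z \<noteq> 0"
  shows "translate t z N \<in> open_chart e S \<longleftrightarrow> N \<in> open_chart e S"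
proof -
  have Nsp: "N i \<subseteq> sp V i" for i using N(1) by (auto simp: quiver_grass_def subrep_def)
  have "t z i v = 0 \<longleftrightarrow> v = 0" if "v \<in> N i" for i v
  proof
    assume "t z i v = 0"
    then have "z powi d k * cd i k v = 0" if "k \<in> K" for k
      using cd_t[OF z _ that, of v i] Nsp \<open>v \<in> N i\<close> by (auto simp: cdD)
    then show "v = 0"
      using Nsp \<open>v \<in> N i\<close> z by (intro sp_eqI[of v i 0] cvec.subspace_0 subspace_sp) (auto simp: cdD T_def)
  qed (use z in \<open>simp add: t_eq cdD cvec.subspace_0[OF subspace_sp]\<close>)
  moreover have "(\<forall>m\<in>S i. cd i m (t z i v) = 0) \<longleftrightarrow> (\<forall>m\<in>S i. cd i m v = 0)" if "v \<in> N i" for i v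
    using that Nsp z S_K[OF cellsD(1)[OF S]] by (auto simp: cd_t subset_iff)
  ultimately show ?thesis using N by (auto simp: open_chart_def translate_def)
qed

text \<open>The limit lies in the open chart, hence so does some \<open>translate t z N\<close> with
  \<open>z \<noteq> 0\<close>, and then \<open>N\<close> itself by invariance under the torus. An
  entry \<open>x p\<close> of the graph \<open>N\<close> appears along the curve as
  \<open>z powi (d k - d l) * x p\<close>. This is regular at 0 with value 0, which rules out a
  nonzero entry unless its degree is positive.\<close>

lemma attracting_subset_cell:
  assumes N: "N \<in> attracting_set Q V e t (chart S (\<lambda>_. 0))"
  shows "N \<in> chart S ` cell_coords S"
proof -
  note S_T = cellsD(1)[OF S]
  obtain g where g: "morphism (affine_var (UNIV :: complex set)) (quiver_grass_var Q V e) g"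
    "\<And>z. z \<noteq> 0 \<Longrightarrow> g z = translate t z N" "g 0 = chart S (\<lambda>_. 0)" and NX: "N \<in> quiver_grass Q V e"
    using N by (auto simp: attracting_set_def)
  have cont: "continuous_map (zariski (affine_var UNIV)) (zariski (quiver_grass_var Q V e)) g"
    and reg: "\<And>U f. openin (zariski (quiver_grass_var Q V e)) U \<Longrightarrow> regular_on (quiver_grass_var Q V e) U f \<Longrightarrow>
      regular_on (affine_var UNIV) {x \<in> points (affine_var UNIV). g x \<in> U} (f \<circ> g)"
    using g(1) by (auto simp: morphism_def)
  have pts: "points (affine_var UNIV) = (UNIV :: complex set)" by (simp add: points_def affine_var_def)
  let ?U = "open_chart e S"
  have U: "openin (zariski (quiver_grass_var Q V e)) ?U"
    using zariski_open_chart[OF S] by (simp add: openin_zariski)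
  have gX: "g z \<in> quiver_grass Q V e" for z
    using cont by (auto simp: continuous_map_def topspace_zariski pts points_quiver_grass)
  have gU: "translate t z N \<in> ?U \<longleftrightarrow> N \<in> ?U" if "z \<noteq> 0" for z
    using translate_open_chart[OF NX _ that] gX[of z] g(2)[OF that] by simp
  have g0: "g 0 \<in> ?U" using chart_open_chart[OF S zero_cell_coords] g(3) by simp
  have "openin (zariski (affine_var UNIV)) {z. g z \<in> ?U}"
    using cont U by (auto simp: continuous_map_def topspace_zariski pts)
  then obtain R where R: "\<forall>p\<in>R. polyfun p" "\<forall>z. g z \<in> ?U \<longleftrightarrow> (\<exists>p\<in>R. p z \<noteq> 0)"
    by (auto simp: openin_zariski zariski_open_def affine_var_def)
  obtain p where p: "polyfun p" "p 0 \<noteq> 0" "\<And>z. p z \<noteq> 0 \<Longrightarrow> g z \<in> ?U" using R g0 by blast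
  \<comment> \<open>A Zariski open set containing 0 contains points \<open>z \<noteq> 0\<close>: the
    polynomial \<open>p\<close> stays nonzero near 0.\<close>
  have "\<forall>\<^sub>F z in at 0. p z \<noteq> 0"
    using isCont_polyfun[OF p(1), of 0] p(2) by (auto simp: isCont_def intro: tendsto_imp_eventually_ne)
  moreover have "\<forall>\<^sub>F z in at (0::complex). z \<noteq> 0" by (simp add: eventually_at_filter)
  ultimately have "\<forall>\<^sub>F z in at 0. p z \<noteq> 0 \<and> z \<noteq> 0" by (rule eventually_conj)
  then obtain z0 where "p z0 \<noteq> 0" "z0 \<noteq> 0" using eventually_happens'[OF at_neq_bot] by blast
  then have NU: "N \<in> ?U" using p(3)[of z0] g(2)[of z0] gU[of z0] by simp
  have gU': "g z \<in> ?U" for z using gU[of z] NU g(2)[of z] g0 by (cases "z = 0") auto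
  define x where "x = (\<lambda>(i, k, l). if (i, k, l) \<in> chart_index S then chart_coord S N i k l else 0)"
  have Nx: "N = chart S x" using open_chart_eq_chart[OF S NU] by (simp add: x_def)
  have sx: "supported S x" by (auto simp: supported_def x_def)
  have eqs: "cell_eqs S x" using NX chart_subrep[OF S sx] Nx by (simp add: quiver_grass_def)
  have "x p = 0" if "p \<notin> pos_index S" for p
  proof (cases "p \<in> chart_index S")
    case True
    then obtain i k l where p: "p = (i, k, l)" and l: "l \<in> S i" and k: "k \<in> T i - S i" and dkl: "d k \<le> d l"
      using \<open>p \<notin> pos_index S\<close> unfolding chart_index_def pos_index_def by fastforce
    define f where "f N = chart_coord S N i k l" for N
    have "regular_on (affine_var UNIV) UNIV (f \<circ> g)"
      using reg[OF U regular_on_chart_coord[OF S l, of k]] by (simp add: pts gU' f_def[abs_def])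
    then obtain P G where PG: "polyfun P" "polyfun G" "G 0 \<noteq> 0" "\<And>z. G z \<noteq> 0 \<Longrightarrow> f (g z) = P z / G z"
      by (rule regular_onE[where u = 0]) (auto simp: affine_var_def)
    have fg: "f (g z) = z powi (d k - d l) * x p" if z: "z \<noteq> 0" for z
    proof -
      \<comment> \<open>Scaled beforehand so that the translated vector has pivot coordinate
        1.\<close>
      let ?v = "t z i (z powi (- d l) *\<^sub>C chartvec x i l)"
      have vsp: "z powi (- d l) *\<^sub>C chartvec x i l \<in> sp V i"
        using chartvec_sp[OF S_T l] by (intro cvec.subspace_scale[OF subspace_sp])
      have "f (g z) = cd i k ?v"
        unfolding f_def
      proof (rule chart_coord_eqI[OF S gU' l])
        have "z powi (- d l) *\<^sub>C chartvec x i l \<in> N i"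
          using chartvec_chart[OF S_T sx l] Nx by (simp add: chart_def cvec.span_scale)
        then show "?v \<in> g z i" by (simp add: g(2)[OF z] translate_def)
        show "cd i m ?v = (if m = l then 1 else 0)" if "m \<in> S i" for m
          unfolding cd_t[OF z vsp S_K[OF S_T that]]
          using cd_chartvec_S[OF S_T sx l that] z by (simp add: cdD scaleC_complex power_int_minus)
      qed
      also have "\<dots> = z powi (d k - d l) * x p"
      proof -
        have kK: "k \<in> K" using k T_K by auto
        show ?thesis
          unfolding cd_t[OF z vsp kK]
          using cd_chartvec[OF S_T sx l kK] k l z
          by (auto simp: cdD scaleC_complex p power_int_diff power_int_minus field_simps)
      qed
      finally show ?thesis .
    qed
    have "f (g 0) = 0"
      using chart_coord_chart[OF S zero_cell_coords True[unfolded p]] g(3) by (simp add: f_def)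
    \<comment> \<open>The limit is the coordinate subspace, whose chart coordinates vanish. This
      makes the right hand side of the limit below vanish also for the exponent 0.\<close>
    then have P0: "P 0 = 0" using PG(3,4) by (metis divide_eq_0_iff)
    let ?n = "nat (d l - d k)"
    have "\<forall>\<^sub>F z in at 0. G z \<noteq> 0"
      using isCont_polyfun[OF PG(2), of 0] PG(3) by (auto simp: isCont_def intro: tendsto_imp_eventually_ne)
    \<comment> \<open>Denominators and the nonpositive power of \<open>z\<close> are cleared, so
      that both sides are continuous and can be compared at 0.\<close>
    with \<open>\<forall>\<^sub>F z in at (0::complex). z \<noteq> 0\<close> have ev: "\<forall>\<^sub>F z in at 0. x p * G z = z ^ ?n * P z"
    proof eventually_elim
      case (elim z)
      have "z ^ ?n = z powi (d l - d k)" using dkl by (simp add: power_int_def)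
      then have "z powi (d k - d l) * z ^ ?n = z powi ((d k - d l) + (d l - d k))"
        using elim(1) power_int_add[of z "d k - d l" "d l - d k"] by metis
      then have "z powi (d k - d l) * z ^ ?n = 1" by simp
      moreover have "z powi (d k - d l) * x p * G z = P z"
        using PG(4)[OF elim(2)] fg[OF elim(1)] elim(2) by simp
      ultimately show ?case by (metis mult.assoc mult.commute mult.left_neutral)
    qed
    have lim: "((\<lambda>z. x p * G z) \<longlongrightarrow> x p * G 0) (at 0)"
      using isCont_polyfun[OF PG(2), of 0] by (intro tendsto_intros) (auto simp: isCont_def)
    have "((\<lambda>z. z ^ ?n * P z) \<longlongrightarrow> 0 ^ ?n * P 0) (at 0)"
      using isCont_polyfun[OF PG(1), of 0] by (intro tendsto_intros) (auto simp: isCont_def)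
    from tendsto_unique[OF at_neq_bot Lim_transform_eventually[OF lim ev] this]
    have "x p * G 0 = 0 ^ ?n * P 0" .
    then show "x p = 0" using P0 PG(3) by simp
  qed (rule supportedD[OF sx])
  then show ?thesis using Nx eqs by (auto simp: cell_coords_def)
qed

lemma attracting_set_cell: "attracting_set Q V e t (chart S (\<lambda>_. 0)) = chart S ` cell_coords S"
  using cell_subset_attracting attracting_subset_cell by blast

end

lemma fixed_points_cells: "fixed_points Q V e t = (\<lambda>S. chart S (\<lambda>_. 0)) ` cells e"
proof
  show "fixed_points Q V e t \<subseteq> (\<lambda>S. chart S (\<lambda>_. 0)) ` cells e"
  proof
    fix L assume L: "L \<in> fixed_points Q V e t"
    then obtain S x where S: "S \<in> cells e" and x: "x \<in> cell_coords S" and Lx: "L = chart S x"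
      using ex_cell[of L e] by (auto simp: fixed_points_def)
    \<comment> \<open>One scalar that is not a root of unity suffices: an entry of positive degree
      \<open>n\<close> is multiplied by \<open>2 ^ n\<close>, so invariance makes it zero.\<close>
    have "translate t 2 L = L" using L by (auto simp: fixed_points_def)
    then have "chart S (torus_scale 2 x) = chart S x" using translate_chart[OF S x] Lx by simp
    then have x2: "torus_scale 2 x = x"
      by (intro chart_inj[OF cellsD(1)[OF S]] cell_coords_supported torus_scale_cell_coords[OF S] x)
    have "x p = 0" for p
    proof (cases "p \<in> pos_index S")
      case True
      then obtain i k l where p: "p = (i, k, l)" "d l < d k" by (auto simp: pos_index_def)
      have "2 ^ nat (d k - d l) * x p = x p" using fun_cong[OF x2, of p] by (simp add: torus_scale_def p)
      moreover have "(2::complex) ^ nat (d k - d l) \<noteq> 1"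
      proof
        assume "(2::complex) ^ nat (d k - d l) = 1"
        then have "norm ((2::complex) ^ nat (d k - d l)) = 1" by simp
        then have "(2::real) ^ nat (d k - d l) = 1" by (simp add: norm_power)
        then show False using one_less_power[of "2::real" "nat (d k - d l)"] p(2) by simp
      qed
      ultimately show ?thesis by simp
    qed (rule cell_coords_pos[OF x])
    then have "x = (\<lambda>_. 0)" by (rule ext)
    then show "L \<in> (\<lambda>S. chart S (\<lambda>_. 0)) ` cells e" using S Lx by blast
  qed
  show "(\<lambda>S. chart S (\<lambda>_. 0)) ` cells e \<subseteq> fixed_points Q V e t"
  proof safe
    fix S assume S: "S \<in> cells e"
    have "torus_scale z (\<lambda>_. 0) = (\<lambda>_. 0)" for z by (auto simp: torus_scale_def)
    then show "chart S (\<lambda>_. 0) \<in> fixed_points Q V e t"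
      using chart_quiver_grass[OF S zero_cell_coords[OF S]] translate_chart[OF S zero_cell_coords[OF S]]
      by (simp add: fixed_points_def)
  qed
qed

section \<open>Order of the cells and the filtration by closed subsets\<close>

definition height :: "('v \<Rightarrow> 'k set) \<Rightarrow> int" where
  "height S = (\<Sum>i\<in>verts Q. \<Sum>l\<in>S i. d l)"

text \<open>The expansion of a nonvanishing minor contains a nonzero product of matrix entries, hence a
  bijection from the pivots to its columns that does not decrease degrees.\<close>

lemma open_chart_height:
  assumes S: "S \<in> cells e" and S': "S' \<in> cells e" and x: "x \<in> cell_coords S"
    and U: "chart S x \<in> open_chart e S'"
  shows "height S \<le> height S'" "height S = height S' \<Longrightarrow> S = S'"
proof -
  note S_T = cellsD(1)[OF S] and sx = cell_coords_supported[OF x]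
  have "frame S x \<in> fst (quiver_grass_var Q V e)"
    using chart_quiver_grass[OF S x] frame_frames[OF S sx] by (simp add: frames_quiver_grass frame_span_frame[OF S])
  then have nz: "minor S' (frame S x) i \<noteq> 0" for i
    using open_chart_iff[OF S'] U by (metis frame_span_frame[OF S])
  have "\<exists>p. p permutes {..<e i} \<and> (\<forall>j<e i. minor_matrix S' (frame S x) i j (p j) \<noteq> 0)" for i
    using nz[of i] fdet_nonzero_permutation unfolding minor_def cellsD(2)[OF S'] by metis
  then obtain p where p: "\<And>i. p i permutes {..<e i}"
    "\<And>i j. j < e i \<Longrightarrow> minor_matrix S' (frame S x) i j (p i j) \<noteq> 0" by metis
  define l where "l i j = enum S i j" for i j
  define m where "m i j = enum S' i (p i j)" for i j
  have lS: "l i j \<in> S i" if "j < e i" for i j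
    using enum_S[OF S that] by (simp add: l_def)
  have mS: "m i j \<in> S' i" if "j < e i" for i j
    using enum_S[OF S', of "p i j" i] permutes_in_image[OF p(1), of i j] that by (simp add: m_def)
  \<comment> \<open>The matrix entry is a coordinate of the graph vector with pivot
    \<open>l i j\<close>; it is nonzero only at that pivot or at an entry of positive
    degree.\<close>
  have le: "m i j = l i j \<or> d (l i j) < d (m i j)" if j: "j < e i" for i j
  proof -
    have "cd i (m i j) (chartvec x i (l i j)) \<noteq> 0"
      using p(2)[OF j] j by (simp add: minor_matrix_def frame_def cellsD(2)[OF S] l_def m_def)
    then have "m i j = l i j \<or> x (i, m i j, l i j) \<noteq> 0"
      using cd_chartvec[OF S_T sx lS[OF j] S_K[OF cellsD(1)[OF S'] mS[OF j]]] by (auto split: if_splits)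
    then show ?thesis using cell_coords_pos[OF x] unfolding pos_index_def by blast
  qed
  then have led: "d (l i j) \<le> d (m i j)" if "j < e i" for i j using that by force
  have sum_l: "(\<Sum>k\<in>S i. d k) = (\<Sum>j<e i. d (l i j))" for i
    unfolding l_def by (rule sum.reindex_bij_betw[OF enum_bij[OF S], symmetric])
  have bij_m: "bij_betw (m i) {..<e i} (S' i)" for i
    unfolding m_def using bij_betw_trans[OF permutes_imp_bij[OF p(1)] enum_bij[OF S']] by (simp add: comp_def)
  have sum_m: "(\<Sum>k\<in>S' i. d k) = (\<Sum>j<e i. d (m i j))" for i
    by (rule sum.reindex_bij_betw[OF bij_m, symmetric])
  have le_i: "(\<Sum>j<e i. d (l i j)) \<le> (\<Sum>j<e i. d (m i j))" for i
    by (rule sum_mono) (use led in auto)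
  then show "height S \<le> height S'" unfolding height_def sum_l sum_m by (rule sum_mono)
  \<comment> \<open>Equality of sums with termwise comparable summands passes to every vertex and
    then to every pivot; by \<open>le\<close>, equal degrees mean equal indices.\<close>
  assume "height S = height S'"
  show "S = S'"
  proof
    fix i
    show "S i = S' i"
    proof (cases "i \<in> verts Q")
      case True
      have "(\<Sum>j<e i. d (l i j)) = (\<Sum>j<e i. d (m i j))"
        using sum_mono_inv[of "\<lambda>i. \<Sum>j<e i. d (l i j)" "verts Q" "\<lambda>i. \<Sum>j<e i. d (m i j)" i,
            OF _ le_i True fin_verts] \<open>height S = height S'\<close>
        by (simp add: height_def sum_l sum_m)
      then have "d (l i j) = d (m i j)" if "j < e i" for j
        using sum_mono_inv[of "\<lambda>j. d (l i j)" "{..<e i}" "\<lambda>j. d (m i j)" j] led that by simp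
      then have eq: "l i j = m i j" if "j < e i" for j using le that by force
      have "S i = l i ` {..<e i}" using enum_bij[OF S, of i] by (simp add: bij_betw_def l_def[abs_def])
      also have "\<dots> = m i ` {..<e i}" using eq by (intro image_cong) auto
      also have "\<dots> = S' i" using bij_m[of i] by (simp add: bij_betw_def)
      finally show ?thesis .
    qed (use S_T[of i] cellsD(1)[OF S', of i] T_empty in auto)
  qed
qed

text \<open>The common point lies in the open charts of both cells, so each height bounds the other
  and the equality case applies.\<close>

lemma chart_cell_unique:
  assumes S: "S \<in> cells e" "x \<in> cell_coords S" and S': "S' \<in> cells e" "x' \<in> cell_coords S'"
    and "chart S x = chart S' x'"
  shows "S = S'"
proof (rule open_chart_height(2)[OF S(1) S'(1) S(2)])
  show U: "chart S x \<in> open_chart e S'" using chart_open_chart[OF S'] assms(5) by simp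
  have "chart S' x' \<in> open_chart e S" using chart_open_chart[OF S] assms(5) by simp
  then show "height S = height S'"
    using open_chart_height(1)[OF S'(1) S(1) S'(2)] open_chart_height(1)[OF S(1) S'(1) S(2) U] by simp
qed

lemma finite_cells: "finite (cells e)"
proof (rule finite_subset)
  show "finite {S. \<forall>i. (i \<in> verts Q \<longrightarrow> S i \<in> Pow K) \<and> (i \<notin> verts Q \<longrightarrow> S i = {})}"
    by (rule finite_set_of_finite_funs) (simp_all add: fin_verts fin_K)
  show "cells e \<subseteq> {S. \<forall>i. (i \<in> verts Q \<longrightarrow> S i \<in> Pow K) \<and> (i \<notin> verts Q \<longrightarrow> S i = {})}"
    using T_empty T_K by (fastforce simp: cells_def)
qed

text \<open>The charts are open and meet only cells of smaller height, so the cells in order of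
  decreasing height form a filtration by closed subsets.\<close>

lemma cellular_decomposition_cells:
  assumes "\<And>S. S \<in> cells e \<Longrightarrow>
    \<exists>n. isomorphic_var (subvar (quiver_grass_var Q V e) (chart S ` cell_coords S)) (affine_space n)"
  shows "cellular_decomposition (quiver_grass_var Q V e) (fixed_points Q V e t) (attracting_set Q V e t)"
proof -
  let ?X = "quiver_grass_var Q V e" and ?C = "attracting_set Q V e t"
  define base where "base S = chart S (\<lambda>_. 0)" for S
  have fp: "fixed_points Q V e t = base ` cells e"
    by (simp add: fixed_points_cells base_def[abs_def])
  have C: "?C (base S) = chart S ` cell_coords S" if "S \<in> cells e" for S
    unfolding base_def by (rule attracting_set_cell[OF that])
  have inj: "inj_on base (cells e)"
    unfolding base_def by (rule inj_onI) (metis chart_cell_unique zero_cell_coords)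
  have disj: "?C (base S) \<inter> ?C (base S') = {}" if "S \<in> cells e" "S' \<in> cells e" "S \<noteq> S'" for S S'
    using chart_cell_unique that C by fastforce
  have cover: "(\<Union>S\<in>cells e. ?C (base S)) = quiver_grass Q V e"
    using chart_quiver_grass by (auto simp: C elim!: ex_cell)
  obtain Ss0 where Ss0: "set Ss0 = cells e" "distinct Ss0"
    using finite_distinct_list[OF finite_cells] by blast
  define Ss where "Ss = sort_key (\<lambda>S. - height S) Ss0"
  have Ss: "set Ss = cells e" "distinct Ss" "sorted (map (\<lambda>S. - height S) Ss)"
    using Ss0 by (simp_all add: Ss_def)
  have closed: "closedin (zariski ?X) (\<Union>l\<in>set (take j (map base Ss)). ?C l)" for j
  proof -
    have cells_td: "cells e = set (take j Ss) \<union> set (drop j Ss)"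
      using Ss(1) by (metis append_take_drop_id set_append)
    have td: "S \<noteq> S' \<and> height S' \<le> height S" if "S \<in> set (take j Ss)" "S' \<in> set (drop j Ss)" for S S'
    proof -
      have "sorted (map (\<lambda>S. - height S) (take j Ss @ drop j Ss))" using Ss(3) by simp
      then have "- height S \<le> - height S'" using that unfolding map_append sorted_append by auto
      moreover have "set (take j Ss) \<inter> set (drop j Ss) = {}" using Ss(2) by (simp add: set_take_disj_set_drop_if_distinct)
      ultimately show ?thesis using that by auto
    qed
    have take: "(\<Union>l\<in>set (take j (map base Ss)). ?C l) = (\<Union>S\<in>set (take j Ss). chart S ` cell_coords S)"
      using cells_td C by (simp add: take_map)
    \<comment> \<open>The complement of an initial union is the union of the open charts of the
      later cells: each cell lies in its chart, and by \<open>open_chart_height\<close> the chart of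
      a later cell cannot meet an earlier cell, whose height is at least as large.\<close>
    have "quiver_grass Q V e - (\<Union>S\<in>set (take j Ss). chart S ` cell_coords S) = (\<Union>S\<in>set (drop j Ss). open_chart e S)"
    proof (intro equalityI subsetI)
      fix N assume N: "N \<in> quiver_grass Q V e - (\<Union>S\<in>set (take j Ss). chart S ` cell_coords S)"
      then obtain S x where "S \<in> cells e" "x \<in> cell_coords S" "N = chart S x" by (auto elim: ex_cell)
      then show "N \<in> (\<Union>S\<in>set (drop j Ss). open_chart e S)"
        using N cells_td chart_open_chart by blast
    next
      fix N assume "N \<in> (\<Union>S\<in>set (drop j Ss). open_chart e S)"
      then obtain S' where S': "S' \<in> set (drop j Ss)" "N \<in> open_chart e S'" by blast
      have False if "S \<in> set (take j Ss)" "x \<in> cell_coords S" "N = chart S x" for S x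
        using open_chart_height[of S e S' x] td[OF that(1) S'(1)] that S' cells_td by auto
      then show "N \<in> quiver_grass Q V e - (\<Union>S\<in>set (take j Ss). chart S ` cell_coords S)"
        using S'(2) by (auto simp: open_chart_def)
    qed
    moreover have "openin (zariski ?X) (\<Union>S\<in>set (drop j Ss). open_chart e S)"
      using cells_td by (intro openin_Union) (auto simp: openin_zariski zariski_open_chart)
    moreover have "(\<Union>S\<in>set (take j Ss). chart S ` cell_coords S) \<subseteq> quiver_grass Q V e"
      using cells_td chart_quiver_grass by blast
    ultimately show ?thesis
      by (simp add: closedin_def take topspace_zariski points_quiver_grass)
  qed
  show ?thesis
    unfolding cellular_decomposition_def
  proof (intro conjI exI[of _ "map base Ss"] ballI allI impI)
    show "finite (fixed_points Q V e t)" by (simp add: fp finite_cells)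
    show "disjoint_family_on ?C (fixed_points Q V e t)"
      using disj by (fastforce simp: disjoint_family_on_def fp)
    show "(\<Union>l\<in>fixed_points Q V e t. ?C l) = points ?X"
      using cover by (simp add: fp points_quiver_grass)
    show "\<exists>n. isomorphic_var (subvar ?X (?C l)) (affine_space n)" if "l \<in> fixed_points Q V e t" for l
      using that assms by (auto simp: fp C)
    show "distinct (map base Ss)" using Ss inj by (simp add: distinct_map)
    show "set (map base Ss) = fixed_points Q V e t" using Ss by (simp add: fp)
  qed (rule closed)
qed


section \<open>Linearization of the cell equations\<close>

text \<open>The linear part of the cell equations. Its solutions are the matrices of the
  homomorphisms from L to M/L of positive degree.\<close>

definition lin_coords :: "('v \<Rightarrow> 'k set) \<Rightarrow> ('v \<times> 'k \<times> 'k \<Rightarrow> complex) set" where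
  "lin_coords S = {x. (\<forall>p. p \<notin> pos_index S \<longrightarrow> x p = 0) \<and>
     (\<forall>a\<in>arcs Q. \<forall>l\<in>S (tail Q a). \<forall>k\<in>T (head Q a) - S (head Q a).
        \<alpha> a k * x (tail Q a, k, l) = \<alpha> a l * x (head Q a, k, l))}"

text \<open>Vanishing of the part of positive degree of \<open>Ext\<^sup>1(L, M/L)\<close>, which splits into contributions
  of pairs of basis vectors.\<close>

definition ext_vanishes :: "('v \<Rightarrow> 'k set) \<Rightarrow> bool" where
  "ext_vanishes S \<longleftrightarrow> (\<forall>k\<in>K. \<forall>l\<in>K. d l < d k \<longrightarrow> (\<forall>f::'a \<Rightarrow> complex. \<exists>y::'v \<Rightarrow> complex.
     (\<forall>i. y i \<noteq> 0 \<longrightarrow> (i, k, l) \<in> chart_index S) \<and>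
     (\<forall>a\<in>arcs Q. l \<in> S (tail Q a) \<and> k \<in> T (head Q a) - S (head Q a) \<longrightarrow>
        \<alpha> a k * y (tail Q a) - \<alpha> a l * y (head Q a) = f a)))"

text \<open>In degree \<open>d k - d l\<close> the right hand side of the quadratic equations involves only coordinates of
  smaller degree, so a right inverse of the linear left hand side solves them recursively.\<close>

lemma lift_iso_linearization:
  assumes S: "S \<in> cells e" and ext: "ext_vanishes S"
  shows "lift_iso (affine_var (cell_coords S)) (affine_var (lin_coords S))"
proof -
  note S_T = cellsD(1)[OF S]
  have fin: "finite (pos_index S)"
    using finite_subset[OF pos_chart_index finite_chart_index[OF S_T]] .
  \<comment> \<open>Response to the unit right hand side at the arrow \<open>a0\<close>. The linear
    operator does not mix different pairs \<open>(k, l)\<close>, so each pair is solved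
    separately.\<close>
  define sol where "sol a0 k l y \<longleftrightarrow> (\<forall>i. y i \<noteq> 0 \<longrightarrow> (i, k, l) \<in> pos_index S) \<and>
      (\<forall>a\<in>arcs Q. l \<in> S (tail Q a) \<and> k \<in> T (head Q a) - S (head Q a) \<and> d l < d k \<longrightarrow>
         \<alpha> a k * y (tail Q a) - \<alpha> a l * y (head Q a) = (if a = a0 then 1 else 0))"
    for a0 k l and y :: "'v \<Rightarrow> complex"
  have "\<exists>y. sol a0 k l y" for a0 k l
  proof (cases "k \<in> K \<and> l \<in> K \<and> d l < d k")
    case True
    have "\<exists>y::'v \<Rightarrow> complex. (\<forall>i. y i \<noteq> 0 \<longrightarrow> (i, k, l) \<in> chart_index S) \<and>
      (\<forall>a\<in>arcs Q. l \<in> S (tail Q a) \<and> k \<in> T (head Q a) - S (head Q a) \<longrightarrow>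
         \<alpha> a k * y (tail Q a) - \<alpha> a l * y (head Q a) = (\<lambda>a. if a = a0 then 1 else 0) a)"
      using ext[unfolded ext_vanishes_def, rule_format, of k l "\<lambda>a. if a = a0 then 1 else 0"] True by simp
    then obtain y :: "'v \<Rightarrow> complex" where "\<forall>i. y i \<noteq> 0 \<longrightarrow> (i, k, l) \<in> chart_index S"
      "\<forall>a\<in>arcs Q. l \<in> S (tail Q a) \<and> k \<in> T (head Q a) - S (head Q a) \<longrightarrow>
         \<alpha> a k * y (tail Q a) - \<alpha> a l * y (head Q a) = (\<lambda>a. if a = a0 then 1 else 0) a"
      by blast
    moreover have "(i, k, l) \<in> pos_index S \<longleftrightarrow> (i, k, l) \<in> chart_index S" for i
      using True by (simp add: pos_index_def chart_index_def)
    ultimately show ?thesis unfolding sol_def by (intro exI[of _ y]) simp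
  next
    case False
    \<comment> \<open>Outside this range there is no equation to solve, and zero is a
      solution.\<close>
    then have "\<not> (l \<in> S (tail Q a) \<and> k \<in> T (head Q a) - S (head Q a) \<and> d l < d k)" for a
      using S_K[OF S_T, of l "tail Q a"] T_K[of k "head Q a"] by blast
    then show ?thesis unfolding sol_def by (intro exI[of _ "\<lambda>_. 0"]) simp
  qed
  then obtain \<sigma> where sol: "\<And>a0 k l. sol a0 k l (\<sigma> a0 k l)" by metis
  have
    \<sigma>_pos: "\<And>a0 k l i. \<sigma> a0 k l i \<noteq> 0 \<Longrightarrow> (i, k, l) \<in> pos_index S" and
    \<sigma>: "\<And>a0 k l a. a \<in> arcs Q \<Longrightarrow> l \<in> S (tail Q a) \<Longrightarrow> k \<in> T (head Q a) - S (head Q a) \<Longrightarrow> d l < d k \<Longrightarrow>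
      \<alpha> a k * \<sigma> a0 k l (tail Q a) - \<alpha> a l * \<sigma> a0 k l (head Q a) = (if a = a0 then 1 else 0)"
    using sol unfolding sol_def by simp_all
  define quad where "quad x a k l = (\<Sum>m\<in>K. \<alpha> a m * x (head Q a, k, m) * x (tail Q a, m, l))" for x a k l
  \<comment> \<open>Superposition of the unit responses: a linear right inverse of the left hand
    side of the equations.\<close>
  define s where "s F = (\<lambda>(i, k, l). \<Sum>a\<in>arcs Q. F a k l * \<sigma> a k l i)" for F
  define pos where "pos x \<longleftrightarrow> (\<forall>p. p \<notin> pos_index S \<longrightarrow> x p = 0)" for x :: "'v \<times> 'k \<times> 'k \<Rightarrow> complex"
  have pos0: "x p = 0" if "pos x" "p \<notin> pos_index S" for x p
    using that unfolding pos_def by blast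
  have posD: "x (i, k, l) = 0" if "pos x" "\<not> d l < d k" for x i k l
    using that by (auto simp: pos_def pos_index_def)
  have pos_s: "pos (s F)" for F
    unfolding pos_def
  proof (intro allI impI)
    fix p assume p: "p \<notin> pos_index S"
    obtain i k l where ikl: "p = (i, k, l)" by (metis prod_cases3)
    have "\<sigma> a k l i = 0" for a using p \<sigma>_pos[of a k l i] by (auto simp: ikl)
    then show "s F p = 0" by (simp add: ikl s_def)
  qed
  have \<delta>s: "\<alpha> a k * s F (tail Q a, k, l) - \<alpha> a l * s F (head Q a, k, l) = F a k l"
    if "a \<in> arcs Q" "l \<in> S (tail Q a)" "k \<in> T (head Q a) - S (head Q a)" "d l < d k" for F a k l
  proof -
    have "\<alpha> a k * s F (tail Q a, k, l) - \<alpha> a l * s F (head Q a, k, l) =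
        (\<Sum>a0\<in>arcs Q. F a0 k l * (\<alpha> a k * \<sigma> a0 k l (tail Q a) - \<alpha> a l * \<sigma> a0 k l (head Q a)))"
      by (simp add: s_def sum_distrib_left sum_subtractf[symmetric] algebra_simps)
    also have "\<dots> = (\<Sum>a0\<in>arcs Q. if a0 = a then F a k l else 0)"
      by (intro sum.cong) (auto simp: \<sigma>[OF that])
    finally show ?thesis using that(1) fin_arcs by simp
  qed
  have quad0: "quad x a k l = 0" if x: "pos x" "\<not> d l < d k" for x a k l
    unfolding quad_def
  proof (intro sum.neutral ballI)
    fix m
    show "\<alpha> a m * x (head Q a, k, m) * x (tail Q a, m, l) = 0"
      using posD[OF x(1), of m k] posD[OF x(1), of l m] x(2) by fastforce
  qed
  have cell: "x \<in> cell_coords S \<longleftrightarrow> pos x \<and> (\<forall>a\<in>arcs Q. \<forall>l\<in>S (tail Q a). \<forall>k\<in>T (head Q a) - S (head Q a).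
      \<alpha> a k * x (tail Q a, k, l) - \<alpha> a l * x (head Q a, k, l) = quad x a k l)" for x
    by (auto simp: cell_coords_def cell_eqs_def pos_def quad_def)
  have lin: "x \<in> lin_coords S \<longleftrightarrow> pos x \<and> (\<forall>a\<in>arcs Q. \<forall>l\<in>S (tail Q a). \<forall>k\<in>T (head Q a) - S (head Q a).
      \<alpha> a k * x (tail Q a, k, l) - \<alpha> a l * x (head Q a, k, l) = 0)" for x
    by (auto simp: lin_coords_def pos_def)
  \<comment> \<open>Subtracting a particular solution for the right hand side \<open>quad x\<close>
    leaves a solution of the homogeneous equations.\<close>
  define h where "h x = (\<lambda>p. x p - s (quad x) p)" for x
  have h_lin: "h x \<in> lin_coords S" if x: "x \<in> cell_coords S" for x
  proof -
    have px: "pos x" and ph: "pos (h x)" using x pos_s by (auto simp: cell h_def pos_def)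
    have "\<alpha> a k * h x (tail Q a, k, l) - \<alpha> a l * h x (head Q a, k, l) = 0"
      if a: "a \<in> arcs Q" "l \<in> S (tail Q a)" "k \<in> T (head Q a) - S (head Q a)" for a k l
    proof (cases "d l < d k")
      case True
      have "\<alpha> a k * x (tail Q a, k, l) - \<alpha> a l * x (head Q a, k, l) = quad x a k l"
        using x a by (simp add: cell)
      then show ?thesis using \<delta>s[OF a True, of "quad x"] by (simp add: h_def algebra_simps)
    qed (simp add: posD[OF ph])
    then show ?thesis using ph by (simp add: lin)
  qed
  \<comment> \<open>To invert \<open>h\<close> at \<open>\<psi>\<close>, the equation
    \<open>y = \<psi> + s (quad y)\<close> is solved by iteration starting from 0.\<close>
  define it where "it \<psi> n = ((\<lambda>y p. \<psi> p + s (quad y) p) ^^ n) (\<lambda>_. 0)" for \<psi> n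
  have it_Suc: "it \<psi> (Suc n) = (\<lambda>p. \<psi> p + s (quad (it \<psi> n)) p)" for \<psi> n by (simp add: it_def)
  have it_0: "it \<psi> 0 = (\<lambda>_. 0)" for \<psi> by (simp add: it_def)
  have pos_it: "pos (it \<psi> n)" if "pos \<psi>" for \<psi> n
    using that pos_s by (cases n) (auto simp: it_0 it_Suc pos_def)
  \<comment> \<open>Agreement of two coordinate families in all degrees up to \<open>n\<close>. One
    iteration gains a degree: a product occurring in degree at most \<open>Suc n\<close> has two
    factors of positive degree, hence each of degree at most \<open>n\<close>.\<close>
  define agree where "agree n y y' \<longleftrightarrow> (\<forall>i k l. d k - d l \<le> int n \<longrightarrow> y (i, k, l) = y' (i, k, l))"
    for n and y y' :: "'v \<times> 'k \<times> 'k \<Rightarrow> complex"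
  have agree_0: "agree 0 y y'" if "pos y" "pos y'" for y y'
    using that by (auto simp: agree_def posD)
  have agree_Suc: "agree (Suc n) (\<lambda>p. \<psi> p + s (quad y) p) (\<lambda>p. \<psi> p + s (quad y') p)"
    if y: "pos y" "pos y'" "agree n y y'" for n \<psi> y y'
  proof -
    have "quad y a k l = quad y' a k l" if kl: "d k - d l \<le> int (Suc n)" for a k l
      unfolding quad_def
    proof (rule sum.cong)
      fix m
      show "\<alpha> a m * y (head Q a, k, m) * y (tail Q a, m, l) = \<alpha> a m * y' (head Q a, k, m) * y' (tail Q a, m, l)"
      proof (cases "d l < d m \<and> d m < d k")
        case True
        then show ?thesis using y(3) kl by (simp add: agree_def)
      next
        case False
        then show ?thesis using posD[OF y(1), of m k] posD[OF y(1), of l m] posD[OF y(2), of m k] posD[OF y(2), of l m]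
          by fastforce
      qed
    qed simp
    then show ?thesis by (simp add: agree_def s_def)
  qed
  \<comment> \<open>\<open>N\<close> bounds all degrees that occur, so agreement up to
    \<open>N\<close> is equality and the iteration is stationary after \<open>N\<close>
    steps.\<close>
  obtain N :: nat where N: "\<And>k l. k \<in> K \<Longrightarrow> l \<in> K \<Longrightarrow> d k - d l \<le> int N"
  proof
    have "finite ((\<lambda>(k, l). d k - d l) ` (K \<times> K))" using fin_K by simp
    then show "d k - d l \<le> int (nat (Max ((\<lambda>(k, l). d k - d l) ` (K \<times> K))))" if "k \<in> K" "l \<in> K" for k l
    proof -
      have "d k - d l \<in> (\<lambda>(k, l). d k - d l) ` (K \<times> K)" using that by auto
      then have "d k - d l \<le> Max ((\<lambda>(k, l). d k - d l) ` (K \<times> K))" using fin_K by (intro Max_ge) auto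
      then show ?thesis by linarith
    qed
  qed
  have agree_N: "y = y'" if "pos y" "pos y'" "agree N y y'" for y y'
  proof
    fix p :: "'v \<times> 'k \<times> 'k"
    obtain i k l where p: "p = (i, k, l)" by (metis prod_cases3)
    show "y p = y' p"
    proof (cases "p \<in> pos_index S")
      case True
      then have "k \<in> K" "l \<in> K" using S_K[OF S_T] T_K by (auto simp: p pos_index_def)
      then show ?thesis using that(3) N by (simp add: agree_def p)
    qed (simp add: pos0[OF that(1)] pos0[OF that(2)])
  qed
  have agree_it: "agree n (it \<psi> n) (it \<psi> (Suc n))" if "pos \<psi>" for \<psi> n
  proof (induction n)
    case 0
    show ?case by (rule agree_0) (rule pos_it[OF that])+
  next
    case (Suc n)
    show ?case
      using agree_Suc[OF pos_it[OF that] pos_it[OF that] Suc, of \<psi>] by (simp only: it_Suc)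
  qed
  have it_fix: "it \<psi> N = (\<lambda>p. \<psi> p + s (quad (it \<psi> N)) p)" if "pos \<psi>" for \<psi>
    using agree_N[OF pos_it[OF that] pos_it[OF that] agree_it[OF that]] by (simp only: it_Suc)
  have it_unique: "it \<psi> N = y" if "pos \<psi>" "pos y" and y: "y = (\<lambda>p. \<psi> p + s (quad y) p)" for \<psi> y
  proof (rule agree_N[OF pos_it[OF that(1)] that(2)])
    have "agree n (it \<psi> n) y" for n
    proof (induction n)
      case 0
      show ?case by (rule agree_0[OF pos_it[OF that(1)] that(2)])
    next
      case (Suc n)
      have "agree (Suc n) (it \<psi> (Suc n)) (\<lambda>p. \<psi> p + s (quad y) p)"
        using agree_Suc[OF pos_it[OF that(1)] that(2) Suc] by (simp only: it_Suc)
      then show ?case using y by simp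
    qed
    then show "agree N (it \<psi> N) y" .
  qed
  have it_cell: "it \<psi> N \<in> cell_coords S" and h_it: "h (it \<psi> N) = \<psi>" if \<psi>: "\<psi> \<in> lin_coords S" for \<psi>
  proof -
    have p: "pos \<psi>" using \<psi> by (simp add: lin)
    define y where "y = it \<psi> N"
    have py: "pos y" using pos_it[OF p] by (simp add: y_def)
    have y: "y q = \<psi> q + s (quad y) q" for q using it_fix[OF p] by (metis y_def)
    show "h (it \<psi> N) = \<psi>" using y by (simp add: h_def flip: y_def)
    have "\<alpha> a k * y (tail Q a, k, l) - \<alpha> a l * y (head Q a, k, l) = quad y a k l"
      if a: "a \<in> arcs Q" "l \<in> S (tail Q a)" "k \<in> T (head Q a) - S (head Q a)" for a k l
    proof (cases "d l < d k")
      case True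
      have "\<alpha> a k * \<psi> (tail Q a, k, l) - \<alpha> a l * \<psi> (head Q a, k, l) = 0"
        using \<psi> a by (simp add: lin)
      then show ?thesis
        using \<delta>s[OF a True, of "quad y"] y[of "(tail Q a, k, l)"] y[of "(head Q a, k, l)"]
        by (simp add: algebra_simps)
    qed (simp add: posD[OF py] quad0[OF py])
    then show "it \<psi> N \<in> cell_coords S" using py by (simp add: cell flip: y_def)
  qed
  have poly_s: "polyfun (\<lambda>x. s (quad (g x)) p)" if g: "\<And>q. polyfun (\<lambda>x. g x q)"
    for g :: "('v \<times> 'k \<times> 'k \<Rightarrow> complex) \<Rightarrow> 'v \<times> 'k \<times> 'k \<Rightarrow> complex" and p
  proof (cases p)
    case (fields i k l)
    show ?thesis
      unfolding fields s_def quad_def prod.case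
      by (intro polyfun_sum polyfun_mult polyfun_const g)
  qed
  \<comment> \<open>A fixed finite number of polynomial steps; this makes the inverse of
    \<open>h\<close> regular.\<close>
  have poly_it: "polyfun (\<lambda>\<psi>. it \<psi> n p)" for n p
  proof (induction n arbitrary: p)
    case (Suc n)
    show ?case unfolding it_Suc by (intro polyfun_add polyfun_apply poly_s Suc)
  qed (simp add: it_0 polyfun_const)
  have lift_forth: "regular_lift (affine_var (cell_coords S)) (affine_var (lin_coords S)) h"
  proof (rule regular_liftI[where H = h])
    have "regmap (cell_coords S) h"
    proof (rule regmap_finite_support[OF fin])
      show "h x p = 0" if "x \<in> cell_coords S" "p \<notin> pos_index S" for x p
        using h_lin[OF that(1)] that(2) pos0 by (simp add: lin)
      show "regfun (cell_coords S) (\<lambda>x. h x p)" for p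
        unfolding h_def by (intro regfun_poly polyfun_diff polyfun_apply poly_s)
    qed
    then show "regmap (fst (affine_var (cell_coords S))) h" by (simp add: affine_var_def)
  qed (use h_lin in \<open>auto simp: affine_var_def\<close>)
  have lift_back: "regular_lift (affine_var (lin_coords S)) (affine_var (cell_coords S)) (\<lambda>\<psi>. it \<psi> N)"
  proof (rule regular_liftI[where H = "\<lambda>\<psi>. it \<psi> N"])
    have "regmap (lin_coords S) (\<lambda>\<psi>. it \<psi> N)"
    proof (rule regmap_finite_support[OF fin])
      show "it \<psi> N p = 0" if "\<psi> \<in> lin_coords S" "p \<notin> pos_index S" for \<psi> p
        using pos0[OF pos_it[of \<psi> N]] that by (simp add: lin)
    qed (intro regfun_poly poly_it)
    then show "regmap (fst (affine_var (lin_coords S))) (\<lambda>\<psi>. it \<psi> N)" by (simp add: affine_var_def)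
  qed (use it_cell in \<open>auto simp: affine_var_def\<close>)
  have it_h: "it (h x) N = x" if "x \<in> cell_coords S" for x
    by (rule it_unique) (use h_lin[OF that] that in \<open>auto simp: lin cell h_def\<close>)
  show ?thesis
    by (rule lift_isoI[OF lift_forth lift_back]) (use h_it it_h in \<open>auto simp: affine_var_def points_def\<close>)
qed


section \<open>Spaces of homomorphisms\<close>

lemma cd_span:
  assumes "X \<subseteq> K" "v \<in> cvec.span ((\<lambda>l. b l i) ` X)" "k \<in> K" "k \<notin> X"
  shows "cd i k v = 0"
  using assms(2)
proof (induction rule: cvec.span_induct_alt)
  case (step c x y)
  then obtain l where "l \<in> X" "x = b l i" by auto
  then have "cd i k x = 0" using cd_b[of k l i] assms by auto
  then show ?case using step by (simp add: cdD scaleC_complex)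
qed (simp add: cdD)

lemma span_sp: "X \<subseteq> K \<Longrightarrow> cvec.span ((\<lambda>l. b l i) ` X) \<subseteq> sp V i"
  by (intro cvec.span_minimal subspace_sp) (auto intro: b_sp)

lemma mem_span_iff:
  assumes "X \<subseteq> K"
  shows "v \<in> cvec.span ((\<lambda>l. b l i) ` X) \<longleftrightarrow> v \<in> sp V i \<and> (\<forall>k\<in>K - X. cd i k v = 0)"
proof safe
  assume v: "v \<in> sp V i" "\<forall>k\<in>K - X. cd i k v = 0"
  have "v = (\<Sum>k\<in>K. cd i k v *\<^sub>C b k i)" by (rule expansion[OF v(1)])
  also have "\<dots> = (\<Sum>k\<in>X. cd i k v *\<^sub>C b k i)"
    by (rule sum.mono_neutral_right) (use assms fin_K v in auto)
  also have "\<dots> \<in> cvec.span ((\<lambda>l. b l i) ` X)"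
    by (intro cvec.span_sum cvec.span_scale cvec.span_base) auto
  finally show "v \<in> cvec.span ((\<lambda>l. b l i) ` X)" .
qed (use span_sp[OF assms] cd_span[OF assms] in auto)

lemma expansion_span:
  assumes "X \<subseteq> K" "v \<in> cvec.span ((\<lambda>l. b l i) ` X)"
  shows "v = (\<Sum>k\<in>X. cd i k v *\<^sub>C b k i)"
proof -
  have "v = (\<Sum>k\<in>K. cd i k v *\<^sub>C b k i)" using expansion span_sp assms by blast
  also have "\<dots> = (\<Sum>k\<in>X. cd i k v *\<^sub>C b k i)"
    by (rule sum.mono_neutral_right) (use assms fin_K cd_span[OF assms] in auto)
  finally show ?thesis .
qed

text \<open>Coordinates of the homomorphisms from the part of \<open>L\<close> in the summands \<open>A\<close> to the part of \<open>V/L\<close> in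
  the summands \<open>B\<close>.\<close>

definition lin_block :: "('v \<Rightarrow> 'k set) \<Rightarrow> 'k set \<Rightarrow> 'k set \<Rightarrow> ('v \<times> 'k \<times> 'k \<Rightarrow> complex) set" where
  "lin_block S A B = {x. (\<forall>i k l. x (i, k, l) \<noteq> 0 \<longrightarrow> (i, k, l) \<in> chart_index S \<and> l \<in> A \<and> k \<in> B) \<and>
     (\<forall>a\<in>arcs Q. \<forall>l\<in>S (tail Q a). \<forall>k\<in>T (head Q a) - S (head Q a).
        \<alpha> a k * x (tail Q a, k, l) = \<alpha> a l * x (head Q a, k, l))}"

lemma lin_block_zero:
  "x \<in> lin_block S A B \<Longrightarrow> (i, k, l) \<notin> chart_index S \<or> l \<notin> A \<or> k \<notin> B \<Longrightarrow> x (i, k, l) = 0"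
  unfolding lin_block_def by blast

lemma subspace_lin_block: "cvec.subspace (lin_block S A B)"
proof (rule cvec.subspaceI)
  show "0 \<in> lin_block S A B" by (simp add: lin_block_def)
  fix x y assume xy: "x \<in> lin_block S A B" "y \<in> lin_block S A B"
  have "(x + y) (i, k, l) = 0" if "\<not> ((i, k, l) \<in> chart_index S \<and> l \<in> A \<and> k \<in> B)" for i k l
    using xy[THEN lin_block_zero, of i k l] that by auto
  then show "x + y \<in> lin_block S A B"
    using xy by (auto simp: lin_block_def distrib_left)
next
  fix c x assume x: "x \<in> lin_block S A B"
  have "(c *\<^sub>C x) (i, k, l) = 0" if "\<not> ((i, k, l) \<in> chart_index S \<and> l \<in> A \<and> k \<in> B)" for i k l
    using x[THEN lin_block_zero, of i k l] that by (auto simp: scaleC_fun scaleC_complex)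
  moreover have "\<alpha> a k * (c *\<^sub>C x) (tail Q a, k, l) = \<alpha> a l * (c *\<^sub>C x) (head Q a, k, l)"
    if "a \<in> arcs Q" "l \<in> S (tail Q a)" "k \<in> T (head Q a) - S (head Q a)" for a k l
  proof -
    have "\<alpha> a k * x (tail Q a, k, l) = \<alpha> a l * x (head Q a, k, l)" using x that by (simp add: lin_block_def)
    then show ?thesis by (simp add: scaleC_fun scaleC_complex mult.left_commute)
  qed
  ultimately show "c *\<^sub>C x \<in> lin_block S A B" unfolding lin_block_def by blast
qed

lemma lin_coords_block: "lin_coords S = {x \<in> lin_block S UNIV UNIV. \<forall>p. p \<notin> pos_index S \<longrightarrow> x p = 0}"
  using pos_chart_index[of S] unfolding lin_coords_def lin_block_def by blast

lemma subspace_lin_coords: "cvec.subspace (lin_coords S)"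
proof (rule cvec.subspaceI)
  note * = subspace_lin_block[of S UNIV UNIV]
  show "0 \<in> lin_coords S" using cvec.subspace_0[OF *] by (simp add: lin_coords_block)
  show "x + y \<in> lin_coords S" if "x \<in> lin_coords S" "y \<in> lin_coords S" for x y
    using cvec.subspace_add[OF *] that by (auto simp: lin_coords_block)
  show "c *\<^sub>C x \<in> lin_coords S" if "x \<in> lin_coords S" for c x
    using cvec.subspace_scale[OF *] that by (auto simp: lin_coords_block scaleC_fun scaleC_complex)
qed

definition source :: "('v \<Rightarrow> 'k set) \<Rightarrow> 'k set \<Rightarrow> 'v \<Rightarrow> 'm set" where
  "source S A i = cvec.span ((\<lambda>l. b l i) ` (S i \<inter> A))"

text \<open>The homomorphism with matrix \<open>x\<close>. Since \<open>q\<close> kills the vectors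
  of L, only the classes of the basis vectors outside \<open>S i\<close> matter in the inner
  sum.\<close>

definition block_hom :: "('v \<Rightarrow> 'k set) \<Rightarrow> 'k set \<Rightarrow> 'k set \<Rightarrow> ('v \<Rightarrow> 'm \<Rightarrow> 'n::complex_vector)
    \<Rightarrow> ('v \<times> 'k \<times> 'k \<Rightarrow> complex) \<Rightarrow> 'v \<Rightarrow> 'm \<Rightarrow> 'n" where
  "block_hom S A B q x = (\<lambda>i v. if v \<in> source S A i
     then \<Sum>l\<in>S i \<inter> A. \<Sum>k\<in>B. (cd i l v * x (i, k, l)) *\<^sub>C q i (b k i) else 0)"

context
  fixes S :: "'v \<Rightarrow> 'k set" and e :: "'v \<Rightarrow> nat" and A B :: "'k set" and U :: "'v \<Rightarrow> 'm set"
    and W :: "('v, 'a, 'n::complex_vector) qrep" and q :: "'v \<Rightarrow> 'm \<Rightarrow> 'n"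
  assumes S: "S \<in> cells e" and A: "A \<subseteq> K" and B: "B \<subseteq> K"
    and U: "\<And>i. U i = cvec.span ((\<lambda>k. b k i) ` B)"
    and quot: "is_quotient Q (rep_of V U) (\<lambda>i. cvec.span ((\<lambda>k. b k i) ` (S i \<inter> B))) W q"
begin

lemma q_props:
  shows q_lin: "clinear_on (U i) (q i)" and q_img: "q i ` U i = sp W i"
    and q_ker: "v \<in> U i \<Longrightarrow> q i v = 0 \<longleftrightarrow> v \<in> cvec.span ((\<lambda>k. b k i) ` (S i \<inter> B))"
    and q_act: "a \<in> arcs Q \<Longrightarrow> v \<in> U (tail Q a) \<Longrightarrow> q (head Q a) (act V a v) = act W a (q (tail Q a) v)"
    and W: "representation Q W"
proof -
  have "{x \<in> U i. q i x = 0} = cvec.span ((\<lambda>k. b k i) ` (S i \<inter> B))"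
    using quot by (auto simp: is_quotient_def rep_of_def)
  then show "v \<in> U i \<Longrightarrow> q i v = 0 \<longleftrightarrow> v \<in> cvec.span ((\<lambda>k. b k i) ` (S i \<inter> B))" by blast
qed (use quot in \<open>auto simp: is_quotient_def rep_hom_def rep_of_def\<close>)

lemma S_A: "S i \<inter> A \<subseteq> K" and S_B: "S i \<inter> B \<subseteq> K" and finite_S_A: "finite (S i \<inter> A)" and finite_B: "finite B"
  using A B finite_subset[OF A fin_K] finite_subset[OF B fin_K] by auto

lemma subspace_U: "cvec.subspace (U i)" and b_U: "k \<in> B \<Longrightarrow> b k i \<in> U i"
  and combination_U: "(\<Sum>k\<in>B. c k *\<^sub>C b k i) \<in> U i"
  by (auto simp: U span_sp[OF B] intro: cvec.span_base cvec.span_sum cvec.span_scale)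

lemma subspace_W: "cvec.subspace (sp W i)"
  using W unfolding representation_def by (metis cvec.subspace_span)

lemma q_combination: "q i (\<Sum>k\<in>B. c k *\<^sub>C b k i) = (\<Sum>k\<in>B. c k *\<^sub>C q i (b k i))"
  by (rule clinear_on_sum[OF q_lin subspace_U b_U])

text \<open>A combination killed by \<open>q\<close> lies in the span of the \<open>b k i\<close>
  with \<open>k\<close> in \<open>S i\<close>, so its coordinates outside \<open>S i\<close>
  vanish.\<close>

lemma q_independent:
  assumes "(\<Sum>k\<in>B. c k *\<^sub>C q i (b k i)) = 0" "k \<in> B" "k \<in> T i - S i"
  shows "c k = 0"
proof -
  have "(\<Sum>k\<in>B. c k *\<^sub>C b k i) \<in> cvec.span ((\<lambda>k. b k i) ` (S i \<inter> B))"
    using q_ker[OF combination_U] assms(1) by (simp add: q_combination)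
  then have "cd i k (\<Sum>k\<in>B. c k *\<^sub>C b k i) = 0"
    using cd_span[OF S_B] assms(2,3) B by blast
  moreover have "cd i k (\<Sum>k\<in>B. c k *\<^sub>C b k i) = (\<Sum>l\<in>B. if l = k then c k else 0)"
    unfolding cdD by (rule sum.cong) (use assms(2,3) B in \<open>auto simp: cd_b subset_iff scaleC_complex T_def\<close>)
  ultimately show ?thesis using assms(2) finite_B by simp
qed

lemma q_b_eq_0:
  assumes k: "k \<in> B" "k \<notin> T i - S i"
  shows "q i (b k i) = 0"
proof -
  have "k \<in> S i \<or> b k i = 0" using k B by (auto simp: T_def)
  then show ?thesis
    using q_ker[OF b_U[OF k(1), of i]] k(1) by (auto simp: cvec.span_zero intro: cvec.span_base)
qed

lemma b_source: "l \<in> S i \<inter> A \<Longrightarrow> b l i \<in> source S A i"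
  by (auto simp: source_def intro: cvec.span_base)

lemma subspace_source: "cvec.subspace (source S A i)"
  by (simp add: source_def)

lemma source_sp: "source S A i \<subseteq> sp V i"
  unfolding source_def by (rule span_sp[OF S_A])

lemma cd_source:
  assumes "l \<in> S i \<inter> A" "k \<in> K"
  shows "cd i k (b l i) = (if k = l then 1 else 0)"
  using assms cd_b[of k l i] cellsD(1)[OF S, of i] A by (auto simp: T_def)

lemma block_hom_b:
  assumes l: "l \<in> S i \<inter> A"
  shows "block_hom S A B q x i (b l i) = (\<Sum>k\<in>B. x (i, k, l) *\<^sub>C q i (b k i))"
proof -
  have "block_hom S A B q x i (b l i) = (\<Sum>m\<in>S i \<inter> A. if m = l then \<Sum>k\<in>B. x (i, k, l) *\<^sub>C q i (b k i) else 0)"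
    using b_source[OF l] S_A[of i] cd_source[OF l]
    by (auto simp: block_hom_def subset_iff intro!: sum.cong)
  then show ?thesis using l finite_S_A by simp
qed

lemma block_hom_sp: "block_hom S A B q x i v \<in> sp W i"
proof -
  have "q i (b k i) \<in> sp W i" if "k \<in> B" for k using q_img b_U[OF that] by blast
  then show ?thesis
    unfolding block_hom_def using subspace_W
    by (auto intro!: cvec.subspace_sum cvec.subspace_scale cvec.subspace_0)
qed

lemma block_hom_clinear: "clinear_on (source S A i) (block_hom S A B q x i)"
  using cvec.subspace_add[OF subspace_source] cvec.subspace_scale[OF subspace_source]
  by (auto simp: clinear_on_def block_hom_def cdD distrib_right scaleC_add_left sum.distrib scaleC_complex
      cvec.scale_sum_right scaleC_scaleC mult.assoc)

lemma hom_eq_source: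
  assumes "clinear_on (source S A i) \<phi>" "clinear_on (source S A i) \<psi>" "\<And>l. l \<in> S i \<inter> A \<Longrightarrow> \<phi> (b l i) = \<psi> (b l i)"
    "v \<in> source S A i"
  shows "\<phi> v = \<psi> v"
proof -
  have v: "v = (\<Sum>l\<in>S i \<inter> A. cd i l v *\<^sub>C b l i)"
    using expansion_span[OF S_A] assms(4) by (simp add: source_def)
  have "\<phi> v = (\<Sum>l\<in>S i \<inter> A. cd i l v *\<^sub>C \<phi> (b l i))"
    using clinear_on_sum[OF assms(1) subspace_source b_source, of "S i \<inter> A" "\<lambda>l. l" "\<lambda>l. cd i l v"] v by simp
  also have "\<dots> = (\<Sum>l\<in>S i \<inter> A. cd i l v *\<^sub>C \<psi> (b l i))" by (rule sum.cong) (simp_all add: assms(3))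
  also have "\<dots> = \<psi> v"
    using clinear_on_sum[OF assms(2) subspace_source b_source, of "S i \<inter> A" "\<lambda>l. l" "\<lambda>l. cd i l v"] v by simp
  finally show ?thesis .
qed

lemma act_source: "a \<in> arcs Q \<Longrightarrow> v \<in> source S A (tail Q a) \<Longrightarrow> act V a v \<in> source S A (head Q a)"
proof -
  assume a: "a \<in> arcs Q" and v: "v \<in> source S A (tail Q a)"
  have vsp: "v \<in> sp V (tail Q a)" using v source_sp by blast
  have "cd (head Q a) k (act V a v) = 0" if k: "k \<in> K - S (head Q a) \<inter> A" for k
  proof (cases "k \<in> S (tail Q a) \<inter> A")
    case True
    then have "\<alpha> a k = 0" using cellsD(3)[OF S a, of k] k by auto
    then show ?thesis using cd_act[OF a vsp] k by simp
  next
    case False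
    then have "cd (tail Q a) k v = 0" using cd_span[OF S_A] v k by (auto simp: source_def)
    then show ?thesis using cd_act[OF a vsp] k by simp
  qed
  then show ?thesis
    unfolding source_def mem_span_iff[OF S_A] using act_sp[OF a vsp] by blast
qed

text \<open>Arrows are diagonal on the source and on the classes \<open>q i (b k i)\<close>, so
  comparing coefficients in the commutative square turns it into one scalar equation for each pair
  \<open>(k, l)\<close>. For \<open>l\<close> outside \<open>A\<close> both sides are zero.\<close>

lemma hom_commute_iff:
  assumes lin: "\<And>i. clinear_on (source S A i) (\<phi> i)" and im: "\<And>i v. \<phi> i v \<in> sp W i"
    and \<phi>: "\<And>i l. l \<in> S i \<inter> A \<Longrightarrow> \<phi> i (b l i) = (\<Sum>k\<in>B. x (i, k, l) *\<^sub>C q i (b k i))"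
    and x: "\<And>i k l. x (i, k, l) \<noteq> 0 \<Longrightarrow> (i, k, l) \<in> chart_index S \<and> l \<in> A \<and> k \<in> B"
    and a: "a \<in> arcs Q"
  shows "(\<forall>v\<in>source S A (tail Q a). \<phi> (head Q a) (act V a v) = act W a (\<phi> (tail Q a) v)) \<longleftrightarrow>
    (\<forall>l\<in>S (tail Q a). \<forall>k\<in>T (head Q a) - S (head Q a).
       \<alpha> a k * x (tail Q a, k, l) = \<alpha> a l * x (head Q a, k, l))"
proof -
  let ?i = "tail Q a" and ?j = "head Q a"
  have Wlin: "clinear_on (sp W ?i) (act W a)" using W a by (simp add: representation_def)
  have lin1: "clinear_on (source S A ?i) (\<lambda>v. \<phi> ?j (act V a v))"
    using lin[of ?j] act_linear[OF a] act_source[OF a] source_sp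
    by (auto simp: clinear_on_def subset_iff)
  have lin2: "clinear_on (source S A ?i) (\<lambda>v. act W a (\<phi> ?i v))"
    using lin[of ?i] Wlin im by (auto simp: clinear_on_def)
  have key: "\<phi> ?j (act V a (b l ?i)) = act W a (\<phi> ?i (b l ?i)) \<longleftrightarrow>
      (\<forall>k\<in>T ?j - S ?j. \<alpha> a k * x (?i, k, l) = \<alpha> a l * x (?j, k, l))" if l: "l \<in> S ?i \<inter> A" for l
  proof -
    have lK: "l \<in> K" using l A by auto
    have b0: "\<alpha> a l = 0 \<or> l \<in> S ?j \<inter> A" using cellsD(3)[OF S a] l by auto
    have "\<phi> ?j (act V a (b l ?i)) = (\<Sum>k\<in>B. (\<alpha> a l * x (?j, k, l)) *\<^sub>C q ?j (b k ?j))"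
    proof (cases "\<alpha> a l = 0")
      case True
      have "\<phi> ?j (0 *\<^sub>C 0) = 0 *\<^sub>C \<phi> ?j 0"
        by (rule clinear_onD(2)[OF lin cvec.subspace_0[OF subspace_source]])
      then show ?thesis using True by (simp add: act_b[OF a lK])
    next
      case False
      then have "l \<in> S ?j \<inter> A" using b0 by blast
      then show ?thesis
        using clinear_onD(2)[OF lin b_source, of l ?j "\<alpha> a l"]
        by (simp add: act_b[OF a lK] \<phi> cvec.scale_sum_right scaleC_scaleC)
    qed
    moreover have "act W a (\<phi> ?i (b l ?i)) = (\<Sum>k\<in>B. (\<alpha> a k * x (?i, k, l)) *\<^sub>C q ?j (b k ?j))"
    proof -
      have qW: "q ?i (b k ?i) \<in> sp W ?i" if "k \<in> B" for k using q_img b_U[OF that] by blast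
      have "act W a (q ?i (b k ?i)) = \<alpha> a k *\<^sub>C q ?j (b k ?j)" if k: "k \<in> B" for k
        using q_act[OF a b_U[OF k]] act_b[OF a, of k] clinear_onD(2)[OF q_lin b_U[OF k]] k B by auto
      then show ?thesis
        unfolding \<phi>[OF l] using clinear_on_sum[OF Wlin subspace_W qW, of B "\<lambda>k. k"]
        by (simp add: scaleC_scaleC mult.commute)
    qed
    ultimately have "\<phi> ?j (act V a (b l ?i)) = act W a (\<phi> ?i (b l ?i)) \<longleftrightarrow>
        (\<Sum>k\<in>B. (\<alpha> a l * x (?j, k, l) - \<alpha> a k * x (?i, k, l)) *\<^sub>C q ?j (b k ?j)) = 0"
      by (simp add: cvec.scale_left_diff_distrib sum_subtractf)
    also have "\<dots> \<longleftrightarrow> (\<forall>k\<in>T ?j - S ?j. \<alpha> a k * x (?i, k, l) = \<alpha> a l * x (?j, k, l))"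
    proof
      assume *: "(\<Sum>k\<in>B. (\<alpha> a l * x (?j, k, l) - \<alpha> a k * x (?i, k, l)) *\<^sub>C q ?j (b k ?j)) = 0"
      show "\<forall>k\<in>T ?j - S ?j. \<alpha> a k * x (?i, k, l) = \<alpha> a l * x (?j, k, l)"
      proof
        fix k assume k: "k \<in> T ?j - S ?j"
        show "\<alpha> a k * x (?i, k, l) = \<alpha> a l * x (?j, k, l)"
        proof (cases "k \<in> B")
          case True
          then show ?thesis using q_independent[OF * True k] by simp
        next
          case False
          then show ?thesis using x[of ?i k l] x[of ?j k l] by (metis mult_zero_right)
        qed
      qed
    next
      assume *: "\<forall>k\<in>T ?j - S ?j. \<alpha> a k * x (?i, k, l) = \<alpha> a l * x (?j, k, l)"
      show "(\<Sum>k\<in>B. (\<alpha> a l * x (?j, k, l) - \<alpha> a k * x (?i, k, l)) *\<^sub>C q ?j (b k ?j)) = 0"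
      proof (intro sum.neutral ballI)
        fix k assume k: "k \<in> B"
        show "(\<alpha> a l * x (?j, k, l) - \<alpha> a k * x (?i, k, l)) *\<^sub>C q ?j (b k ?j) = 0"
        proof (cases "k \<in> T ?j - S ?j")
          case False
          then have "q ?j (b k ?j) = 0" by (rule q_b_eq_0[OF k])
          then show ?thesis by simp
        qed (use * in simp)
      qed
    qed
    finally show ?thesis .
  qed
  have "(\<forall>v\<in>source S A ?i. \<phi> ?j (act V a v) = act W a (\<phi> ?i v)) \<longleftrightarrow>
      (\<forall>l\<in>S ?i \<inter> A. \<phi> ?j (act V a (b l ?i)) = act W a (\<phi> ?i (b l ?i)))"
    using b_source hom_eq_source[OF lin1 lin2] by blast
  moreover have "x (?i, k, l) = 0 \<and> x (?j, k, l) = 0" if "l \<notin> A" for k l using x that by blast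
  ultimately show ?thesis using key by (metis Int_iff mult_zero_right)
qed

lemma block_hom_bij: "bij_betw (block_hom S A B q) (lin_block S A B) (rep_hom Q (rep_of V (source S A)) W)"
proof (rule bij_betwI')
  fix x y assume x: "x \<in> lin_block S A B" and y: "y \<in> lin_block S A B"
  show "block_hom S A B q x = block_hom S A B q y \<longleftrightarrow> x = y"
  proof
    assume eq: "block_hom S A B q x = block_hom S A B q y"
    show "x = y"
    proof
      fix p :: "'v \<times> 'k \<times> 'k"
      obtain i k l where p: "p = (i, k, l)" by (metis prod_cases3)
      show "x p = y p"
      proof (cases "(i, k, l) \<in> chart_index S \<and> l \<in> A \<and> k \<in> B")
        case True
        then have l: "l \<in> S i \<inter> A" and k: "k \<in> B" "k \<in> T i - S i" by (auto simp: chart_index_def)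
        have "(\<Sum>k\<in>B. (x (i, k, l) - y (i, k, l)) *\<^sub>C q i (b k i)) = 0"
          using block_hom_b[OF l, of x] block_hom_b[OF l, of y] eq
          by (simp add: cvec.scale_left_diff_distrib sum_subtractf)
        from q_independent[OF this k] show ?thesis by (simp add: p)
      next
        case False
        then show ?thesis using lin_block_zero[OF x] lin_block_zero[OF y] by (auto simp: p)
      qed
    qed
  qed simp
next
  fix x assume x: "x \<in> lin_block S A B"
  have "\<forall>v\<in>source S A (tail Q a). block_hom S A B q x (head Q a) (act V a v) = act W a (block_hom S A B q x (tail Q a) v)"
    if "a \<in> arcs Q" for a
    using hom_commute_iff[where x = x and a = a, OF block_hom_clinear block_hom_sp block_hom_b] x that
    unfolding lin_block_def by blast
  moreover have "v \<notin> source S A i \<Longrightarrow> block_hom S A B q x i v = 0" for i v by (simp add: block_hom_def)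
  ultimately show "block_hom S A B q x \<in> rep_hom Q (rep_of V (source S A)) W"
    using block_hom_clinear block_hom_sp by (simp add: rep_hom_def rep_of_def image_subset_iff)
next
  fix \<phi> assume \<phi>: "\<phi> \<in> rep_hom Q (rep_of V (source S A)) W"
  then have lin: "clinear_on (source S A i) (\<phi> i)" and im: "\<phi> i ` source S A i \<subseteq> sp W i"
    and out: "v \<notin> source S A i \<Longrightarrow> \<phi> i v = 0"
    and comm: "a \<in> arcs Q \<Longrightarrow> v \<in> source S A (tail Q a) \<Longrightarrow> \<phi> (head Q a) (act V a v) = act W a (\<phi> (tail Q a) v)"
    for i v a by (simp_all add: rep_hom_def rep_of_def)
  have imW: "\<phi> i v \<in> sp W i" for i v
    using im out cvec.subspace_0[OF subspace_W] by (cases "v \<in> source S A i") auto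
  have "\<exists>c. \<phi> i (b l i) = q i (\<Sum>k\<in>B. c k *\<^sub>C b k i)" for i l
  proof -
    obtain u where u: "u \<in> U i" "\<phi> i (b l i) = q i u" using imW[of i "b l i"] q_img[of i] by blast
    then show ?thesis using expansion_span[OF B] by (metis U)
  qed
  then obtain c where c: "\<And>i l. \<phi> i (b l i) = q i (\<Sum>k\<in>B. c i l k *\<^sub>C b k i)" by metis
  \<comment> \<open>The coefficients \<open>c\<close> come from arbitrary preimages under
    \<open>q\<close>; those outside the chart belong to vectors that \<open>q\<close> kills and are
    set to zero.\<close>
  define x where "x = (\<lambda>(i, k, l). if (i, k, l) \<in> chart_index S \<and> l \<in> A \<and> k \<in> B then c i l k else 0)"
  have x: "x (i, k, l) \<noteq> 0 \<Longrightarrow> (i, k, l) \<in> chart_index S \<and> l \<in> A \<and> k \<in> B" for i k l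
    by (auto simp: x_def split: if_splits)
  have \<phi>x: "\<phi> i (b l i) = (\<Sum>k\<in>B. x (i, k, l) *\<^sub>C q i (b k i))" if l: "l \<in> S i \<inter> A" for i l
    unfolding c q_combination
  proof (rule sum.cong)
    fix k assume k: "k \<in> B"
    show "c i l k *\<^sub>C q i (b k i) = x (i, k, l) *\<^sub>C q i (b k i)"
    proof (cases "k \<in> T i - S i")
      case False
      then have "q i (b k i) = 0" by (rule q_b_eq_0[OF k])
      then show ?thesis by simp
    qed (use l k in \<open>simp add: x_def chart_index_def\<close>)
  qed simp
  have "x \<in> lin_block S A B"
    using hom_commute_iff[OF lin imW \<phi>x x] comm x unfolding lin_block_def by blast
  moreover have "\<phi> = block_hom S A B q x"
  proof (intro ext)
    fix i v
    show "\<phi> i v = block_hom S A B q x i v"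
    proof (cases "v \<in> source S A i")
      case True
      show ?thesis
        by (rule hom_eq_source[OF lin block_hom_clinear _ True]) (simp add: \<phi>x block_hom_b)
    qed (simp add: out block_hom_def)
  qed
  ultimately show "\<exists>x\<in>lin_block S A B. \<phi> = block_hom S A B q x" by blast
qed

lemma block_hom_linear: "Vector_Spaces.linear scaleC scaleC (block_hom S A B q)"
  by (rule linearI) (auto simp: block_hom_def fun_eq_iff scaleC_fun scaleC_complex distrib_left
      scaleC_add_left sum.distrib cvec.scale_sum_right scaleC_scaleC mult.left_commute)

lemma lift_iso_block: "lift_iso (affine_var (lin_block S A B)) (affine_var (rep_hom Q (rep_of V (source S A)) W))"
proof -
  obtain B0 where "finite B0" "lin_block S A B = cvec.span B0"
    using finite_support_subspace[OF finite_chart_index[OF cellsD(1)[OF S]] subspace_lin_block]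
      lin_block_zero by (metis prod_cases3)
  then show ?thesis
    by (rule lift_iso_linear[OF _ _ _ block_hom_bij]) (simp add: clinear_on_def linearD[OF block_hom_linear])
qed

end

text \<open>A homomorphism is homogeneous of degree \<open>n\<close> when its matrix is concentrated
  on the pairs with \<open>d k - d l = n\<close>. So the generators of \<open>hom_pos\<close> have
  matrices in \<open>lin_coords\<close>; conversely such a matrix is the sum of its homogeneous
  components, each again a homomorphism.\<close>

lemma lift_iso_hom_pos:
  fixes W :: "('v, 'a, 'n::complex_vector) qrep"
  assumes S: "S \<in> cells e" and quot: "is_quotient Q V (chart S (\<lambda>_. 0)) W q"
  shows "lift_iso (affine_var (lin_coords S)) (affine_var (hom_pos Q V (graded_part K b d) (chart S (\<lambda>_. 0)) W q))"
proof -
  let ?L = "chart S (\<lambda>_. 0)" and ?h = "block_hom S K K q"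
  have SK: "S i \<inter> K = S i" for i using cellsD(1)[OF S, of i] T_K by auto
  have V: "rep_of V (sp V) = V" by (simp add: rep_of_def)
  have quot': "is_quotient Q (rep_of V (sp V)) (\<lambda>i. cvec.span ((\<lambda>k. b k i) ` (S i \<inter> K))) W q"
    unfolding V SK coordinate_subspace by (rule quot)
  \<comment> \<open>The block facts are applied to all of V, with both index sets equal to
    \<open>K\<close>.\<close>
  note ctx = S order.refl order.refl sp_eq quot'
  have src: "source S K = ?L" by (rule ext) (simp add: source_def SK coordinate_subspace)
  note bij = block_hom_bij[OF ctx, unfolded src] and hlin = block_hom_linear[OF ctx]
  have "lin_block S UNIV UNIV = lin_block S K K"
    using S_K[OF cellsD(1)[OF S]] T_K unfolding lin_block_def chart_index_def by blast
  then have lc: "x \<in> lin_coords S \<longleftrightarrow> x \<in> lin_block S K K \<and> (\<forall>p. p \<notin> pos_index S \<longrightarrow> x p = 0)" for x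
    unfolding lin_coords_block by blast
  define G where "G = graded_part K b d"
  have G: "G n i = cvec.span ((\<lambda>k. b k i) ` {k \<in> K. d k = n})" for n i
    unfolding G_def graded_part_def by (intro arg_cong[of _ _ cvec.span]) auto
  define gens where "gens = {\<phi> \<in> rep_hom Q (rep_of V ?L) W.
     \<exists>k>0. \<forall>n i. \<phi> i ` (?L i \<inter> G n i) \<subseteq> q i ` G (n + k) i}"
  have hom_pos: "hom_pos Q V (graded_part K b d) ?L W q = cvec.span gens"
    by (simp add: hom_pos_def gens_def G_def)
  have "gens \<subseteq> ?h ` lin_coords S"
  proof
    fix \<phi> assume "\<phi> \<in> gens"
    then obtain n where \<phi>: "\<phi> \<in> rep_hom Q (rep_of V ?L) W" and n: "n > 0"
      "\<And>m i. \<phi> i ` (?L i \<inter> G m i) \<subseteq> q i ` G (m + n) i" by (auto simp: gens_def)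
    obtain x where x: "x \<in> lin_block S K K" "\<phi> = ?h x" using bij \<phi> by (auto simp: bij_betw_def)
    have "x p = 0" if "p \<notin> pos_index S" for p
    proof (rule ccontr)
      assume nz: "x p \<noteq> 0"
      obtain i k l where p: "p = (i, k, l)" by (metis prod_cases3)
      have ci: "(i, k, l) \<in> chart_index S" using lin_block_zero[OF x(1), of i k l] nz p by blast
      then have l: "l \<in> S i" "l \<in> S i \<inter> K" and k: "k \<in> K" "k \<in> T i - S i"
        using SK[of i] T_K by (auto simp: chart_index_def)
      have "b l i \<in> ?L i \<inter> G (d l) i"
        using l unfolding G coordinate_subspace[of i S, symmetric] by (auto intro: cvec.span_base)
      then obtain u where u: "u \<in> G (d l + n) i" "\<phi> i (b l i) = q i u" using n(2) by blast
      have "u \<in> sp V i" using u(1) span_sp[of "{k \<in> K. d k = d l + n}" i] by (auto simp: G)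
      then have "q i u = q i (\<Sum>m\<in>K. cd i m u *\<^sub>C b m i)" using expansion by simp
      then have "(\<Sum>m\<in>K. (x (i, m, l) - cd i m u) *\<^sub>C q i (b m i)) = 0"
        using u(2) block_hom_b[OF ctx l(2), of x] x(2)
        by (simp add: q_combination[OF ctx] cvec.scale_left_diff_distrib sum_subtractf)
      from q_independent[OF ctx this k] have "cd i k u \<noteq> 0" using nz p by simp
      \<comment> \<open>A nonzero matrix entry forces the degrees of its row and column to differ by
        exactly the degree \<open>n > 0\<close> of the homomorphism.\<close>
      then have "d k = d l + n" using cd_span[of "{k \<in> K. d k = d l + n}" u i k] u(1) k(1) by (auto simp: G)
      then show False using that ci n(1) by (simp add: p chart_index_def pos_index_def)
    qed
    then show "\<phi> \<in> ?h ` lin_coords S" using x lc by blast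
  qed
  moreover have "cvec.subspace (?h ` lin_coords S)"
  proof -
    interpret vp: vector_space_pair "scaleC :: complex \<Rightarrow> ('v \<times> 'k \<times> 'k \<Rightarrow> complex) \<Rightarrow> _"
      "scaleC :: complex \<Rightarrow> ('v \<Rightarrow> 'm \<Rightarrow> 'n) \<Rightarrow> _" by unfold_locales
    show ?thesis by (rule vp.linear_subspace_image[OF hlin subspace_lin_coords])
  qed
  ultimately have "cvec.span gens \<subseteq> ?h ` lin_coords S" by (rule cvec.span_minimal)
  moreover have "?h x \<in> cvec.span gens" if x: "x \<in> lin_coords S" for x
  proof -
    define D where "D = (\<lambda>(k, l). d k - d l) ` (K \<times> K) \<inter> {0<..}"
    \<comment> \<open>The homogeneous component of degree \<open>n\<close>. The linear equations
      relate only entries with the same \<open>k\<close> and \<open>l\<close>, so it satisfies them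
      too.\<close>
    define xn where "xn n = (\<lambda>(i, k, l). if d k - d l = n then x (i, k, l) else 0)" for n
    have finD: "finite D" using fin_K by (simp add: D_def)
    have x_pos: "x p = 0" if "p \<notin> pos_index S" for p using x that lc by blast
    have "x = (\<Sum>n\<in>D. xn n)"
    proof
      fix p :: "'v \<times> 'k \<times> 'k"
      obtain i k l where p: "p = (i, k, l)" by (metis prod_cases3)
      have ev: "Vector_Spaces.linear scaleC scaleC (\<lambda>x::'v \<times> 'k \<times> 'k \<Rightarrow> complex. x p)"
        by (rule linearI) (simp_all add: scaleC_fun)
      have "(\<Sum>n\<in>D. xn n) p = (\<Sum>n\<in>D. if n = d k - d l then x p else 0)"
        unfolding linearD(5)[OF ev] by (intro sum.cong) (auto simp: xn_def p)
      also have "\<dots> = x p"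
      proof (cases "p \<in> pos_index S")
        case True
        then have "k \<in> K" "l \<in> K" "d l < d k"
          using T_K S_K[OF cellsD(1)[OF S]] by (auto simp: p pos_index_def)
        then have "d k - d l \<in> D" by (auto simp: D_def)
        then show ?thesis using finD by simp
      next
        case False
        then have "x p = 0" by (rule x_pos)
        then show ?thesis by (simp only: if_cancel sum.neutral_const)
      qed
      finally show "x p = (\<Sum>n\<in>D. xn n) p" by simp
    qed
    then have "?h x = (\<Sum>n\<in>D. ?h (xn n))" using linearD(5)[OF hlin, of xn D] by simp
    moreover have "?h (xn n) \<in> gens" if n: "n \<in> D" for n
      unfolding gens_def
    proof (intro CollectI conjI exI[of _ n] allI)
      have "xn n \<in> lin_block S K K"
        using x lc unfolding lin_block_def xn_def by auto
      then show "?h (xn n) \<in> rep_hom Q (rep_of V ?L) W" using bij by (auto simp: bij_betw_def)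
      show "n > 0" using n by (simp add: D_def)
      fix m i
      show "?h (xn n) i ` (?L i \<inter> G m i) \<subseteq> q i ` G (m + n) i"
      proof safe
        fix v assume v: "v \<in> ?L i" "v \<in> G m i"
        define c where "c k = (\<Sum>l\<in>S i \<inter> K. cd i l v * xn n (i, k, l))" for k
        have "?h (xn n) i v = (\<Sum>l\<in>S i \<inter> K. \<Sum>k\<in>K. (cd i l v * xn n (i, k, l)) *\<^sub>C q i (b k i))"
          using v(1) by (simp add: block_hom_def src)
        also have "\<dots> = (\<Sum>k\<in>K. c k *\<^sub>C q i (b k i))"
          unfolding c_def cvec.scale_sum_left by (rule sum.swap)
        also have "\<dots> = q i (\<Sum>k\<in>K. c k *\<^sub>C b k i)" by (simp add: q_combination[OF ctx])
        finally have hq: "?h (xn n) i v = q i (\<Sum>k\<in>K. c k *\<^sub>C b k i)" .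
        have "c k *\<^sub>C b k i \<in> G (m + n) i" if k: "k \<in> K" for k
        proof (cases "d k = m + n")
          case True
          then show ?thesis unfolding G using k by (intro cvec.span_scale cvec.span_base) simp
        next
          case False
          have "cd i l v * xn n (i, k, l) = 0" if l: "l \<in> S i \<inter> K" for l
          proof (cases "d l = m")
            case True
            then show ?thesis using False by (simp add: xn_def)
          next
            case False
            then have "cd i l v = 0" using cd_span[of "{k \<in> K. d k = m}" v i l] v(2) l by (auto simp: G)
            then show ?thesis by simp
          qed
          then have "c k = 0" unfolding c_def by (rule sum.neutral[OF ballI])
          then show ?thesis by (simp add: G cvec.span_zero)
        qed
        then have "(\<Sum>k\<in>K. c k *\<^sub>C b k i) \<in> G (m + n) i" unfolding G by (rule cvec.span_sum)
        then show "?h (xn n) i v \<in> q i ` G (m + n) i" unfolding hq by (rule imageI)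
      qed
    qed
    ultimately show ?thesis by (simp add: cvec.span_sum cvec.span_base)
  qed
  ultimately have "?h ` lin_coords S = cvec.span gens" by blast
  moreover have "inj_on ?h (lin_coords S)"
    by (rule inj_on_subset[OF bij_betw_imp_inj_on[OF bij]]) (use lc in blast)
  ultimately have bij': "bij_betw ?h (lin_coords S) (hom_pos Q V (graded_part K b d) ?L W q)"
    unfolding hom_pos by (simp add: bij_betw_def)
  obtain B0 where "finite B0" "lin_coords S = cvec.span B0"
    using finite_support_subspace[OF finite_chart_index[OF cellsD(1)[OF S]] subspace_lin_coords, of S]
      lc pos_chart_index by blast
  then show ?thesis
    by (rule lift_iso_linear[OF _ _ _ bij']) (simp add: clinear_on_def linearD[OF hlin])
qed

end


section \<open>The decomposition into a projective and an injective part\<close>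

text \<open>Diagonal arrows and a diagonal torus preserve the span of any set of summands, and the
  same vectors, functionals and degrees serve for it. This transfers the whole theory of charts to P
  and to I.\<close>

lemma (in coordinate_rep) sub_coordinate_rep:
  assumes X: "X \<subseteq> K" and N: "\<And>i. N i = cvec.span ((\<lambda>k. b k i) ` X)"
  shows "coordinate_rep Q (rep_of V N) X b d cd \<alpha> t"
proof (rule coordinate_rep.intro)
  show "finite X" using X fin_K by (rule finite_subset)
  show "representation Q (rep_of V N)"
    unfolding representation_def
  proof (intro conjI allI impI ballI)
    show "\<exists>B. finite B \<and> sp (rep_of V N) i = cvec.span B" for i
      using \<open>finite X\<close> N by (auto simp: rep_of_def)
    show "sp (rep_of V N) i = {0}" if "i \<notin> verts Q" for i
    proof -
      have "N i \<subseteq> sp V i" unfolding N by (rule span_sp[OF X])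
      moreover have "sp V i = {0}" using that rep by (simp add: representation_def)
      ultimately show ?thesis using cvec.subspace_0[of "N i"] N by (auto simp: rep_of_def)
    qed
    fix a assume a: "a \<in> arcs Q"
    show "clinear_on (sp (rep_of V N) (tail Q a)) (act (rep_of V N) a)"
      using act_linear[OF a] span_sp[OF X, of "tail Q a"] by (auto simp: clinear_on_def rep_of_def N subset_iff)
    have "act V a v \<in> N (head Q a)" if v: "v \<in> N (tail Q a)" for v
    proof -
      have vs: "v \<in> sp V (tail Q a)" "\<forall>k\<in>K - X. cd (tail Q a) k v = 0"
        using v mem_span_iff[OF X] by (auto simp: N)
      then show ?thesis
        unfolding N mem_span_iff[OF X] using act_sp[OF a vs(1)] cd_act[OF a vs(1)] by auto
    qed
    then show "act (rep_of V N) a ` sp (rep_of V N) (tail Q a) \<subseteq> sp (rep_of V N) (head Q a)"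
      by (auto simp: rep_of_def)
  qed
  show "sp (rep_of V N) i = cvec.span ((\<lambda>k. b k i) ` X)" for i by (simp add: rep_of_def N)
  show "act (rep_of V N) a (b k (tail Q a)) = \<alpha> a k *\<^sub>C b k (head Q a)" if "a \<in> arcs Q" "k \<in> X" for a k
    using act_b[OF that(1)] that(2) X by (auto simp: rep_of_def)
  show "inj_on d X" using d_inj X by (rule inj_on_subset)
  show "t z i x = (\<Sum>k\<in>X. (z powi d k * cd i k x) *\<^sub>C b k i)" if "z \<noteq> 0" "x \<in> sp (rep_of V N) i" for z x i
  proof -
    have x: "x \<in> cvec.span ((\<lambda>k. b k i) ` X)" using that(2) by (simp add: rep_of_def N)
    then have "t z i x = (\<Sum>k\<in>K. (z powi d k * cd i k x) *\<^sub>C b k i)"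
      using that(1) span_sp[OF X] by (intro t_eq) auto
    also have "\<dots> = (\<Sum>k\<in>X. (z powi d k * cd i k x) *\<^sub>C b k i)"
      by (rule sum.mono_neutral_right) (use X fin_K cd_span[OF X x] in auto)
    finally show ?thesis .
  qed
qed (use fin_verts fin_arcs wf cd_lin cd_b alpha_nz X in \<open>auto simp: subset_iff\<close>)

text \<open>Extensions of one thin representation by another one, on the first two coordinates.\<close>

definition thin_ext ::
    "('v \<Rightarrow> bool) \<Rightarrow> ('v \<Rightarrow> bool) \<Rightarrow> ('a \<Rightarrow> complex) \<Rightarrow> ('a \<Rightarrow> complex) \<Rightarrow> ('a \<Rightarrow> complex)
      \<Rightarrow> ('v, 'a, nat \<Rightarrow> complex) qrep" where
  "thin_ext p q \<beta> \<gamma> f = \<lparr>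
     sp = (\<lambda>i. {x. (x 0 \<noteq> 0 \<longrightarrow> p i) \<and> (x 1 \<noteq> 0 \<longrightarrow> q i) \<and> (\<forall>n\<ge>2. x n = 0)}),
     act = (\<lambda>a x n. if n = 0 then \<beta> a * x 0 + f a * x 1 else if n = 1 then \<gamma> a * x 1 else 0)\<rparr>"

lemma sp_thin_ext:
  "x \<in> sp (thin_ext p q \<beta> \<gamma> f) i \<longleftrightarrow> (x 0 \<noteq> 0 \<longrightarrow> p i) \<and> (x 1 \<noteq> 0 \<longrightarrow> q i) \<and> (\<forall>n\<ge>2. x n = 0)"
  by (simp add: thin_ext_def)

lemma act_thin_ext:
  "act (thin_ext p q \<beta> \<gamma> f) a x =
     (\<lambda>n. if n = 0 then \<beta> a * x 0 + f a * x 1 else if n = 1 then \<gamma> a * x 1 else 0)"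
  by (simp add: thin_ext_def)

lemma thin_eqI:
  fixes x y :: "nat \<Rightarrow> complex"
  assumes "x 0 = y 0" "x 1 = y 1" "\<forall>n\<ge>2. x n = 0" "\<forall>n\<ge>2. y n = 0"
  shows "x = y"
proof
  fix n :: nat
  have "n = 0 \<or> n = 1 \<or> 2 \<le> n" by arith
  then show "x n = y n" by (elim disjE) (simp_all add: assms(1,2)[simplified] assms(3,4))
qed

lemma subspace_thin_ext: "cvec.subspace (sp (thin_ext p q \<beta> \<gamma> f) i)"
proof (rule cvec.subspaceI)
  show "0 \<in> sp (thin_ext p q \<beta> \<gamma> f) i" by (simp add: sp_thin_ext)
  show "x + y \<in> sp (thin_ext p q \<beta> \<gamma> f) i"
    if "x \<in> sp (thin_ext p q \<beta> \<gamma> f) i" "y \<in> sp (thin_ext p q \<beta> \<gamma> f) i" for x y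
    using that unfolding sp_thin_ext by (metis add.right_neutral plus_fun_apply)
  show "c *\<^sub>C x \<in> sp (thin_ext p q \<beta> \<gamma> f) i" if "x \<in> sp (thin_ext p q \<beta> \<gamma> f) i" for c x
    using that unfolding sp_thin_ext by (auto simp: scaleC_fun scaleC_complex)
qed

lemma representation_thin_ext:
  assumes "\<And>i. i \<notin> verts Q \<Longrightarrow> \<not> p i \<and> \<not> q i"
    and "\<And>a. a \<in> arcs Q \<Longrightarrow> \<beta> a \<noteq> 0 \<Longrightarrow> p (tail Q a) \<Longrightarrow> p (head Q a)"
    and "\<And>a. a \<in> arcs Q \<Longrightarrow> f a \<noteq> 0 \<Longrightarrow> q (tail Q a) \<Longrightarrow> p (head Q a)"
    and "\<And>a. a \<in> arcs Q \<Longrightarrow> \<gamma> a \<noteq> 0 \<Longrightarrow> q (tail Q a) \<Longrightarrow> q (head Q a)"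
  shows "representation Q (thin_ext p q \<beta> \<gamma> f)"
  unfolding representation_def
proof (intro conjI allI impI ballI)
  fix i
  show "\<exists>B. finite B \<and> sp (thin_ext p q \<beta> \<gamma> f) i = cvec.span B"
  proof (rule finite_support_subspace[OF _ subspace_thin_ext])
    show "finite {0, 1 :: nat}" by simp
    show "x n = 0" if "x \<in> sp (thin_ext p q \<beta> \<gamma> f) i" "n \<notin> {0, 1}" for x n
    proof -
      have "n \<ge> 2" using that(2) by auto
      then show ?thesis using that(1) unfolding sp_thin_ext by blast
    qed
  qed blast
  show "sp (thin_ext p q \<beta> \<gamma> f) i = {0}" if "i \<notin> verts Q"
  proof -
    have "x = 0" if "x \<in> sp (thin_ext p q \<beta> \<gamma> f) i" for x
      using that assms(1)[OF \<open>i \<notin> verts Q\<close>] unfolding sp_thin_ext by (intro thin_eqI) auto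
    moreover have "0 \<in> sp (thin_ext p q \<beta> \<gamma> f) i" by (simp add: sp_thin_ext)
    ultimately show ?thesis by auto
  qed
next
  fix a assume a: "a \<in> arcs Q"
  show "clinear_on (sp (thin_ext p q \<beta> \<gamma> f) (tail Q a)) (act (thin_ext p q \<beta> \<gamma> f) a)"
    unfolding clinear_on_def act_thin_ext
    by (intro conjI ballI allI HOL.ext) (simp_all add: scaleC_fun scaleC_complex algebra_simps)
  show "act (thin_ext p q \<beta> \<gamma> f) a ` sp (thin_ext p q \<beta> \<gamma> f) (tail Q a) \<subseteq> sp (thin_ext p q \<beta> \<gamma> f) (head Q a)"
  proof
    fix y assume "y \<in> act (thin_ext p q \<beta> \<gamma> f) a ` sp (thin_ext p q \<beta> \<gamma> f) (tail Q a)"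
    then obtain x where x: "x \<in> sp (thin_ext p q \<beta> \<gamma> f) (tail Q a)"
      and y: "y 0 = \<beta> a * x 0 + f a * x 1" "y 1 = \<gamma> a * x 1" "\<forall>n\<ge>2. y n = 0"
      by (auto simp: act_thin_ext)
    have "p (head Q a)" if "y 0 \<noteq> 0"
    proof -
      have "\<beta> a \<noteq> 0 \<and> x 0 \<noteq> 0 \<or> f a \<noteq> 0 \<and> x 1 \<noteq> 0" using that y(1) by auto
      then show ?thesis using x assms(2,3)[OF a] unfolding sp_thin_ext by blast
    qed
    moreover have "q (head Q a)" if "y 1 \<noteq> 0"
    proof -
      have "\<gamma> a \<noteq> 0 \<and> x 1 \<noteq> 0" using that y(2) by auto
      then show ?thesis using x assms(4)[OF a] unfolding sp_thin_ext by blast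
    qed
    ultimately show "y \<in> sp (thin_ext p q \<beta> \<gamma> f) (head Q a)" using y(3) unfolding sp_thin_ext by blast
  qed
qed

section \<open>Charts and cells of M compared with those of P and I\<close>

locale split_rep = coordinate_rep Q V K b d cd \<alpha> t
  for Q :: "('v, 'a) pre_digraph"
    and V :: "('v, 'a, 'm::complex_vector) qrep"
    and K :: "'k set"
    and b :: "'k \<Rightarrow> 'v \<Rightarrow> 'm"
    and d :: "'k \<Rightarrow> int"
    and cd :: "'v \<Rightarrow> 'k \<Rightarrow> 'm \<Rightarrow> complex"
    and \<alpha> :: "'a \<Rightarrow> 'k \<Rightarrow> complex"
    and t :: "complex \<Rightarrow> 'v \<Rightarrow> 'm \<Rightarrow> 'm" +
  fixes KP KI :: "'k set" and P I :: "'v \<Rightarrow> 'm set"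
  assumes K_split: "K = KP \<union> KI" and disj: "KP \<inter> KI = {}"
    and d_PI: "k \<in> KP \<Longrightarrow> l \<in> KI \<Longrightarrow> d k < d l"
    and P_eq: "P i = cvec.span ((\<lambda>k. b k i) ` KP)"
    and I_eq: "I i = cvec.span ((\<lambda>k. b k i) ` KI)"
    and P_projective: "projective Q (rep_of V P)"
    and I_injective: "injective Q (rep_of V I)"
begin

lemma KP_K: "KP \<subseteq> K" and KI_K: "KI \<subseteq> K" and K_iff: "k \<in> K \<longleftrightarrow> k \<in> KP \<or> k \<in> KI"
  by (auto simp: K_split)

sublocale GP: coordinate_rep Q "rep_of V P" KP b d cd \<alpha> t
  by (rule sub_coordinate_rep[OF KP_K P_eq])

sublocale GI: coordinate_rep Q "rep_of V I" KI b d cd \<alpha> t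
  by (rule sub_coordinate_rep[OF KI_K I_eq])

lemma T_P: "GP.T i = T i \<inter> KP" and T_I: "GI.T i = T i \<inter> KI"
  by (auto simp: GP.T_def GI.T_def T_def K_iff)

definition PS :: "('v \<Rightarrow> 'k set) \<Rightarrow> 'v \<Rightarrow> 'k set" where
  "PS S i = S i \<inter> KP"

definition IS :: "('v \<Rightarrow> 'k set) \<Rightarrow> 'v \<Rightarrow> 'k set" where
  "IS S i = S i \<inter> KI"

definition Px :: "('v \<times> 'k \<times> 'k \<Rightarrow> complex) \<Rightarrow> 'v \<times> 'k \<times> 'k \<Rightarrow> complex" where
  "Px x = (\<lambda>(i, k, l). if k \<in> KP \<and> l \<in> KP then x (i, k, l) else 0)"

definition Ix :: "('v \<times> 'k \<times> 'k \<Rightarrow> complex) \<Rightarrow> 'v \<times> 'k \<times> 'k \<Rightarrow> complex" where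
  "Ix x = (\<lambda>(i, k, l). if k \<in> KI \<and> l \<in> KI then x (i, k, l) else 0)"

lemma Px_0: "Px (\<lambda>_. 0) = (\<lambda>_. 0)" and Ix_0: "Ix (\<lambda>_. 0) = (\<lambda>_. 0)"
  by (auto simp: Px_def Ix_def)

text \<open>An entry from a summand of I to a summand of P has negative degree.\<close>

lemma pos_PI: "x \<in> cell_coords S \<Longrightarrow> k \<in> KP \<Longrightarrow> l \<in> KI \<Longrightarrow> x (i, k, l) = 0"
  using d_PI[of k l] by (intro cell_coords_pos) (auto simp: pos_index_def)

context
  fixes S :: "'v \<Rightarrow> 'k set" and e :: "'v \<Rightarrow> nat"
  assumes S: "S \<in> cells e"
begin

lemma S_split: "S i = PS S i \<union> IS S i" "PS S i \<inter> IS S i = {}"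
  using cellsD(1)[OF S, of i] T_K[of _ i] disj by (auto simp: PS_def IS_def K_iff subset_iff)

lemma finite_PS: "finite (PS S i)" and finite_IS: "finite (IS S i)"
  using finite_S[OF cellsD(1)[OF S]] by (auto simp: PS_def IS_def)

lemma card_PS: "card (PS S i) = e i - card (IS S i)"
  using card_Un_disjoint[OF finite_PS finite_IS S_split(2), of i] S_split(1)[of i] cellsD(2)[OF S, of i] by simp

lemma PS_cells: "PS S \<in> GP.cells (\<lambda>i. e i - card (IS S i))"
  using cellsD(1)[OF S] cellsD(3)[OF S] by (auto simp: GP.cells_def T_P card_PS) (auto simp: PS_def)

lemma IS_cells: "IS S \<in> GI.cells (\<lambda>i. card (IS S i))"
  using cellsD(1)[OF S] cellsD(3)[OF S] by (auto simp: GI.cells_def T_I) (auto simp: IS_def)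

text \<open>For \<open>k\<close> in \<open>KP\<close> the factor with indices \<open>k\<close> and
  \<open>m\<close> vanishes unless \<open>m\<close> is in \<open>KP\<close>, so the quadratic
  equations of this block involve no other entries.\<close>

lemma Px_coords:
  assumes x: "x \<in> cell_coords S"
  shows "Px x \<in> GP.cell_coords (PS S)"
  unfolding GP.cell_coords_def GP.cell_eqs_def
proof (intro CollectI conjI allI impI ballI)
  note x0 = cell_coords_pos[OF x]
  show "Px x p = 0" if "p \<notin> GP.pos_index (PS S)" for p
  proof (cases p)
    case (fields i k l)
    have "(i, k, l) \<in> pos_index S \<Longrightarrow> k \<in> KP \<Longrightarrow> l \<in> KP \<Longrightarrow> False"
      using that by (auto simp: fields pos_index_def GP.pos_index_def T_P PS_def)
    then show ?thesis using x0[of p] by (auto simp: fields Px_def)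
  qed
  fix a l k assume a: "a \<in> arcs Q" and l: "l \<in> PS S (tail Q a)"
    and k: "k \<in> GP.T (head Q a) - PS S (head Q a)"
  have l': "l \<in> S (tail Q a)" "l \<in> KP" and k': "k \<in> T (head Q a) - S (head Q a)" "k \<in> KP"
    using l k by (auto simp: PS_def T_P)
  have "\<alpha> a k * x (tail Q a, k, l) - \<alpha> a l * x (head Q a, k, l) =
      (\<Sum>m\<in>K. \<alpha> a m * x (head Q a, k, m) * x (tail Q a, m, l))"
    using x a l' k' by (simp add: cell_coords_def cell_eqs_def)
  also have "\<dots> = (\<Sum>m\<in>KP. \<alpha> a m * x (head Q a, k, m) * x (tail Q a, m, l))"
  proof (rule sum.mono_neutral_right)
    show "\<forall>m\<in>K - KP. \<alpha> a m * x (head Q a, k, m) * x (tail Q a, m, l) = 0"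
      using pos_PI[OF x k'(2)] by (auto simp: K_iff)
  qed (use fin_K KP_K in auto)
  finally show "\<alpha> a k * Px x (tail Q a, k, l) - \<alpha> a l * Px x (head Q a, k, l) =
      (\<Sum>m\<in>KP. \<alpha> a m * Px x (head Q a, k, m) * Px x (tail Q a, m, l))"
    using l'(2) k'(2) by (simp add: Px_def)
qed

text \<open>Dual to the block of P: for \<open>l\<close> in \<open>KI\<close> the factor with
  indices \<open>m\<close> and \<open>l\<close> vanishes unless \<open>m\<close> is in
  \<open>KI\<close>.\<close>

lemma Ix_coords:
  assumes x: "x \<in> cell_coords S"
  shows "Ix x \<in> GI.cell_coords (IS S)"
  unfolding GI.cell_coords_def GI.cell_eqs_def
proof (intro CollectI conjI allI impI ballI)
  note x0 = cell_coords_pos[OF x]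
  show "Ix x p = 0" if "p \<notin> GI.pos_index (IS S)" for p
  proof (cases p)
    case (fields i k l)
    have "(i, k, l) \<in> pos_index S \<Longrightarrow> k \<in> KI \<Longrightarrow> l \<in> KI \<Longrightarrow> False"
      using that by (auto simp: fields pos_index_def GI.pos_index_def T_I IS_def)
    then show ?thesis using x0[of p] by (auto simp: fields Ix_def)
  qed
  fix a l k assume a: "a \<in> arcs Q" and l: "l \<in> IS S (tail Q a)"
    and k: "k \<in> GI.T (head Q a) - IS S (head Q a)"
  have l': "l \<in> S (tail Q a)" "l \<in> KI" and k': "k \<in> T (head Q a) - S (head Q a)" "k \<in> KI"
    using l k by (auto simp: IS_def T_I)
  have "\<alpha> a k * x (tail Q a, k, l) - \<alpha> a l * x (head Q a, k, l) =
      (\<Sum>m\<in>K. \<alpha> a m * x (head Q a, k, m) * x (tail Q a, m, l))"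
    using x a l' k' by (simp add: cell_coords_def cell_eqs_def)
  also have "\<dots> = (\<Sum>m\<in>KI. \<alpha> a m * x (head Q a, k, m) * x (tail Q a, m, l))"
  proof (rule sum.mono_neutral_right)
    show "\<forall>m\<in>K - KI. \<alpha> a m * x (head Q a, k, m) * x (tail Q a, m, l) = 0"
      using pos_PI[OF x _ l'(2)] by (auto simp: K_iff)
  qed (use fin_K KI_K in auto)
  finally show "\<alpha> a k * Ix x (tail Q a, k, l) - \<alpha> a l * Ix x (head Q a, k, l) =
      (\<Sum>m\<in>KI. \<alpha> a m * Ix x (head Q a, k, m) * Ix x (tail Q a, m, l))"
    using l'(2) k'(2) by (simp add: Ix_def)
qed

lemma P_sp: "P i \<subseteq> sp V i" and I_sp: "I i \<subseteq> sp V i"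
  unfolding P_eq I_eq by (rule span_sp[OF KP_K], rule span_sp[OF KI_K])

lemma mem_I: "v \<in> I i \<longleftrightarrow> v \<in> sp V i \<and> (\<forall>k\<in>KP. cd i k v = 0)"
  unfolding I_eq mem_span_iff[OF KI_K] using disj by (auto simp: K_iff)

text \<open>On I the coordinates in \<open>KP\<close> are zero. The graph equations at
  \<open>k\<close> in \<open>KP\<close> become trivial by \<open>pos_PI\<close>, and the others
  retain only the pivots in \<open>KI\<close>.\<close>

lemma meet_chart:
  assumes x: "x \<in> cell_coords S"
  shows "meet (chart S x) I = GI.chart (IS S) (Ix x)"
proof (rule HOL.ext, rule Set.set_eqI)
  fix i v
  note S_T = cellsD(1)[OF S] and sx = cell_coords_supported[OF x]
  show "v \<in> meet (chart S x) I i \<longleftrightarrow> v \<in> GI.chart (IS S) (Ix x) i"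
  proof (cases "v \<in> I i")
    case True
    have 0: "cd i m v = 0" if "m \<in> KP" for m using True that mem_I by blast
    have vsp: "v \<in> sp V i" "v \<in> sp (rep_of V I) i" using True I_sp by (auto simp: rep_of_def)
    have sum: "(\<Sum>m\<in>S i. cd i m v * x (i, k, m)) = (\<Sum>m\<in>IS S i. cd i m v * x (i, k, m))" for k
      by (rule sum.mono_neutral_right) (use finite_S[OF S_T] S_split[of i] 0 in \<open>auto simp: PS_def\<close>)
    have P0: "cd i k v = (\<Sum>m\<in>IS S i. cd i m v * x (i, k, m))" if "k \<in> KP" for k
      using 0[OF that] pos_PI[OF x that] by (simp add: IS_def)
    have Ixx: "(\<Sum>m\<in>IS S i. cd i m v * Ix x (i, k, m)) = (\<Sum>m\<in>IS S i. cd i m v * x (i, k, m))" if "k \<in> KI" for k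
      by (rule sum.cong) (use that in \<open>auto simp: Ix_def IS_def\<close>)
    have "v \<in> meet (chart S x) I i \<longleftrightarrow> (\<forall>k\<in>T i - S i. cd i k v = (\<Sum>m\<in>IS S i. cd i m v * x (i, k, m)))"
      using mem_chart[OF S_T sx vsp(1)] True sum by (simp add: meet_def)
    also have "\<dots> \<longleftrightarrow> (\<forall>k\<in>GI.T i - IS S i. cd i k v = (\<Sum>m\<in>IS S i. cd i m v * Ix x (i, k, m)))"
      using P0 Ixx T_K[of _ i] by (fastforce simp: T_I IS_def K_iff)
    also have "\<dots> \<longleftrightarrow> v \<in> GI.chart (IS S) (Ix x) i"
      using GI.mem_chart[OF GI.cellsD(1)[OF IS_cells] GI.cell_coords_supported[OF Ix_coords[OF x]] vsp(2)] by simp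
    finally show ?thesis .
  next
    case False
    then show ?thesis
      using GI.chart_sp[OF GI.cellsD(1)[OF IS_cells], of "Ix x" i] by (auto simp: meet_def rep_of_def)
  qed
qed

text \<open>The graph equations at \<open>k\<close> in \<open>KP\<close> involve only pivots in
  \<open>KP\<close>, so they are not affected by adding an element of I.\<close>

lemma proj_chart:
  assumes x: "x \<in> cell_coords S"
  shows "proj_along P I (chart S x) = GP.chart (PS S) (Px x)"
proof (rule HOL.ext, rule Set.set_eqI)
  fix i v
  note S_T = cellsD(1)[OF S] and sx = cell_coords_supported[OF x]
  show "v \<in> proj_along P I (chart S x) i \<longleftrightarrow> v \<in> GP.chart (PS S) (Px x) i"
  proof (cases "v \<in> P i")
    case True
    have vsp: "v \<in> sp V i" "v \<in> sp (rep_of V P) i" using True P_sp by (auto simp: rep_of_def)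
    have PT: "k \<in> GP.T i - PS S i \<longleftrightarrow> k \<in> T i - S i \<and> k \<in> KP" for k by (auto simp: T_P PS_def)
    have sum: "(\<Sum>m\<in>S i. c m * x (i, k, m)) = (\<Sum>m\<in>PS S i. c m * Px x (i, k, m))" if "k \<in> KP" for k and c :: "'k \<Rightarrow> complex"
    proof -
      have "(\<Sum>m\<in>S i. c m * x (i, k, m)) = (\<Sum>m\<in>PS S i. c m * x (i, k, m))"
        by (rule sum.mono_neutral_right)
          (use finite_S[OF S_T] S_split[of i] pos_PI[OF x that] in \<open>auto simp: IS_def\<close>)
      also have "\<dots> = (\<Sum>m\<in>PS S i. c m * Px x (i, k, m))"
        by (rule sum.cong) (use that in \<open>auto simp: Px_def PS_def\<close>)
      finally show ?thesis .
    qed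
    note memP = GP.mem_chart[OF GP.cellsD(1)[OF PS_cells] GP.cell_coords_supported[OF Px_coords[OF x]] vsp(2)]
    show ?thesis
    proof
      assume "v \<in> proj_along P I (chart S x) i"
      then obtain y where y: "y \<in> I i" "v + y \<in> chart S x i" by (auto simp: proj_along_def)
      have vy: "cd i m (v + y) = cd i m v" if "m \<in> KP" for m using y(1) that mem_I by (simp add: cdD(1))
      have "cd i k v = (\<Sum>m\<in>PS S i. cd i m v * Px x (i, k, m))" if k: "k \<in> T i - S i" "k \<in> KP" for k
      proof -
        have "v + y \<in> sp V i" using y(2) chart_sp[OF S_T] by blast
        then have "cd i k (v + y) = (\<Sum>m\<in>S i. cd i m (v + y) * x (i, k, m))"
          using mem_chart[OF S_T sx] y(2) k(1) by blast
        also have "\<dots> = (\<Sum>m\<in>PS S i. cd i m (v + y) * Px x (i, k, m))" by (rule sum[OF k(2)])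
        also have "\<dots> = (\<Sum>m\<in>PS S i. cd i m v * Px x (i, k, m))"
          by (rule sum.cong) (simp_all add: vy PS_def)
        finally show ?thesis using vy[OF k(2)] by simp
      qed
      then show "v \<in> GP.chart (PS S) (Px x) i" unfolding memP Ball_def PT by blast
    next
      assume vP: "v \<in> GP.chart (PS S) (Px x) i"
      \<comment> \<open>The vector of the graph with the pivot coordinates of \<open>v\<close>; it
        agrees with \<open>v\<close> in all coordinates of \<open>KP\<close>, hence differs from
        \<open>v\<close> by an element of I.\<close>
      let ?w = "\<Sum>m\<in>S i. cd i m v *\<^sub>C chartvec x i m"
      have w: "?w \<in> chart S x i" unfolding chart_def by (intro cvec.span_sum cvec.span_scale cvec.span_base) auto
      have wsp: "?w \<in> sp V i" using w chart_sp[OF S_T] by blast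
      have "cd i k (?w - v) = 0" if k: "k \<in> KP" for k
      proof (cases "k \<in> T i")
        case kT: True
        show ?thesis
        proof (cases "k \<in> S i")
          case True
          then show ?thesis using cd_chart_combination_S[OF S_T sx True] by (simp add: cdD(4))
        next
          case False
          have "cd i k ?w = (\<Sum>m\<in>PS S i. cd i m v * Px x (i, k, m))"
            using cd_chart_combination[OF S_T sx, of k i "\<lambda>m. cd i m v"] kT False sum[OF k] by simp
          also have "\<dots> = cd i k v" using vP kT False k unfolding memP Ball_def PT by simp
          finally show ?thesis by (simp add: cdD(4))
        qed
      next
        case False
        then show ?thesis using cd_outside[of k i] wsp vsp(1) k KP_K by (auto simp: cdD(4))
      qed
      then have "?w - v \<in> I i"
        using mem_I wsp vsp(1) by (simp add: cvec.subspace_diff[OF subspace_sp])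
      moreover have "v + (?w - v) \<in> chart S x i" using w by simp
      ultimately show "v \<in> proj_along P I (chart S x) i" using True unfolding proj_along_def by blast
    qed
  next
    case False
    then show ?thesis
      using GP.chart_sp[OF GP.cellsD(1)[OF PS_cells], of "Px x" i] by (auto simp: proj_along_def rep_of_def)
  qed
qed

lemma dimv_meet_chart: "x \<in> cell_coords S \<Longrightarrow> dimv (meet (chart S x) I) = (\<lambda>i. card (IS S i))"
  using GI.dim_chart[OF GI.cellsD(1)[OF IS_cells] GI.cell_coords_supported[OF Ix_coords]]
  by (simp add: meet_chart dimv_def)

lemma dimv_proj_chart:
  "x \<in> cell_coords S \<Longrightarrow> dimv (proj_along P I (chart S x)) = (\<lambda>i. e i - card (IS S i))"
  using GP.dim_chart[OF GP.cellsD(1)[OF PS_cells] GP.cell_coords_supported[OF Px_coords]]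
  by (simp add: proj_chart dimv_def card_PS)

end

text \<open>For the inclusion from right to left, \<open>N\<close> lies in some cell
  \<open>S'\<close>, and its intersection with I and projection to P lie in the cells of
  \<open>IS S'\<close> and \<open>PS S'\<close>. Uniqueness of cells in the two smaller
  Grassmannians gives both parts of \<open>S\<close>, hence \<open>S' = S\<close>.\<close>

lemma attracting_set_stratum:
  assumes S: "S \<in> cells e"
  shows "attracting_set Q V e t (chart S (\<lambda>_. 0)) =
     {N \<in> stratum Q V P I e (\<lambda>i. card (IS S i)). zeta P I N \<in>
        attracting_set Q (rep_of V I) (\<lambda>i. card (IS S i)) t (GI.chart (IS S) (\<lambda>_. 0)) \<times>
        attracting_set Q (rep_of V P) (\<lambda>i. e i - card (IS S i)) t (GP.chart (PS S) (\<lambda>_. 0))}"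
  unfolding attracting_set_cell[OF S] GI.attracting_set_cell[OF IS_cells[OF S]] GP.attracting_set_cell[OF PS_cells[OF S]]
proof (intro equalityI subsetI)
  fix N assume "N \<in> chart S ` cell_coords S"
  then obtain x where x: "x \<in> cell_coords S" "N = chart S x" by blast
  then show "N \<in> {N \<in> stratum Q V P I e (\<lambda>i. card (IS S i)). zeta P I N \<in>
      GI.chart (IS S) ` GI.cell_coords (IS S) \<times> GP.chart (PS S) ` GP.cell_coords (PS S)}"
    using chart_quiver_grass[OF S x(1)] dimv_meet_chart[OF S x(1)] dimv_proj_chart[OF S x(1)]
      meet_chart[OF S x(1)] proj_chart[OF S x(1)] Ix_coords[OF S x(1)] Px_coords[OF S x(1)]
    by (auto simp: stratum_def zeta_def)
next
  fix N assume N: "N \<in> {N \<in> stratum Q V P I e (\<lambda>i. card (IS S i)). zeta P I N \<in>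
      GI.chart (IS S) ` GI.cell_coords (IS S) \<times> GP.chart (PS S) ` GP.cell_coords (PS S)}"
  then have "N \<in> quiver_grass Q V e" by (simp add: stratum_def)
  then obtain S' x where S': "S' \<in> cells e" and x: "x \<in> cell_coords S'" and Nx: "N = chart S' x"
    by (rule ex_cell)
  obtain y z where y: "y \<in> GI.cell_coords (IS S)" "meet N I = GI.chart (IS S) y"
    and z: "z \<in> GP.cell_coords (PS S)" "proj_along P I N = GP.chart (PS S) z"
    using N by (auto simp: zeta_def)
  \<comment> \<open>The stratum fixes the dimension vectors, which puts the two candidate cells into
    the same Grassmannian.\<close>
  have card: "card (IS S' i) = card (IS S i)" "e i - card (IS S' i) = e i - card (IS S i)" for i
    using dimv_meet_chart[OF S' x] dimv_proj_chart[OF S' x] N Nx by (auto simp: stratum_def fun_eq_iff)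
  have "IS S' = IS S"
    by (rule GI.chart_cell_unique[OF _ Ix_coords[OF S' x] IS_cells[OF S] y(1)])
      (use IS_cells[OF S'] card meet_chart[OF S' x] Nx y(2) in auto)
  moreover have "PS S' = PS S"
    by (rule GP.chart_cell_unique[OF _ Px_coords[OF S' x] PS_cells[OF S] z(1)])
      (use PS_cells[OF S'] card proj_chart[OF S' x] Nx z(2) in auto)
  ultimately have "S' = S"
    using S_split(1)[OF S] S_split(1)[OF S'] by (auto simp: fun_eq_iff)
  then show "N \<in> chart S ` cell_coords S" using Nx x by blast
qed

section \<open>Vanishing of the positive extensions and splitting of the linear coordinates\<close>

context
  fixes S :: "'v \<Rightarrow> 'k set" and e :: "'v \<Rightarrow> nat"
  assumes S: "S \<in> cells e"
begin

text \<open>Split the extension of the summand \<open>l\<close> of \<open>P\<close> by the contribution of \<open>k\<close> to \<open>M/L\<close>; then restrict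
  to \<open>L\<close>.\<close>

lemma ext_solution_P:
  assumes l: "l \<in> KP" and k: "k \<in> K"
  shows "\<exists>y::'v \<Rightarrow> complex. (\<forall>i. y i \<noteq> 0 \<longrightarrow> (i, k, l) \<in> chart_index S) \<and>
     (\<forall>a\<in>arcs Q. l \<in> S (tail Q a) \<and> k \<in> T (head Q a) - S (head Q a) \<longrightarrow>
        \<alpha> a k * y (tail Q a) - \<alpha> a l * y (head Q a) = f a)"
proof -
  have lK: "l \<in> K" using l KP_K by blast
  define p where "p i \<longleftrightarrow> k \<in> T i - S i" for i
  \<comment> \<open>The whole summand \<open>l\<close> of P and not only its part in L: projectivity
    is available for the former.\<close>
  define q where "q i \<longleftrightarrow> l \<in> T i" for i
  define \<beta> where "\<beta> a = (if p (head Q a) then \<alpha> a k else 0)" for a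
  define \<gamma> where "\<gamma> a = \<alpha> a l" for a
  \<comment> \<open>The cocycle is extended over the summand by the values of \<open>f\<close>, cut
    off where the target is zero so that \<open>X\<close> is a representation.\<close>
  define fa where "fa a = (if p (head Q a) then f a else 0)" for a
  define X where "X = thin_ext p q \<beta> \<gamma> fa"
  define Y where "Y = thin_ext (\<lambda>_. False) q (\<lambda>_. 0) \<gamma> (\<lambda>_. 0)"
  define g where "g i x = (if x \<in> sp X i then (\<lambda>n::nat. if n = 1 then x 1 else 0) else 0)" for i and x :: "nat \<Rightarrow> complex"
  define \<phi> where "\<phi> i v = (if v \<in> P i then (\<lambda>n::nat. if n = 1 then cd i l v else 0) else 0)" for i v
  have \<gamma>q: "a \<in> arcs Q \<Longrightarrow> \<gamma> a \<noteq> 0 \<Longrightarrow> q (head Q a)" for a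
    using alpha_T[OF _ lK] by (auto simp: \<gamma>_def q_def)
  have pq: "\<not> p i \<and> \<not> q i" if "i \<notin> verts Q" for i using T_empty[OF that] by (auto simp: p_def q_def)
  have X: "representation Q X" unfolding X_def
    by (rule representation_thin_ext) (use pq \<gamma>q in \<open>auto simp: \<beta>_def fa_def split: if_splits\<close>)
  have Y: "representation Q Y" unfolding Y_def
    by (rule representation_thin_ext) (use pq \<gamma>q in auto)
  have spX: "x \<in> sp X i \<longleftrightarrow> (x 0 \<noteq> 0 \<longrightarrow> p i) \<and> (x 1 \<noteq> 0 \<longrightarrow> q i) \<and> (\<forall>n\<ge>2. x n = 0)" for x i
    unfolding X_def by (rule sp_thin_ext)
  have spY: "x \<in> sp Y i \<longleftrightarrow> (x 0 \<noteq> 0 \<longrightarrow> False) \<and> (x 1 \<noteq> 0 \<longrightarrow> q i) \<and> (\<forall>n\<ge>2. x n = 0)" for x i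
    unfolding Y_def by (rule sp_thin_ext)
  have actX: "act X a x = (\<lambda>n. if n = 0 then \<beta> a * x 0 + fa a * x 1 else if n = 1 then \<gamma> a * x 1 else 0)" for a x
    unfolding X_def by (rule act_thin_ext)
  have actY: "act Y a x = (\<lambda>n. if n = 0 then 0 * x 0 + 0 * x 1 else if n = 1 then \<gamma> a * x 1 else 0)" for a x
    unfolding Y_def by (rule act_thin_ext)
  have subX: "cvec.subspace (sp X i)" for i unfolding X_def by (rule subspace_thin_ext)
  have actX_sp: "act X a x \<in> sp X (head Q a)" if "a \<in> arcs Q" "x \<in> sp X (tail Q a)" for a x
    using X that unfolding representation_def by blast
  have g: "g \<in> rep_hom Q X Y"
    unfolding rep_hom_def
  proof (intro CollectI conjI allI impI ballI)
    show "clinear_on (sp X i) (g i)" for i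
      using cvec.subspace_add[OF subX] cvec.subspace_scale[OF subX]
      by (auto simp: clinear_on_def g_def fun_eq_iff scaleC_fun scaleC_complex)
    show "g i ` sp X i \<subseteq> sp Y i" for i by (auto simp: g_def spX spY)
    show "g i x = 0" if "x \<notin> sp X i" for i x using that by (simp add: g_def)
    show "g (head Q a) (act X a x) = act Y a (g (tail Q a) x)" if "a \<in> arcs Q" "x \<in> sp X (tail Q a)" for a x
      using that actX_sp[OF that] by (simp add: g_def actX actY fun_eq_iff)
  qed
  have g_surj: "g i ` sp X i = sp Y i" for i
  proof
    show "g i ` sp X i \<subseteq> sp Y i" using g by (auto simp: rep_hom_def)
    show "sp Y i \<subseteq> g i ` sp X i"
    proof
      fix y assume y: "y \<in> sp Y i"
      then have "y \<in> sp X i" unfolding spX spY by blast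
      moreover have "g i y = y"
        using y \<open>y \<in> sp X i\<close> by (intro thin_eqI) (auto simp: g_def spY)
      ultimately show "y \<in> g i ` sp X i" by (metis imageI)
    qed
  qed
  have Psub: "cvec.subspace (P i)" for i by (simp add: P_eq)
  have \<phi>: "\<phi> \<in> rep_hom Q (rep_of V P) Y"
    unfolding rep_hom_def
  proof (intro CollectI conjI allI impI ballI)
    show "clinear_on (sp (rep_of V P) i) (\<phi> i)" for i
      using cvec.subspace_add[OF Psub] cvec.subspace_scale[OF Psub]
      by (auto simp: clinear_on_def \<phi>_def rep_of_def fun_eq_iff cdD scaleC_fun scaleC_complex)
    have "q i" if "v \<in> P i" "cd i l v \<noteq> 0" for i v
      using cd_outside[OF lK, of i v] that P_sp[OF S] by (auto simp: q_def)
    then show "\<phi> i ` sp (rep_of V P) i \<subseteq> sp Y i" for i by (auto simp: \<phi>_def spY rep_of_def)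
    show "\<phi> i v = 0" if "v \<notin> sp (rep_of V P) i" for i v using that by (auto simp: \<phi>_def rep_of_def)
    show "\<phi> (head Q a) (act (rep_of V P) a v) = act Y a (\<phi> (tail Q a) v)"
      if a: "a \<in> arcs Q" and v: "v \<in> sp (rep_of V P) (tail Q a)" for a v
      using GP.act_sp[OF a v] GP.cd_act[OF a v l] v
      by (auto simp: \<phi>_def actY fun_eq_iff rep_of_def \<gamma>_def)
  qed
  obtain h where h: "h \<in> rep_hom Q (rep_of V P) X" and gh: "\<And>i v. v \<in> P i \<Longrightarrow> g i (h i v) = \<phi> i v"
    using P_projective[unfolded projective_def, rule_format, of X Y g \<phi>] X Y g g_surj \<phi>
    by (auto simp: rep_of_def)
  \<comment> \<open>The lift of the generator. Its second coordinate is 1 and its first coordinate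
    measures how far the splitting deviates from the coordinate section.\<close>
  define H where "H i = h i (b l i)" for i
  have bP: "b l i \<in> P i" for i using l by (auto simp: P_eq intro: cvec.span_base)
  have HX: "H i \<in> sp X i" for i using h bP unfolding H_def rep_hom_def by (auto simp: rep_of_def)
  have H1: "H i 1 = (if q i then 1 else 0)" for i
  proof -
    have "g i (H i) 1 = \<phi> i (b l i) 1" using gh[OF bP] by (simp add: H_def)
    then show ?thesis using HX[of i] bP[of i] cd_b[OF lK lK, of i] lK by (simp add: g_def \<phi>_def q_def T_def)
  qed
  have comm: "\<alpha> a l * H (head Q a) 0 = \<beta> a * H (tail Q a) 0 + fa a * H (tail Q a) 1" if a: "a \<in> arcs Q" for a
  proof -
    have hl: "clinear_on (P i) (h i)" for i using h by (simp add: rep_hom_def rep_of_def)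
    have "h (head Q a) (act V a (b l (tail Q a))) = act X a (H (tail Q a))"
      using h a bP unfolding H_def rep_hom_def by (auto simp: rep_of_def)
    moreover have "h (head Q a) (act V a (b l (tail Q a))) = \<alpha> a l *\<^sub>C H (head Q a)"
      using clinear_onD(2)[OF hl bP] by (simp add: act_b[OF a lK] H_def)
    ultimately have "(\<alpha> a l *\<^sub>C H (head Q a)) 0 = act X a (H (tail Q a)) 0" by simp
    then show ?thesis by (simp add: actX scaleC_fun scaleC_complex)
  qed
  \<comment> \<open>The sign comes from solving \<open>comm\<close> for \<open>f a\<close>. Cutting
    off to the chart loses nothing in the equations concerned: at the tail the cut off value is
    already zero, and at the head either \<open>l\<close> stays in \<open>S\<close> or
    \<open>\<alpha> a l\<close> is zero.\<close>
  define y where "y i = (if (i, k, l) \<in> chart_index S then - H i 0 else 0)" for i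
  have "\<alpha> a k * y (tail Q a) - \<alpha> a l * y (head Q a) = f a"
    if a: "a \<in> arcs Q" and kl: "l \<in> S (tail Q a) \<and> k \<in> T (head Q a) - S (head Q a)" for a
  proof -
    have ph: "p (head Q a)" using kl by (simp add: p_def)
    have "q (tail Q a)" using kl cellsD(1)[OF S] by (auto simp: q_def)
    then have "\<alpha> a l * H (head Q a) 0 = \<alpha> a k * H (tail Q a) 0 + f a"
      using comm[OF a] ph H1[of "tail Q a"] by (simp add: \<beta>_def fa_def)
    moreover have "y (tail Q a) = - H (tail Q a) 0"
      using HX[of "tail Q a"] kl by (auto simp: y_def chart_index_def spX p_def)
    moreover have "\<alpha> a l * y (head Q a) = - (\<alpha> a l * H (head Q a) 0)"
    proof (cases "\<alpha> a l = 0")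
      case False
      then have "l \<in> S (head Q a)" using cellsD(3)[OF S a] kl by blast
      then show ?thesis using kl by (simp add: y_def chart_index_def)
    qed simp
    ultimately have "\<alpha> a k * y (tail Q a) - \<alpha> a l * y (head Q a) =
        \<alpha> a k * - H (tail Q a) 0 - - (\<alpha> a k * H (tail Q a) 0 + f a)"
      by (simp only:)
    then show ?thesis by simp
  qed
  then show ?thesis by (intro exI[of _ y]) (auto simp: y_def)
qed

text \<open>Split the extension of the contribution of \<open>l\<close> to \<open>L\<close> by the summand \<open>k\<close> of \<open>I\<close>; then project
  to \<open>M/L\<close>.\<close>

lemma ext_solution_I:
  assumes k: "k \<in> KI" and l: "l \<in> K"
  shows "\<exists>y::'v \<Rightarrow> complex. (\<forall>i. y i \<noteq> 0 \<longrightarrow> (i, k, l) \<in> chart_index S) \<and>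
     (\<forall>a\<in>arcs Q. l \<in> S (tail Q a) \<and> k \<in> T (head Q a) - S (head Q a) \<longrightarrow>
        \<alpha> a k * y (tail Q a) - \<alpha> a l * y (head Q a) = f a)"
proof -
  have kK: "k \<in> K" using k KI_K by blast
  \<comment> \<open>The whole summand \<open>k\<close> of I and not only its image in M/L, because
    injectivity is available for the former; the quotient term of the extension is the part of L in
    the summand \<open>l\<close>.\<close>
  define p where "p i \<longleftrightarrow> k \<in> T i" for i
  define q where "q i \<longleftrightarrow> l \<in> S i" for i
  define \<beta> where "\<beta> a = \<alpha> a k" for a
  define \<gamma> where "\<gamma> a = \<alpha> a l" for a
  define fa where "fa a = (if p (head Q a) then f a else 0)" for a
  define X where "X = thin_ext p (\<lambda>_. False) \<beta> (\<lambda>_. 0) (\<lambda>_. 0)"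
  define Y where "Y = thin_ext p q \<beta> \<gamma> fa"
  define g where "g i x = (if x \<in> sp X i then x else 0)" for i and x :: "nat \<Rightarrow> complex"
  define \<phi> where "\<phi> i x = (if x \<in> sp X i then x 0 *\<^sub>C b k i else 0)" for i and x :: "nat \<Rightarrow> complex"
  have \<beta>p: "a \<in> arcs Q \<Longrightarrow> \<beta> a \<noteq> 0 \<Longrightarrow> p (head Q a)" for a
    using alpha_T[OF _ kK] by (auto simp: \<beta>_def p_def)
  have \<gamma>q: "a \<in> arcs Q \<Longrightarrow> \<gamma> a \<noteq> 0 \<Longrightarrow> q (tail Q a) \<Longrightarrow> q (head Q a)" for a
    using cellsD(3)[OF S] by (auto simp: \<gamma>_def q_def)
  have pq: "\<not> p i \<and> \<not> q i" if "i \<notin> verts Q" for i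
    using T_empty[OF that] cellsD(1)[OF S, of i] by (auto simp: p_def q_def)
  have X: "representation Q X" unfolding X_def
    by (rule representation_thin_ext) (use pq \<beta>p in auto)
  have Y: "representation Q Y" unfolding Y_def
    by (rule representation_thin_ext) (use pq \<beta>p \<gamma>q in \<open>auto simp: fa_def split: if_splits\<close>)
  have spX: "x \<in> sp X i \<longleftrightarrow> (x 0 \<noteq> 0 \<longrightarrow> p i) \<and> (x 1 \<noteq> 0 \<longrightarrow> False) \<and> (\<forall>n\<ge>2. x n = 0)" for x i
    unfolding X_def by (rule sp_thin_ext)
  have spY: "x \<in> sp Y i \<longleftrightarrow> (x 0 \<noteq> 0 \<longrightarrow> p i) \<and> (x 1 \<noteq> 0 \<longrightarrow> q i) \<and> (\<forall>n\<ge>2. x n = 0)" for x i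
    unfolding Y_def by (rule sp_thin_ext)
  have actX: "act X a x = (\<lambda>n. if n = 0 then \<beta> a * x 0 + 0 * x 1 else if n = 1 then 0 * x 1 else 0)" for a x
    unfolding X_def by (rule act_thin_ext)
  have actY: "act Y a x = (\<lambda>n. if n = 0 then \<beta> a * x 0 + fa a * x 1 else if n = 1 then \<gamma> a * x 1 else 0)" for a x
    unfolding Y_def by (rule act_thin_ext)
  have subX: "cvec.subspace (sp X i)" for i unfolding X_def by (rule subspace_thin_ext)
  have subY: "cvec.subspace (sp Y i)" for i unfolding Y_def by (rule subspace_thin_ext)
  have actX_sp: "act X a x \<in> sp X (head Q a)" if "a \<in> arcs Q" "x \<in> sp X (tail Q a)" for a x
    using X that unfolding representation_def by blast
  have g: "g \<in> rep_hom Q X Y"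
    unfolding rep_hom_def
  proof (intro CollectI conjI allI impI ballI)
    show "clinear_on (sp X i) (g i)" for i
      using cvec.subspace_add[OF subX] cvec.subspace_scale[OF subX] by (auto simp: clinear_on_def g_def)
    show "g i ` sp X i \<subseteq> sp Y i" for i by (auto simp: g_def spX spY)
    show "g i x = 0" if "x \<notin> sp X i" for i x using that by (simp add: g_def)
    show "g (head Q a) (act X a x) = act Y a (g (tail Q a) x)" if "a \<in> arcs Q" "x \<in> sp X (tail Q a)" for a x
    proof -
      have "x 1 = 0" using that(2) unfolding spX by blast
      then have "act X a x = act Y a x" by (simp add: actX actY fun_eq_iff)
      then show ?thesis using that actX_sp[OF that] by (simp add: g_def)
    qed
  qed
  have bI: "b k i \<in> I i" for i using k by (auto simp: I_eq intro: cvec.span_base)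
  have Isub: "cvec.subspace (I i)" for i by (simp add: I_eq)
  have \<phi>: "\<phi> \<in> rep_hom Q X (rep_of V I)"
    unfolding rep_hom_def
  proof (intro CollectI conjI allI impI ballI)
    show "clinear_on (sp X i) (\<phi> i)" for i
      using cvec.subspace_add[OF subX] cvec.subspace_scale[OF subX]
      by (auto simp: clinear_on_def \<phi>_def scaleC_add_left scaleC_scaleC scaleC_fun scaleC_complex)
    show "\<phi> i ` sp X i \<subseteq> sp (rep_of V I) i" for i
      using bI cvec.subspace_scale[OF Isub] by (auto simp: \<phi>_def rep_of_def)
    show "\<phi> i x = 0" if "x \<notin> sp X i" for i x using that by (simp add: \<phi>_def)
    show "\<phi> (head Q a) (act X a x) = act (rep_of V I) a (\<phi> (tail Q a) x)"
      if a: "a \<in> arcs Q" and x: "x \<in> sp X (tail Q a)" for a x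
      using actX_sp[OF a x] x clinear_onD(2)[OF act_linear[OF a] b_sp[OF kK], of "x 0"] act_b[OF a kK]
      by (simp add: \<phi>_def rep_of_def actX \<beta>_def scaleC_scaleC mult.commute)
  qed
  have inj: "inj_on (g i) (sp X i)" for i by (auto simp: inj_on_def g_def)
  obtain h where h: "h \<in> rep_hom Q Y (rep_of V I)" and hg: "\<And>i x. x \<in> sp X i \<Longrightarrow> h i (g i x) = \<phi> i x"
    using I_injective[unfolded injective_def, rule_format, of X Y g \<phi>] X Y g inj \<phi> by blast
  have hl: "clinear_on (sp Y i) (h i)" and hI: "x \<in> sp Y i \<Longrightarrow> h i x \<in> I i"
    and hc: "a \<in> arcs Q \<Longrightarrow> x \<in> sp Y (tail Q a) \<Longrightarrow> h (head Q a) (act Y a x) = act V a (h (tail Q a) x)" for i x a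
    using h by (auto simp: rep_hom_def rep_of_def)
  \<comment> \<open>\<open>e1\<close> lifts the generator of the quotient and \<open>e0\<close>
    generates the subrepresentation. The extension \<open>h\<close> to \<open>Y\<close> sends
    \<open>e0\<close> to \<open>b k\<close>, so the \<open>k\<close>-coordinate of
    \<open>h i e1\<close> solves the equation.\<close>
  define e1 :: "nat \<Rightarrow> complex" where "e1 n = (if n = 1 then 1 else 0)" for n
  define e0 :: "nat \<Rightarrow> complex" where "e0 n = (if n = 0 then 1 else 0)" for n
  define H where "H i = cd i k (h i e1)" for i
  have e1Y: "e1 \<in> sp Y i" if "l \<in> S i" for i using that by (auto simp: spY e1_def q_def)
  have comm: "f a + \<alpha> a l * H (head Q a) = \<alpha> a k * H (tail Q a)"
    if a: "a \<in> arcs Q" and lS: "l \<in> S (tail Q a)" and kT: "k \<in> T (head Q a)" for a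
  proof -
    have ph: "p (head Q a)" using kT by (simp add: p_def)
    have e0X: "e0 \<in> sp X (head Q a)" and e0Y: "e0 \<in> sp Y (head Q a)"
      using ph by (auto simp: spX spY e0_def)
    have act: "act Y a e1 = f a *\<^sub>C e0 + \<alpha> a l *\<^sub>C e1"
      using ph by (auto simp: actY fun_eq_iff e0_def e1_def scaleC_fun scaleC_complex fa_def \<gamma>_def)
    have "h (head Q a) (\<alpha> a l *\<^sub>C e1) = \<alpha> a l *\<^sub>C h (head Q a) e1 \<and> \<alpha> a l *\<^sub>C e1 \<in> sp Y (head Q a)"
    proof (cases "\<alpha> a l = 0")
      case True
      have "h (head Q a) (0 *\<^sub>C 0) = 0 *\<^sub>C h (head Q a) 0"
        by (rule clinear_onD(2)[OF hl cvec.subspace_0[OF subY]])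
      then show ?thesis using True cvec.subspace_0[OF subY] by simp
    next
      case False
      then have "l \<in> S (head Q a)" using cellsD(3)[OF S a lS] by blast
      then show ?thesis using clinear_onD(2)[OF hl e1Y] cvec.subspace_scale[OF subY e1Y] by blast
    qed
    then have "h (head Q a) (act Y a e1) = f a *\<^sub>C h (head Q a) e0 + \<alpha> a l *\<^sub>C h (head Q a) e1"
      unfolding act using clinear_onD(1)[OF hl cvec.subspace_scale[OF subY e0Y]] clinear_onD(2)[OF hl e0Y] by metis
    also have "h (head Q a) e0 = b k (head Q a)"
      using hg[OF e0X] e0X by (simp add: g_def \<phi>_def e0_def)
    finally have "act V a (h (tail Q a) e1) = f a *\<^sub>C b k (head Q a) + \<alpha> a l *\<^sub>C h (head Q a) e1"
      using hc[OF a e1Y[OF lS]] by simp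
    then have "cd (head Q a) k (act V a (h (tail Q a) e1)) = f a + \<alpha> a l * H (head Q a)"
      using kT cd_b[OF kK kK] by (simp add: cdD scaleC_complex H_def T_def)
    moreover have "h (tail Q a) e1 \<in> sp V (tail Q a)" using hI[OF e1Y[OF lS]] I_sp[OF S] by blast
    ultimately show ?thesis using cd_act[OF a _ kK] by (simp add: H_def)
  qed
  \<comment> \<open>At the tail, cutting off is harmless: if \<open>\<alpha> a k\<close> is nonzero,
    \<open>k\<close> is present there, and it is not a pivot since it is none at the head.\<close>
  define y where "y i = (if (i, k, l) \<in> chart_index S then H i else 0)" for i
  have "\<alpha> a k * y (tail Q a) - \<alpha> a l * y (head Q a) = f a"
    if a: "a \<in> arcs Q" and kl: "l \<in> S (tail Q a) \<and> k \<in> T (head Q a) - S (head Q a)" for a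
  proof -
    have "\<alpha> a k * y (tail Q a) = \<alpha> a k * H (tail Q a)"
    proof (cases "\<alpha> a k = 0")
      case False
      then have "k \<in> T (tail Q a) - S (tail Q a)" using alpha_T[OF a kK] cellsD(3)[OF S a, of k] kl by blast
      then show ?thesis using kl by (simp add: y_def chart_index_def)
    qed simp
    moreover have "\<alpha> a l * y (head Q a) = \<alpha> a l * H (head Q a)"
    proof (cases "\<alpha> a l = 0")
      case False
      then have "l \<in> S (head Q a)" using cellsD(3)[OF S a] kl by blast
      then show ?thesis using kl by (simp add: y_def chart_index_def)
    qed simp
    ultimately have "\<alpha> a k * y (tail Q a) - \<alpha> a l * y (head Q a) = \<alpha> a k * H (tail Q a) - \<alpha> a l * H (head Q a)"
      by (simp only:)
    also have "\<dots> = f a" using comm[OF a] kl by (simp add: algebra_simps)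
    finally show ?thesis .
  qed
  then show ?thesis by (intro exI[of _ y]) (auto simp: y_def)
qed

lemma ext_vanishes: "ext_vanishes S"
  unfolding ext_vanishes_def
proof (intro ballI impI allI)
  fix k l and f :: "'a \<Rightarrow> complex"
  assume k: "k \<in> K" and l: "l \<in> K" and "d l < d k"
  then have "l \<in> KP \<or> k \<in> KI" using d_PI[of k l] K_iff by force
  then show "\<exists>y. (\<forall>i. y i \<noteq> 0 \<longrightarrow> (i, k, l) \<in> chart_index S) \<and>
     (\<forall>a\<in>arcs Q. l \<in> S (tail Q a) \<and> k \<in> T (head Q a) - S (head Q a) \<longrightarrow>
        \<alpha> a k * y (tail Q a) - \<alpha> a l * y (head Q a) = f a)"
    using ext_solution_P[OF _ k] ext_solution_I[OF _ l] by blast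
qed

text \<open>The condition treats one pair \<open>(k, l)\<close> at a time, and for pairs in
  \<open>KP\<close> its ingredients are the same in P as in M.\<close>

lemma ext_vanishes_P: "GP.ext_vanishes (PS S)"
proof -
  have "(i, k, l) \<in> GP.chart_index (PS S) \<longleftrightarrow> (i, k, l) \<in> chart_index S"
    "l \<in> PS S i \<longleftrightarrow> l \<in> S i" "k \<in> GP.T i - PS S i \<longleftrightarrow> k \<in> T i - S i" if "k \<in> KP" "l \<in> KP" for i k l
    using that by (auto simp: GP.chart_index_def chart_index_def T_P PS_def)
  then show ?thesis
    using ext_vanishes unfolding ext_vanishes_def GP.ext_vanishes_def by (simp add: K_iff)
qed

lemma ext_vanishes_I: "GI.ext_vanishes (IS S)"
proof -
  have "(i, k, l) \<in> GI.chart_index (IS S) \<longleftrightarrow> (i, k, l) \<in> chart_index S"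
    "l \<in> IS S i \<longleftrightarrow> l \<in> S i" "k \<in> GI.T i - IS S i \<longleftrightarrow> k \<in> T i - S i" if "k \<in> KI" "l \<in> KI" for i k l
    using that by (auto simp: GI.chart_index_def chart_index_def T_I IS_def)
  then show ?thesis
    using ext_vanishes unfolding ext_vanishes_def GI.ext_vanishes_def by (simp add: K_iff)
qed

text \<open>Of the four blocks of a matrix, the one from I to P is absent by degree. The one from P
  to I has only positive degrees, so positivity is no restriction there and
  \<open>lin_block S KP KI\<close> appears without it. The linear equations do not connect different
  blocks.\<close>

lemma lift_iso_split:
  "lift_iso (affine_var (lin_coords S))
     (affine_var (GI.lin_coords (IS S) \<times> GP.lin_coords (PS S) \<times> lin_block S KP KI))"
proof -
  define B where "B x = (\<lambda>(i, k, l). if k \<in> KI \<and> l \<in> KP then x (i, k, l) else 0)"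
    for x :: "'v \<times> 'k \<times> 'k \<Rightarrow> complex"
  define F where "F x = (Ix x, Px x, B x)" for x
  have kl: "k \<in> KP \<or> k \<in> KI" "l \<in> KP \<or> l \<in> KI" if "(i, k, l) \<in> chart_index S" for i k l
    using that T_K S_K[OF cellsD(1)[OF S]] unfolding chart_index_def K_iff by blast+
  have disjD: "k \<in> KI \<Longrightarrow> k \<notin> KP" for k using disj by blast
  have lin: "x \<in> lin_coords S \<longleftrightarrow> (\<forall>i k l. x (i, k, l) \<noteq> 0 \<longrightarrow> (i, k, l) \<in> pos_index S) \<and>
      (\<forall>a\<in>arcs Q. \<forall>l\<in>S (tail Q a). \<forall>k\<in>T (head Q a) - S (head Q a).
        \<alpha> a k * x (tail Q a, k, l) = \<alpha> a l * x (head Q a, k, l))" for x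
    unfolding lin_coords_def by auto
  have linI: "x \<in> GI.lin_coords (IS S) \<longleftrightarrow> (\<forall>i k l. x (i, k, l) \<noteq> 0 \<longrightarrow> (i, k, l) \<in> pos_index S \<and> k \<in> KI \<and> l \<in> KI) \<and>
      (\<forall>a\<in>arcs Q. \<forall>l\<in>S (tail Q a) \<inter> KI. \<forall>k\<in>(T (head Q a) - S (head Q a)) \<inter> KI.
        \<alpha> a k * x (tail Q a, k, l) = \<alpha> a l * x (head Q a, k, l))" for x
  proof -
    have T: "GI.T j - IS S j = (T j - S j) \<inter> KI" for j by (auto simp: T_I IS_def)
    have pos: "(i, k, l) \<in> GI.pos_index (IS S) \<longleftrightarrow> (i, k, l) \<in> pos_index S \<and> k \<in> KI \<and> l \<in> KI" for i k l
      by (auto simp: GI.pos_index_def pos_index_def T_I IS_def)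
    show ?thesis
      unfolding GI.lin_coords_def mem_Collect_eq split_paired_All pos T unfolding IS_def
      by (intro conj_cong refl) blast
  qed
  have linP: "x \<in> GP.lin_coords (PS S) \<longleftrightarrow> (\<forall>i k l. x (i, k, l) \<noteq> 0 \<longrightarrow> (i, k, l) \<in> pos_index S \<and> k \<in> KP \<and> l \<in> KP) \<and>
      (\<forall>a\<in>arcs Q. \<forall>l\<in>S (tail Q a) \<inter> KP. \<forall>k\<in>(T (head Q a) - S (head Q a)) \<inter> KP.
        \<alpha> a k * x (tail Q a, k, l) = \<alpha> a l * x (head Q a, k, l))" for x
  proof -
    have T: "GP.T j - PS S j = (T j - S j) \<inter> KP" for j by (auto simp: T_P PS_def)
    have pos: "(i, k, l) \<in> GP.pos_index (PS S) \<longleftrightarrow> (i, k, l) \<in> pos_index S \<and> k \<in> KP \<and> l \<in> KP" for i k l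
      by (auto simp: GP.pos_index_def pos_index_def T_P PS_def)
    show ?thesis
      unfolding GP.lin_coords_def mem_Collect_eq split_paired_All pos T unfolding PS_def
      by (intro conj_cong refl) blast
  qed
  \<comment> \<open>Here the hypothesis that every degree on I exceeds every degree on P is
    used.\<close>
  have posB: "(i, k, l) \<in> pos_index S" if "(i, k, l) \<in> chart_index S" "k \<in> KI" "l \<in> KP" for i k l
    using that d_PI[of l k] by (auto simp: chart_index_def pos_index_def)
  have I_sub: "GI.lin_coords (IS S) \<subseteq> lin_coords S"
  proof
    fix x assume x: "x \<in> GI.lin_coords (IS S)"
    have "\<alpha> a k * x (tail Q a, k, l) = \<alpha> a l * x (head Q a, k, l)"
      if "a \<in> arcs Q" "l \<in> S (tail Q a)" "k \<in> T (head Q a) - S (head Q a)" for a k l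
    proof (cases "k \<in> KI \<and> l \<in> KI")
      case False
      then have "x (tail Q a, k, l) = 0" "x (head Q a, k, l) = 0" using x unfolding linI by blast+
      then show ?thesis by simp
    qed (use x that in \<open>simp add: linI\<close>)
    then show "x \<in> lin_coords S" using x unfolding lin linI by blast
  qed
  have P_sub: "GP.lin_coords (PS S) \<subseteq> lin_coords S"
  proof
    fix x assume x: "x \<in> GP.lin_coords (PS S)"
    have "\<alpha> a k * x (tail Q a, k, l) = \<alpha> a l * x (head Q a, k, l)"
      if "a \<in> arcs Q" "l \<in> S (tail Q a)" "k \<in> T (head Q a) - S (head Q a)" for a k l
    proof (cases "k \<in> KP \<and> l \<in> KP")
      case False
      then have "x (tail Q a, k, l) = 0" "x (head Q a, k, l) = 0" using x unfolding linP by blast+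
      then show ?thesis by simp
    qed (use x that in \<open>simp add: linP\<close>)
    then show "x \<in> lin_coords S" using x unfolding lin linP by blast
  qed
  have B_sub: "lin_block S KP KI \<subseteq> lin_coords S"
    unfolding lin lin_block_def subset_iff mem_Collect_eq using posB by blast
  have FI: "Ix x \<in> GI.lin_coords (IS S)" if "x \<in> lin_coords S" for x
    using that unfolding lin linI by (auto simp: Ix_def)
  have FP: "Px x \<in> GP.lin_coords (PS S)" if "x \<in> lin_coords S" for x
    using that unfolding lin linP by (auto simp: Px_def)
  have FB: "B x \<in> lin_block S KP KI" if "x \<in> lin_coords S" for x
    using that pos_chart_index[of S] unfolding lin lin_block_def by (auto simp: B_def)
  have sum: "x = Ix x + Px x + B x" if x: "x \<in> lin_coords S" for x
  proof
    fix p :: "'v \<times> 'k \<times> 'k"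
    obtain i k l where p: "p = (i, k, l)" by (metis prod_cases3)
    show "x p = (Ix x + Px x + B x) p"
    proof (cases "(i, k, l) \<in> pos_index S")
      case True
      then have "k \<in> KP \<or> k \<in> KI" "l \<in> KP \<or> l \<in> KI" "d l < d k"
        using kl pos_chart_index by (blast, blast, simp add: pos_index_def)
      then show ?thesis
        using d_PI[of k l] disjD[of k] disjD[of l] by (auto simp: p Ix_def Px_def B_def)
    next
      case False
      then have "x (i, k, l) = 0" using x unfolding lin by blast
      then show ?thesis by (simp add: p Ix_def Px_def B_def)
    qed
  qed
  have F_inv: "F (x + y + z) = (x, y, z)"
    if x: "x \<in> GI.lin_coords (IS S)" and y: "y \<in> GP.lin_coords (PS S)" and z: "z \<in> lin_block S KP KI" for x y z
  proof -
    have 0: "\<not> (k \<in> KI \<and> l \<in> KI) \<Longrightarrow> x (i, k, l) = 0" "\<not> (k \<in> KP \<and> l \<in> KP) \<Longrightarrow> y (i, k, l) = 0"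
      "\<not> (k \<in> KI \<and> l \<in> KP) \<Longrightarrow> z (i, k, l) = 0" for i k l
      using x y z unfolding linI linP lin_block_def by blast+
    have "Ix (x + y + z) (i, k, l) = x (i, k, l)" "Px (x + y + z) (i, k, l) = y (i, k, l)"
      "B (x + y + z) (i, k, l) = z (i, k, l)" for i k l
      using 0[of k l i] disjD[of k] disjD[of l]
      by (cases "k \<in> KI"; cases "l \<in> KI"; cases "k \<in> KP"; cases "l \<in> KP"; simp add: Ix_def Px_def B_def)+
    then show ?thesis by (auto simp: F_def fun_eq_iff)
  qed
  have bij: "bij_betw F (lin_coords S) (GI.lin_coords (IS S) \<times> GP.lin_coords (PS S) \<times> lin_block S KP KI)"
  proof (rule bij_betw_byWitness[where f' = "\<lambda>(x, y, z). x + y + z"])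
    show "\<forall>x\<in>lin_coords S. (case F x of (x, y, z) \<Rightarrow> x + y + z) = x"
      using sum by (simp add: F_def)
    show "\<forall>w\<in>GI.lin_coords (IS S) \<times> GP.lin_coords (PS S) \<times> lin_block S KP KI.
        F (case w of (x, y, z) \<Rightarrow> x + y + z) = w"
      using F_inv by auto
    show "F ` lin_coords S \<subseteq> GI.lin_coords (IS S) \<times> GP.lin_coords (PS S) \<times> lin_block S KP KI"
      using FI FP FB by (auto simp: F_def)
    show "(\<lambda>(x, y, z). x + y + z) ` (GI.lin_coords (IS S) \<times> GP.lin_coords (PS S) \<times> lin_block S KP KI) \<subseteq> lin_coords S"
      using I_sub P_sub B_sub cvec.subspace_add[OF subspace_lin_coords] by (auto simp: subset_iff)
  qed
  have "Ix (x + y) = Ix x + Ix y" "Px (x + y) = Px x + Px y" "B (x + y) = B x + B y"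
    "Ix (c *\<^sub>C x) = c *\<^sub>C Ix x" "Px (c *\<^sub>C x) = c *\<^sub>C Px x" "B (c *\<^sub>C x) = c *\<^sub>C B x" for x y c
    by (auto simp: Ix_def Px_def B_def scaleC_fun scaleC_complex intro!: HOL.ext)
  then have F_lin: "clinear_on (lin_coords S) F"
    by (simp add: clinear_on_def F_def scaleC_prod_def)
  have supp: "x p = 0" if "x \<in> lin_coords S" "p \<notin> chart_index S" for x p
    using that pos_chart_index[of S] unfolding lin_coords_def by blast
  obtain B0 where "finite B0" "lin_coords S = cvec.span B0"
    using finite_support_subspace[OF finite_chart_index[OF cellsD(1)[OF S]] subspace_lin_coords[of S]] supp by blast
  then show ?thesis using F_lin bij by (rule lift_iso_linear)
qed

end

section \<open>Isomorphism types of the cells\<close>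

lemma chart_0: "S \<in> cells e \<Longrightarrow> meet (chart S (\<lambda>_. 0)) I = GI.chart (IS S) (\<lambda>_. 0)"
  "S \<in> cells e \<Longrightarrow> proj_along P I (chart S (\<lambda>_. 0)) = GP.chart (PS S) (\<lambda>_. 0)"
  using meet_chart[OF _ zero_cell_coords] proj_chart[OF _ zero_cell_coords] by (auto simp: Ix_0 Px_0)

lemma lift_iso_lin_coords:
  assumes S: "S \<in> cells e"
  shows "lift_iso (subvar (quiver_grass_var Q V e) (attracting_set Q V e t (chart S (\<lambda>_. 0)))) (affine_var (lin_coords S))"
  unfolding attracting_set_cell[OF S]
  by (rule lift_iso_trans[OF lift_iso_cell[OF S] lift_iso_linearization[OF S ext_vanishes[OF S]]])

lemma cell_hom_pos:
  fixes W :: "('v, 'a, 'n::complex_vector) qrep"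
  assumes S: "S \<in> cells e" and quot: "is_quotient Q V (chart S (\<lambda>_. 0)) W q"
  shows "isomorphic_var (subvar (quiver_grass_var Q V e) (attracting_set Q V e t (chart S (\<lambda>_. 0))))
    (affine_var (hom_pos Q V (graded_part K b d) (chart S (\<lambda>_. 0)) W q))"
  by (rule lift_iso_isomorphic_var[OF lift_iso_trans[OF lift_iso_lin_coords[OF S] lift_iso_hom_pos[OF S quot]]])

lemma cellular_decomposition_split:
  "cellular_decomposition (quiver_grass_var Q V e) (fixed_points Q V e t) (attracting_set Q V e t)"
proof (rule cellular_decomposition_cells)
  fix S assume S: "S \<in> cells e"
  have supp: "x p = 0" if "x \<in> lin_coords S" "p \<notin> chart_index S" for x p
    using that pos_chart_index[of S] unfolding lin_coords_def by blast
  obtain B0 where "finite B0" "lin_coords S = cvec.span B0"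
    using finite_support_subspace[OF finite_chart_index[OF cellsD(1)[OF S]] subspace_lin_coords[of S]] supp by blast
  then obtain n where "lift_iso (affine_var (lin_coords S)) (affine_space n)" by (rule lift_iso_affine_space)
  then show "\<exists>n. isomorphic_var (subvar (quiver_grass_var Q V e) (chart S ` cell_coords S)) (affine_space n)"
    using lift_iso_lin_coords[OF S] lift_iso_trans lift_iso_isomorphic_var
    unfolding attracting_set_cell[OF S] by blast
qed

text \<open>The isomorphism passes through linear coordinates: the cell of M and the two cells in I
  and P are each linearized, and the linear coordinates of M split as a direct sum.\<close>

lemma cell_product:
  fixes W :: "('v, 'a, 'n::complex_vector) qrep"
  assumes S: "S \<in> cells e" and quot: "is_quotient Q (rep_of V I) (GI.chart (IS S) (\<lambda>_. 0)) W q"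
  shows "isomorphic_var (subvar (quiver_grass_var Q V e) (attracting_set Q V e t (chart S (\<lambda>_. 0))))
    (prod_var (subvar (quiver_grass_var Q (rep_of V I) (\<lambda>i. card (IS S i)))
        (attracting_set Q (rep_of V I) (\<lambda>i. card (IS S i)) t (GI.chart (IS S) (\<lambda>_. 0))))
      (prod_var (subvar (quiver_grass_var Q (rep_of V P) (\<lambda>i. e i - card (IS S i)))
          (attracting_set Q (rep_of V P) (\<lambda>i. e i - card (IS S i)) t (GP.chart (PS S) (\<lambda>_. 0))))
        (affine_var (rep_hom Q (rep_of V (GP.chart (PS S) (\<lambda>_. 0))) W))))"
proof -
  have affine_prod: "affine_var (A \<times> B) = prod_var (affine_var A) (affine_var B)"
    for A :: "('v \<times> 'k \<times> 'k \<Rightarrow> complex) set" and B :: "'z::complex_vector set"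
    by (simp add: affine_var_def prod_var_def map_prod.id)
  have IS: "(\<lambda>i. cvec.span ((\<lambda>k. b k i) ` (S i \<inter> KI))) = GI.chart (IS S) (\<lambda>_. 0)"
    using GI.coordinate_subspace[of _ "IS S"] by (simp add: IS_def)
  have PS: "source S KP = GP.chart (PS S) (\<lambda>_. 0)"
    using GP.coordinate_subspace[of _ "PS S"] by (auto simp: source_def PS_def)
  have "lift_iso (affine_var (lin_block S KP KI)) (affine_var (rep_hom Q (rep_of V (GP.chart (PS S) (\<lambda>_. 0))) W))"
    using lift_iso_block[OF S KP_K KI_K I_eq, unfolded IS PS, OF quot] .
  moreover have "lift_iso (affine_var (GI.lin_coords (IS S)))
      (subvar (quiver_grass_var Q (rep_of V I) (\<lambda>i. card (IS S i)))
        (attracting_set Q (rep_of V I) (\<lambda>i. card (IS S i)) t (GI.chart (IS S) (\<lambda>_. 0))))"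
    unfolding GI.attracting_set_cell[OF IS_cells[OF S]]
    by (rule lift_iso_sym[OF lift_iso_trans[OF GI.lift_iso_cell[OF IS_cells[OF S]]
          GI.lift_iso_linearization[OF IS_cells[OF S] ext_vanishes_I[OF S]]]])
  moreover have "lift_iso (affine_var (GP.lin_coords (PS S)))
      (subvar (quiver_grass_var Q (rep_of V P) (\<lambda>i. e i - card (IS S i)))
        (attracting_set Q (rep_of V P) (\<lambda>i. e i - card (IS S i)) t (GP.chart (PS S) (\<lambda>_. 0))))"
    unfolding GP.attracting_set_cell[OF PS_cells[OF S]]
    by (rule lift_iso_sym[OF lift_iso_trans[OF GP.lift_iso_cell[OF PS_cells[OF S]]
          GP.lift_iso_linearization[OF PS_cells[OF S] ext_vanishes_P[OF S]]]])
  ultimately show ?thesis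
    by (intro lift_iso_isomorphic_var lift_iso_trans[OF lift_iso_lin_coords[OF S]]
      lift_iso_trans[OF lift_iso_split[OF S, unfolded affine_prod]] lift_iso_prod)
qed

end

section \<open>From the data of the theorem to coordinates\<close>

lemma finite_dynkin_quiver:
  assumes "dynkin_quiver Q"
  shows "finite (verts Q)" "finite (arcs Q)" "wf_digraph Q"
proof -
  obtain n E \<sigma> where E: "dynkin_diagram n E" and \<sigma>: "bij_betw \<sigma> (verts Q) {..<n}"
    and bij: "bij_betw (\<lambda>a. {\<sigma> (tail Q a), \<sigma> (head Q a)}) (arcs Q) E" and "wf_digraph Q"
    using assms by (auto simp: dynkin_quiver_def)
  show "wf_digraph Q" by fact
  show "finite (verts Q)" using bij_betw_finite[OF \<sigma>] by simp
  have fin: "finite {{i, i + 1} |i. i + k < n}" for k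
  proof (rule finite_subset)
    show "{{i, i + 1} |i. i + k < n} \<subseteq> (\<lambda>i. {i, i + 1}) ` {..<n}" by auto
  qed simp
  from E have "finite E" by cases (simp_all only: finite_insert fin)
  then show "finite (arcs Q)" using bij_betw_finite[OF bij] by simp
qed

lemma span_singletonE:
  assumes "x \<in> cvec.span {y :: 'm::complex_vector}"
  obtains c where "x = c *\<^sub>C y"
  using assms by (auto simp: cvec.span_singleton)

text \<open>Independence comes from uniqueness of the decomposition of 0. It is stated for the
  multiples \<open>u k *\<^sub>C b k i\<close>, because a summand may vanish at
  \<open>i\<close>.\<close>

lemma direct_sum_span:
  fixes b :: "'k \<Rightarrow> 'v \<Rightarrow> 'm::complex_vector"
  assumes D: "direct_sum Q (rep_of M P) KP S" and P: "\<And>i. cvec.subspace (P i)"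
    and gen: "\<And>k i. k \<in> KP \<Longrightarrow> S k i = cvec.span {b k i}"
  shows "P i = cvec.span ((\<lambda>k. b k i) ` KP)"
    and "(\<Sum>k\<in>KP. u k *\<^sub>C b k i) = 0 \<Longrightarrow> k \<in> KP \<Longrightarrow> u k *\<^sub>C b k i = 0"
proof -
  have SP: "S k i \<subseteq> P i" if "k \<in> KP" for k using D that by (auto simp: direct_sum_def subrep_def rep_of_def)
  have bS: "b k i \<in> S k i" if "k \<in> KP" for k using gen[OF that] by (simp add: cvec.span_base)
  have ex1: "\<exists>!c. (\<forall>k\<in>KP. c k \<in> S k i) \<and> (\<forall>k. k \<notin> KP \<longrightarrow> c k = 0) \<and> x = (\<Sum>k\<in>KP. c k)" if "x \<in> P i" for x
    using D that by (simp add: direct_sum_def rep_of_def)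
  show "P i = cvec.span ((\<lambda>k. b k i) ` KP)"
  proof
    show "P i \<subseteq> cvec.span ((\<lambda>k. b k i) ` KP)"
    proof
      fix x assume "x \<in> P i"
      then obtain c where c: "\<forall>k\<in>KP. c k \<in> S k i" "x = (\<Sum>k\<in>KP. c k)" using ex1 by metis
      have "c k \<in> cvec.span ((\<lambda>k. b k i) ` KP)" if "k \<in> KP" for k
        using c(1) that gen[OF that] cvec.span_mono[of "{b k i}" "(\<lambda>k. b k i) ` KP"] by auto
      then show "x \<in> cvec.span ((\<lambda>k. b k i) ` KP)" unfolding c(2) by (rule cvec.span_sum)
    qed
    show "cvec.span ((\<lambda>k. b k i) ` KP) \<subseteq> P i"
      using bS SP by (intro cvec.span_minimal P) blast
  qed
  assume 0: "(\<Sum>k\<in>KP. u k *\<^sub>C b k i) = 0" and k: "k \<in> KP"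
  define c where "c k = (if k \<in> KP then u k *\<^sub>C b k i else 0)" for k
  have "\<forall>k\<in>KP. c k \<in> S k i" using gen by (auto simp: c_def intro: cvec.span_scale cvec.span_base)
  moreover have "0 = (\<Sum>k\<in>KP. c k)" using 0 by (simp add: c_def cong: sum.cong)
  moreover have "\<forall>k\<in>KP. 0 \<in> S k i" using gen by (auto simp: cvec.span_zero)
  ultimately have "c = (\<lambda>_. 0)"
    using ex1[OF cvec.subspace_0[OF P]] by (metis (mono_tags, lifting) c_def sum.neutral)
  then show "u k *\<^sub>C b k i = 0" using k by (metis c_def)
qed

theorem theorem5p1:
  fixes Q :: "('v, 'a) pre_digraph"
    and M :: "('v, 'a, 'm::complex_vector) qrep"
    and P I :: "'v \<Rightarrow> 'm set"
    and KP KI :: "'k set"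
    and S :: "'k \<Rightarrow> 'v \<Rightarrow> 'm set"
    and b :: "'k \<Rightarrow> 'v \<Rightarrow> 'm"
    and d :: "'k \<Rightarrow> int"
    and e :: "'v \<Rightarrow> nat"
    and t :: "complex \<Rightarrow> 'v \<Rightarrow> 'm \<Rightarrow> 'm"
    and X :: "('v \<Rightarrow> nat \<Rightarrow> 'm, 'v \<Rightarrow> 'm set) pvariety"
    and XT :: "('v \<Rightarrow> 'm set) set"
    and C :: "('v \<Rightarrow> 'm set) \<Rightarrow> ('v \<Rightarrow> 'm set) set"
  assumes dynkin: "dynkin_quiver Q"
    and M: "representation Q M"
    and M_sum: "direct_sum2 Q M P I"
    and P: "projective Q (rep_of M P)"
    and I: "injective Q (rep_of M I)"
    and P_sum: "direct_sum Q (rep_of M P) KP S"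
    and I_sum: "direct_sum Q (rep_of M I) KI S"
    and disj: "KP \<inter> KI = {}"
    and indec: "\<forall>k\<in>KP \<union> KI. indecomposable Q (rep_of M (S k))"
    and gen: "\<forall>k\<in>KP \<union> KI. \<forall>i. S k i = cvec.span {b k i}"
    and d_inj: "inj_on d (KP \<union> KI)"
    and d_hom: "\<forall>k\<in>KP \<union> KI. \<forall>l\<in>KP \<union> KI.
      \<not> rep_iso Q (rep_of M (S k)) (rep_of M (S l)) \<and>
      rep_hom Q (rep_of M (S k)) (rep_of M (S l)) \<noteq> {0} \<longrightarrow> d k < d l"
    and d_PI: "\<forall>k\<in>KP. \<forall>l\<in>KI. d k < d l"
    and e: "e = dimv P"
    and t: "t = torus_act (KP \<union> KI) b d"
    and X: "X = quiver_grass_var Q M e"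
    and XT: "XT = fixed_points Q M e t"
    and C: "C = attracting_set Q M e t"
  shows "(\<forall>L\<in>XT. \<forall>(W :: ('v, 'a, 'n::complex_vector) qrep) q. is_quotient Q M L W q \<longrightarrow>
            isomorphic_var (subvar X (C L))
              (affine_var (hom_pos Q M (graded_part (KP \<union> KI) b d) L W q))) \<and>
         cellular_decomposition X XT C \<and>
         (\<forall>L\<in>XT.
            let L\<^sub>I = meet L I; L\<^sub>P = proj_along P I L; f = dimv L\<^sub>I; g = (\<lambda>i. e i - f i);
                C\<^sub>I = attracting_set Q (rep_of M I) f t L\<^sub>I;
                C\<^sub>P = attracting_set Q (rep_of M P) g t L\<^sub>P
            in C L = {N \<in> stratum Q M P I e f. zeta P I N \<in> C\<^sub>I \<times> C\<^sub>P} \<and>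
               (\<forall>(W :: ('v, 'a, 'n2::complex_vector) qrep) q.
                  is_quotient Q (rep_of M I) L\<^sub>I W q \<longrightarrow>
                  isomorphic_var (subvar X (C L))
                    (prod_var (subvar (quiver_grass_var Q (rep_of M I) f) C\<^sub>I)
                      (prod_var (subvar (quiver_grass_var Q (rep_of M P) g) C\<^sub>P)
                        (affine_var (rep_hom Q (rep_of M L\<^sub>P) W))))))"
proof -
  define K where "K = KP \<union> KI"
  have finP: "finite KP" and finI: "finite KI" using P_sum I_sum by (auto simp: direct_sum_def)
  have fin_K: "finite K" by (simp add: K_def finP finI)
  have subP: "cvec.subspace (P i)" and subI: "cvec.subspace (I i)" and PM: "P i \<subseteq> sp M i" and IM: "I i \<subseteq> sp M i" for i
    using M_sum unfolding direct_sum2_def direct_sum_def subrep_def by (metis UNIV_I)+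
  have ex1: "\<exists>!c::bool \<Rightarrow> 'm. (\<forall>k. c k \<in> (if k then P else I) i) \<and> x = (\<Sum>k\<in>UNIV. c k)" if "x \<in> sp M i" for x i
    using M_sum that by (simp add: direct_sum2_def direct_sum_def)
  note gP = direct_sum_span[OF P_sum subP, of b] and gI = direct_sum_span[OF I_sum subI, of b]
  have P_eq: "P i = cvec.span ((\<lambda>k. b k i) ` KP)" for i by (rule gP(1)) (use gen in auto)
  have I_eq: "I i = cvec.span ((\<lambda>k. b k i) ` KI)" for i by (rule gI(1)) (use gen in auto)
  have sp_eq: "sp M i = cvec.span ((\<lambda>k. b k i) ` K)" for i
  proof
    show "sp M i \<subseteq> cvec.span ((\<lambda>k. b k i) ` K)"
    proof
      fix x assume "x \<in> sp M i"
      then obtain c :: "bool \<Rightarrow> 'm" where c: "\<forall>k. c k \<in> (if k then P else I) i" "x = (\<Sum>k\<in>UNIV. c k)"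
        using ex1 by blast
      have "c True \<in> P i" "c False \<in> I i" using c(1)[rule_format, of True] c(1)[rule_format, of False] by simp_all
      moreover have "x = c True + c False" using c(2) by (simp add: UNIV_bool)
      moreover have "P i \<subseteq> cvec.span ((\<lambda>k. b k i) ` K)" "I i \<subseteq> cvec.span ((\<lambda>k. b k i) ` K)"
        unfolding P_eq I_eq by (rule cvec.span_mono; auto simp: K_def)+
      ultimately show "x \<in> cvec.span ((\<lambda>k. b k i) ` K)" by (auto intro: cvec.span_add)
    qed
    have "(\<lambda>k. b k i) ` K \<subseteq> sp M i"
      using PM[of i] IM[of i] unfolding P_eq I_eq K_def by (auto intro: cvec.span_base)
    moreover have "cvec.subspace (sp M i)" using M unfolding representation_def by (metis cvec.subspace_span)
    ultimately show "cvec.span ((\<lambda>k. b k i) ` K) \<subseteq> sp M i" by (rule cvec.span_minimal)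
  qed
  have indep: "u k *\<^sub>C b k i = 0" if 0: "(\<Sum>k\<in>K. u k *\<^sub>C b k i) = 0" and k: "k \<in> K" for u k i
  proof -
    \<comment> \<open>The two partial sums decompose 0 along P and I, so each of them
      vanishes.\<close>
    define c where "c j = (if j then \<Sum>k\<in>KP. u k *\<^sub>C b k i else \<Sum>k\<in>KI. u k *\<^sub>C b k i)" for j
    have "(\<Sum>k\<in>KP. u k *\<^sub>C b k i) \<in> P i" "(\<Sum>k\<in>KI. u k *\<^sub>C b k i) \<in> I i"
      unfolding P_eq I_eq by (intro cvec.span_sum cvec.span_scale cvec.span_base; simp)+
    then have "\<forall>k. c k \<in> (if k then P else I) i" by (simp add: c_def)
    moreover have "0 = (\<Sum>k\<in>UNIV. c k)"
      using 0 disj finP finI by (simp add: K_def c_def UNIV_bool sum.union_disjoint add.commute)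
    moreover have "\<forall>k. 0 \<in> (if k then P else I) i" using cvec.subspace_0[OF subP] cvec.subspace_0[OF subI] by simp
    moreover have "0 \<in> sp M i" using PM cvec.subspace_0[OF subP] by blast
    ultimately have "c = (\<lambda>_. 0)" using ex1[of 0 i] by (metis (mono_tags, lifting) sum.neutral)
    then have "c True = 0" "c False = 0" by simp_all
    then have "(\<Sum>k\<in>KP. u k *\<^sub>C b k i) = 0" "(\<Sum>k\<in>KI. u k *\<^sub>C b k i) = 0" by (simp_all add: c_def)
    then show ?thesis using gP(2)[of u i k] gI(2)[of u i k] gen k by (auto simp: K_def)
  qed
  \<comment> \<open>The nonzero basis vectors at \<open>i\<close>. The definition of
    \<open>torus_act\<close> works with the set of these vectors, so they have to be matched with
    their indices.\<close>
  define J where "J i = {k \<in> K. b k i \<noteq> 0}" for i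
  have finJ: "finite (J i)" for i using fin_K by (simp add: J_def)
  have injJ: "inj_on (\<lambda>k. b k i) (J i)" for i
  proof (rule inj_onI, rule ccontr)
    fix k l assume kl: "k \<in> J i" "l \<in> J i" "b k i = b l i" "k \<noteq> l"
    \<comment> \<open>If two summands had the same nonzero vector at \<open>i\<close>, the
      coefficients 1 and -1 would give a nontrivial relation.\<close>
    define u :: "'k \<Rightarrow> complex" where "u m = (if m = k then 1 else if m = l then - 1 else 0)" for m
    have "(\<Sum>m\<in>K. u m *\<^sub>C b m i) = (\<Sum>m\<in>{k, l}. u m *\<^sub>C b m i)"
      using kl fin_K by (intro sum.mono_neutral_right) (auto simp: J_def u_def)
    also have "\<dots> = 0" using kl by (simp add: u_def)
    finally have "u k *\<^sub>C b k i = 0" using kl(1) by (intro indep) (auto simp: J_def)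
    then show False using kl(1) by (simp add: u_def J_def)
  qed
  have indJ: "\<not> cvec.dependent ((\<lambda>k. b k i) ` J i)" for i
  proof (subst cvec.dependent_finite)
    show "finite ((\<lambda>k. b k i) ` J i)" using finJ by simp
    show "\<not> (\<exists>u. (\<exists>v\<in>(\<lambda>k. b k i) ` J i. u v \<noteq> 0) \<and> (\<Sum>v\<in>(\<lambda>k. b k i) ` J i. u v *\<^sub>C v) = 0)"
    proof safe
      fix u k assume k: "k \<in> J i" "u (b k i) \<noteq> 0" and "(\<Sum>v\<in>(\<lambda>k. b k i) ` J i. u v *\<^sub>C v) = 0"
      then have "(\<Sum>k\<in>J i. u (b k i) *\<^sub>C b k i) = 0" by (simp add: sum.reindex[OF injJ])
      moreover have "(\<Sum>k\<in>K. u (b k i) *\<^sub>C b k i) = (\<Sum>k\<in>J i. u (b k i) *\<^sub>C b k i)"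
        using fin_K by (intro sum.mono_neutral_right) (auto simp: J_def)
      ultimately have "u (b k i) *\<^sub>C b k i = 0" using k(1) by (intro indep) (auto simp: J_def)
      then show False using k by (simp add: J_def)
    qed
  qed
  have "\<exists>c :: 'm \<Rightarrow> 'm \<Rightarrow> complex. (\<forall>\<beta>. Vector_Spaces.linear scaleC scaleC (c \<beta>)) \<and>
      (\<forall>\<beta>. \<forall>\<gamma>\<in>(\<lambda>k. b k i) ` J i. c \<beta> \<gamma> = (if \<gamma> = \<beta> then 1 else 0))" for i
    by (rule dual_functionals[OF indJ[of i]]) blast
  then obtain c where c_lin: "\<And>i \<beta>. Vector_Spaces.linear scaleC scaleC (c i \<beta> :: 'm \<Rightarrow> complex)"
    and c: "\<And>i \<beta> \<gamma>. \<gamma> \<in> (\<lambda>k. b k i) ` J i \<Longrightarrow> c i \<beta> \<gamma> = (if \<gamma> = \<beta> then 1 else 0)" by metis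
  \<comment> \<open>Dual functionals indexed by summands and not by vectors; a summand that is zero
    at \<open>i\<close> gets the zero functional.\<close>
  define cd where "cd i k = (if b k i = 0 then (\<lambda>_. 0) else c i (b k i))" for i k
  have cd_lin: "Vector_Spaces.linear scaleC scaleC (cd i k)" for i k
    using c_lin by (auto simp: cd_def intro: linearI)
  have cd_b: "cd i k (b l i) = (if k = l \<and> b l i \<noteq> 0 then 1 else 0)" if "k \<in> K" "l \<in> K" for i k l
  proof (cases "b k i = 0 \<or> b l i = 0")
    case True
    then show ?thesis using linearD(3)[OF c_lin] by (auto simp: cd_def)
  next
    case False
    then have "k \<in> J i" "l \<in> J i" using that by (auto simp: J_def)
    then show ?thesis using c[of "b l i" i "b k i"] injJ[of i] False by (auto simp: cd_def inj_on_def)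
  qed
  \<comment> \<open>The generators span one-dimensional or zero spaces preserved by the arrows, so
    this coordinate determines the image of the generator.\<close>
  define \<alpha> where "\<alpha> a k = cd (head Q a) k (act M a (b k (tail Q a)))" for a k
  have bS: "b k i \<in> S k i" if "k \<in> K" for k i using gen that by (auto simp: K_def intro: cvec.span_base)
  have act_b: "act M a (b k (tail Q a)) = \<alpha> a k *\<^sub>C b k (head Q a)" if a: "a \<in> arcs Q" and k: "k \<in> K" for a k
  proof -
    have "act M a ` S k (tail Q a) \<subseteq> S k (head Q a)"
    proof -
      have "subrep Q (rep_of M P) (S k) \<or> subrep Q (rep_of M I) (S k)"
        using P_sum I_sum k by (auto simp: K_def direct_sum_def)
      then show ?thesis using a by (elim disjE) (simp_all add: subrep_def rep_of_def)
    qed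
    then have "act M a (b k (tail Q a)) \<in> cvec.span {b k (head Q a)}"
      using bS[OF k] gen k by (auto simp: K_def)
    then obtain c where c: "act M a (b k (tail Q a)) = c *\<^sub>C b k (head Q a)" by (rule span_singletonE)
    then show ?thesis
      using cd_b[OF k k, of "head Q a"] linearD(2)[OF cd_lin] by (auto simp: \<alpha>_def scaleC_complex)
  qed
  have alpha_nz: "b k (tail Q a) \<noteq> 0 \<and> b k (head Q a) \<noteq> 0" if a: "a \<in> arcs Q" and nz: "\<alpha> a k \<noteq> 0" for a k
  proof -
    have "cvec.subspace (sp M (tail Q a))" using sp_eq by simp
    then have "act M a (0 *\<^sub>C 0) = 0 *\<^sub>C act M a 0"
      using M a cvec.subspace_0 unfolding representation_def by (intro clinear_onD(2)) auto
    then have "b k (tail Q a) \<noteq> 0" using nz linearD(3)[OF cd_lin] by (auto simp: \<alpha>_def)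
    moreover have "b k (head Q a) \<noteq> 0" using nz by (auto simp: \<alpha>_def cd_def)
    ultimately show ?thesis by blast
  qed
  have t_eq: "t z i x = (\<Sum>k\<in>K. (z powi d k * cd i k x) *\<^sub>C b k i)" if "x \<in> sp M i" for z x i
  proof -
    let ?B = "(\<lambda>k. b k i) ` J i"
    have B: "{b k i |k. k \<in> KP \<union> KI \<and> b k i \<noteq> 0} = ?B" by (auto simp: J_def K_def)
    have "cvec.span ?B = cvec.span ((\<lambda>k. b k i) ` K)"
    proof
      have "b k i \<in> cvec.span ?B" if "k \<in> K" for k
        using that by (cases "b k i = 0") (auto simp: J_def cvec.span_zero intro: cvec.span_base)
      then show "cvec.span ((\<lambda>k. b k i) ` K) \<subseteq> cvec.span ?B"
        by (intro cvec.span_minimal) auto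
    qed (rule cvec.span_mono, auto simp: J_def)
    then have x: "x \<in> cvec.span ?B" using that sp_eq by simp
    \<comment> \<open>The library coordinates with respect to the basis at \<open>i\<close> agree
      with the global functionals \<open>cd\<close> on the span; both are linear and agree on basis
      vectors.\<close>
    have rep: "cvec.representation ?B x (b k i) = cd i k x" if k: "k \<in> J i" for k
    proof -
      have "x \<in> cvec.span ?B \<and> cvec.representation ?B x (b k i) = cd i k x"
        using x
      proof (induction rule: cvec.span_induct_alt)
        case base
        then show ?case using linearD(3)[OF cd_lin] by (simp add: cvec.representation_zero cvec.span_zero)
      next
        case (step a v y)
        then have yB: "y \<in> cvec.span ?B" by blast
        obtain l where l: "l \<in> J i" "v = b l i" using step(1) by auto
        have vB: "v \<in> cvec.span ?B" using step(1) by (rule cvec.span_base)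
        have "cvec.representation ?B v (b k i) = cd i k v"
          using cvec.representation_basis[OF indJ step(1)] cd_b[of k l i] k l injJ[of i]
          by (auto simp: J_def inj_on_def)
        moreover have "cvec.representation ?B (a *\<^sub>C v + y) (b k i) =
            a * cvec.representation ?B v (b k i) + cvec.representation ?B y (b k i)"
          unfolding cvec.representation_add[OF indJ yB cvec.span_scale[OF vB]]
            cvec.representation_scale[OF indJ vB] ..
        moreover have "cd i k (a *\<^sub>C v + y) = a * cd i k v + cd i k y"
          by (simp add: linearD(1,2)[OF cd_lin] scaleC_complex)
        ultimately show ?case
          using step(2) cvec.span_add[OF cvec.span_scale[OF vB] yB] by simp
      qed
      then show ?thesis by blast
    qed
    have "t z i x = (\<Sum>k\<in>J i. cd i k x *\<^sub>C (z powi d k) *\<^sub>C b k i)"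
      unfolding t torus_act_def B unfolding K_def[symmetric] J_def[symmetric]
      by (rule sum.cong) (simp_all add: rep)
    also have "\<dots> = (\<Sum>k\<in>K. (z powi d k * cd i k x) *\<^sub>C b k i)"
      using fin_K by (intro sum.mono_neutral_cong_left) (auto simp: J_def scaleC_scaleC mult.commute)
    finally show ?thesis .
  qed
  interpret split_rep Q M K b d cd \<alpha> t KP KI P I
  proof (intro split_rep.intro coordinate_rep.intro split_rep_axioms.intro)
    show "inj_on d K" using d_inj by (simp add: K_def)
    show "d k < d l" if "k \<in> KP" "l \<in> KI" for k l using d_PI that by blast
    show "b k (tail Q a) \<noteq> 0 \<and> b k (head Q a) \<noteq> 0" if "a \<in> arcs Q" "\<alpha> a k \<noteq> 0" for a k
      by (rule alpha_nz[OF that])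
    show "t z i x = (\<Sum>k\<in>K. (z powi d k * cd i k x) *\<^sub>C b k i)" if "x \<in> sp M i" for z i x
      by (rule t_eq[OF that])
  qed (fact finite_dynkin_quiver[OF dynkin] M fin_K sp_eq cd_lin cd_b act_b K_def disj P_eq I_eq P I)+
  have XT_eq: "L \<in> XT \<longleftrightarrow> (\<exists>S\<in>cells e. L = chart S (\<lambda>_. 0))" for L
    unfolding XT fixed_points_cells by blast
  show ?thesis
  proof (intro conjI ballI allI impI)
    fix L and W :: "('v, 'a, 'n) qrep" and q
    assume "L \<in> XT" "is_quotient Q M L W q"
    then show "isomorphic_var (subvar X (C L)) (affine_var (hom_pos Q M (graded_part (KP \<union> KI) b d) L W q))"
      unfolding XT_eq X C K_def[symmetric] using cell_hom_pos by blast
  next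
    show "cellular_decomposition X XT C"
      unfolding X XT C by (rule cellular_decomposition_split)
  next
    fix L assume "L \<in> XT"
    then obtain S where S: "S \<in> cells e" and L: "L = chart S (\<lambda>_. 0)" using XT_eq by blast
    have f: "dimv (meet L I) = (\<lambda>i. card (IS S i))"
      unfolding L by (rule dimv_meet_chart[OF S zero_cell_coords[OF S]])
    have LI: "meet L I = GI.chart (IS S) (\<lambda>_. 0)" and LP: "proj_along P I L = GP.chart (PS S) (\<lambda>_. 0)"
      unfolding L by (rule chart_0[OF S])+
    show "let L\<^sub>I = meet L I; L\<^sub>P = proj_along P I L; f = dimv L\<^sub>I; g = (\<lambda>i. e i - f i);
              C\<^sub>I = attracting_set Q (rep_of M I) f t L\<^sub>I;
              C\<^sub>P = attracting_set Q (rep_of M P) g t L\<^sub>P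
          in C L = {N \<in> stratum Q M P I e f. zeta P I N \<in> C\<^sub>I \<times> C\<^sub>P} \<and>
             (\<forall>(W :: ('v, 'a, 'n2) qrep) q. is_quotient Q (rep_of M I) L\<^sub>I W q \<longrightarrow>
                isomorphic_var (subvar X (C L))
                  (prod_var (subvar (quiver_grass_var Q (rep_of M I) f) C\<^sub>I)
                    (prod_var (subvar (quiver_grass_var Q (rep_of M P) g) C\<^sub>P)
                      (affine_var (rep_hom Q (rep_of M L\<^sub>P) W)))))"
      unfolding Let_def f unfolding LI LP X C unfolding L
      by (intro conjI allI impI) (rule attracting_set_stratum[OF S], rule cell_product[OF S])
  qed
qed

end
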